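(* Let $g \in H_3\cap W(\mathbb{R})$, and let $$(a,b)\in\left\{\left(\tfrac{1}{\sqrt3},\tfrac{1}{\sqrt3}\right),\ \left(\tfrac{1}{2},\tfrac{1}{2}\right)\right\}.$$ Then the Gabor system $\mathcal{G}(g,a,b)$ is not a frame for $L^2(\mathbb{R})$. In particular, for each of these two pairs $(a,b)$ and each $n=4m+3$ with $m\in\mathbb{N}\cup\{0\}$, the Gabor system $\mathcal{G}(h_n,a,b)$ is not a frame for $L^2(\mathbb{R})$.
   Context: For $g\in L^2(\mathbb{R})$ and $a,b>0$, the Gabor system is $\mathcal{G}(g,a,b)=\{e^{2\pi i b m\,\cdot}g(\cdot-ak)\}_{k,m\in\mathbb{Z}}$. It is a frame for $L^2(\mathbb{R})$ if there exist constants $A,B>0$ such that $A\|f\|^2\le\sum_{k,m\in\mathbb{Z}}|\langle f,e^{2\pi i bm\,\cdot}g(\cdot-ak)\rangle|^2\le B\|f\|^2$ for all $f\in L^2(\mathbb{R})$. The Fourier transform is $\hat f(\gamma)=\mathcal{F}f(\gamma)=\int_{\mathbb{R}}f(x)e^{-2\pi i\gamma x}\,dx$ for $f\in L^1(\mathbb{R})$, extended as usual to $L^2(\mathbb{R})$. $H_3=\ker(\mathcal{F}-(-i)^3 I)\subset L^2(\mathbb{R})$ is the eigenspace of the Fourier transform for the eigenvalue $(-i)^3=i$. The Wiener space $W(\mathbb{R})$ consists of the functions $g\in L^\infty(\mathbb{R})$ with $\sum_{k\in\mathbb{Z}}\operatorname{ess\,sup}_{x\in[0,1]}|g(x+k)|<\infty$.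 The $n$th Hermite function is $h_n(x)=c_n^{-1/2}e^{\pi x^2}\frac{d^n}{dx^n}e^{-2\pi x^2}$ with $c_n=(2\pi)^n2^{n-1/2}n!$, $n\in\mathbb{N}\cup\{0\}$; it satisfies $\hat h_n=(-i)^nh_n$. *)

theory Defs
  imports "HOL-Analysis.Analysis" "HOL-Probability.Essential_Supremum"
begin

(* Elements of function spaces on the real line are represented by actual functions
   real => complex; the notions defined for them do not depend on values on null sets. *)

definition L2_sqnorm :: "(real \<Rightarrow> complex) \<Rightarrow> ennreal" where
  "L2_sqnorm f = (\<integral>\<^sup>+ x. ennreal ((norm (f x))\<^sup>2) \<partial>lebesgue)"

definition L2 :: "(real \<Rightarrow> complex) set" where
  "L2 = {f. f \<in> borel_measurable lebesgue \<and> L2_sqnorm f < \<infinity>}"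

definition L2_inner :: "(real \<Rightarrow> complex) \<Rightarrow> (real \<Rightarrow> complex) \<Rightarrow> complex" where
  "L2_inner f h = (LINT x|lebesgue. f x * cnj (h x))"

definition L2_frame :: "('i \<Rightarrow> real \<Rightarrow> complex) \<Rightarrow> bool" where
  "L2_frame e \<longleftrightarrow> (\<exists>A B :: real. A > 0 \<and> B > 0 \<and> (\<forall>f \<in> L2.
     ennreal A * L2_sqnorm f \<le> (\<Sum>\<^sub>\<infinity>i. ennreal ((norm (L2_inner f (e i)))\<^sup>2)) \<and>
     (\<Sum>\<^sub>\<infinity>i. ennreal ((norm (L2_inner f (e i)))\<^sup>2)) \<le> ennreal B * L2_sqnorm f))"

definition gabor_system ::
    "(real \<Rightarrow> complex) \<Rightarrow> real \<Rightarrow> real \<Rightarrow> int \<times> int \<Rightarrow> real \<Rightarrow> complex" where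
  "gabor_system g a b = (\<lambda>(k, m) x.
     exp (2 * of_real pi * \<i> * of_real (b * of_int m * x)) * g (x - a * of_int k))"

definition fourier_L1 :: "(real \<Rightarrow> complex) \<Rightarrow> real \<Rightarrow> complex" where
  "fourier_L1 f \<gamma> = (LINT x|lebesgue. f x * exp (- 2 * of_real pi * \<i> * of_real (\<gamma> * x)))"

(* "F is the Fourier transform of f" for f in L2: the graph of the continuous extension to L2
   of the integral transform on the dense subspace of integrable functions in L2. *)
definition is_fourier_L2 :: "(real \<Rightarrow> complex) \<Rightarrow> (real \<Rightarrow> complex) \<Rightarrow> bool" where
  "is_fourier_L2 f F \<longleftrightarrow> f \<in> L2 \<and> F \<in> L2 \<and>
     (\<exists>\<phi> :: nat \<Rightarrow> real \<Rightarrow> complex.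
        (\<forall>n. integrable lebesgue (\<phi> n) \<and> \<phi> n \<in> L2) \<and>
        (\<lambda>n. L2_sqnorm (\<lambda>x. \<phi> n x - f x)) \<longlonglongrightarrow> 0 \<and>
        (\<lambda>n. L2_sqnorm (\<lambda>\<gamma>. fourier_L1 (\<phi> n) \<gamma> - F \<gamma>)) \<longlonglongrightarrow> 0)"

definition fourier_eigenspace :: "nat \<Rightarrow> (real \<Rightarrow> complex) set" where
  "fourier_eigenspace j = {f \<in> L2. is_fourier_L2 f (\<lambda>\<gamma>. (- \<i>) ^ j * f \<gamma>)}"

definition wiener_space :: "(real \<Rightarrow> complex) set" where
  "wiener_space = {g. g \<in> borel_measurable lebesgue \<and>
     esssup lebesgue (\<lambda>x. ennreal (norm (g x))) < \<infinity> \<and>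
     (\<Sum>\<^sub>\<infinity>k::int. esssup (lebesgue_on {0..1}) (\<lambda>x. ennreal (norm (g (x + of_int k))))) < \<infinity>}"

definition hermite_const :: "nat \<Rightarrow> real" where
  "hermite_const n = (2 * pi) ^ n * 2 powr (real n - 1 / 2) * fact n"

definition hermite_fun :: "nat \<Rightarrow> real \<Rightarrow> real" where
  "hermite_fun n x = hermite_const n powr (- 1 / 2) * exp (pi * x\<^sup>2) *
     (deriv ^^ n) (\<lambda>y. exp (- 2 * pi * y\<^sup>2)) x"

end

theory Submission
  imports Defs "HOL-Probability.Sinc_Integral" "HOL-Probability.Characteristic_Functions"
    "HOL-Computational_Algebra.Polynomial"
begin

text \<open>The obstruction is a Dirac comb. Write \<open>p = sqrt N\<close> with \<open>N = 3\<close> or \<open>N = 4\<close>, so that both parameter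
  pairs are \<open>a = b = 1 / p\<close>. Formally, the inner product of the comb \<open>\<Sum>j. \<delta>(x - j * p)\<close> with the Gabor atom of
  index \<open>(k, m)\<close> is the conjugate of \<open>\<Sum>j. g (j * p - k / p)\<close>: the modulations are \<open>p\<close>-periodic and drop
  out. So if the sums of \<open>g\<close> over all cosets of \<open>p \<int>\<close> in \<open>(1 / p) \<int>\<close> vanish, the comb is orthogonal to
  the whole system, and truncated, slightly smeared combs show that there is no lower frame bound.

  The coset sums vanish for an algebraic reason. A function in \<open>H\<^sub>3\<close> that lies in the Wiener space has a
  continuous representative \<open>G\<close> with \<open>fourier_L1 G x = \<i> * G x\<close> at every \<open>x\<close>. The lattices \<open>p \<int>\<close> and
  \<open>(1 / p) \<int>\<close> are dual to each other, so the Poisson formula, applied to the cosets of \<open>p \<int>\<close>, says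
    \<open>\<i> * p * S r = \<Sum>r' < N. S r' * exp (- 2 * pi * \<i> * r * r' / N)\<close>
  for the \<open>N\<close> coset sums \<open>S r\<close>. Thus \<open>S\<close> is either \<open>0\<close> or an eigenvector of the unitary discrete Fourier
  transform of order \<open>N\<close> for the eigenvalue \<open>\<i>\<close>. For \<open>N = 3\<close> and \<open>N = 4\<close> that matrix has no such
  eigenvalue, hence \<open>S = 0\<close>.

  The steps are carried by \<open>eigenfunction_representative\<close>, \<open>poisson_summation\<close>, \<open>lattice_sums_vanish\<close> and
  \<open>not_frame_if_lattice_sums_vanish\<close>. The Poisson formula is needed for functions that are merely
  continuous with a transform in the Wiener space, which is why it is proved by Fejer summation. The
  Hermite functions of index \<open>4 * m + 3\<close> are Gaussians times polynomials, hence in the Wiener space, and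
  their eigenvalue follows from the recursion of the polynomials (\<open>fourier_L1_hermite_poly\<close>).\<close>

section \<open>The Fourier integral\<close>

definition wave :: "real \<Rightarrow> complex" where
  "wave t = cis (2 * pi * t)"

lemma norm_wave [simp]: "norm (wave t) = 1"
  by (simp add: wave_def)

lemma wave_add: "wave (s + t) = wave s * wave t"
  by (simp add: wave_def cis_mult distrib_left)

lemma wave_0 [simp]: "wave 0 = 1"
  by (simp add: wave_def)

lemma wave_int [simp]: "wave (of_int n) = 1"
  using cis_multiple_2pi[of "of_int n"] by (simp add: wave_def)

lemma wave_minus: "wave (- t) = cnj (wave t)"
  by (simp add: wave_def cis_cnj)

lemma wave_continuous [continuous_intros]:
  "continuous_on S f \<Longrightarrow> continuous_on S (\<lambda>x. wave (f x))"
  unfolding wave_def by (intro continuous_intros)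

lemma wave_measurable [measurable]: "wave \<in> borel_measurable borel"
  by (intro borel_measurable_continuous_onI continuous_intros)

lemma exp_eq_wave: "exp (2 * of_real pi * \<i> * of_real t) = wave t"
  by (simp add: wave_def cis_conv_exp mult_ac)

lemma fourier_L1_wave: "fourier_L1 f \<gamma> = (LINT x|lebesgue. f x * wave (- (\<gamma> * x)))"
  unfolding fourier_L1_def exp_eq_wave[symmetric] by simp

text \<open>Dominated convergence along sequences. The domination is only asked for near the point,
  because lattice sums such as \<open>\<Sum>n. G (t + n * p)\<close> have a summable majorant that is uniform in
  \<open>t\<close> only on bounded sets.\<close>
lemma isCont_integral_dominated:
  fixes f :: "real \<Rightarrow> 'a \<Rightarrow> 'b::{banach, second_countable_topology}"
  assumes meas: "\<And>t. f t \<in> borel_measurable M" and w: "integrable M w" and d: "d > 0"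
    and bound: "\<And>t x. x \<in> space M \<Longrightarrow> \<bar>t - t0\<bar> < d \<Longrightarrow> norm (f t x) \<le> w x"
    and cont: "\<And>x. x \<in> space M \<Longrightarrow> isCont (\<lambda>t. f t x) t0"
  shows "isCont (\<lambda>t. LINT x|M. f t x) t0"
  unfolding continuous_at_sequentially comp_def
proof (intro allI impI)
  fix X :: "nat \<Rightarrow> real" assume X: "X \<longlonglongrightarrow> t0"
  then obtain N where N: "\<And>n. n \<ge> N \<Longrightarrow> \<bar>X n - t0\<bar> < d"
    using d unfolding LIMSEQ_def dist_real_def by blast
  show "(\<lambda>n. LINT x|M. f (X n) x) \<longlonglongrightarrow> (LINT x|M. f t0 x)"
  proof (rule LIMSEQ_offset[where k = N], rule integral_dominated_convergence[OF meas meas w])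
    show "AE x in M. (\<lambda>n. f (X (n + N)) x) \<longlonglongrightarrow> f t0 x"
      using isCont_tendsto_compose[OF cont LIMSEQ_ignore_initial_segment[OF X]] by (intro AE_I2)
    show "AE x in M. norm (f (X (n + N)) x) \<le> w x" for n
      using bound N by (intro AE_I2) auto
  qed
qed

lemma borel_imp_lebesgue_measurable:
  "f \<in> borel_measurable borel \<Longrightarrow> f \<in> borel_measurable lebesgue"
  for f :: "real \<Rightarrow> 'a::topological_space"
  by (rule measurable_completion) simp

lemma integrable_mult_wave:
  assumes "integrable lebesgue f"
  shows "integrable lebesgue (\<lambda>x. f x * wave (c * x))"
proof -
  have [measurable]: "(\<lambda>x. wave (c * x)) \<in> borel_measurable lebesgue"
    by (rule borel_imp_lebesgue_measurable) measurable
  note [measurable] = borel_measurable_integrable[OF assms]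
  show ?thesis
    by (rule Bochner_Integration.integrable_bound[OF integrable_norm[OF assms]])
       (auto simp: norm_mult)
qed

lemma isCont_fourier_L1:
  assumes "integrable lebesgue f"
  shows "isCont (fourier_L1 f) \<gamma>"
  unfolding fourier_L1_wave[abs_def]
proof (rule isCont_integral_dominated[OF _ integrable_norm[OF assms] zero_less_one])
  show "(\<lambda>x. f x * wave (- (t * x))) \<in> borel_measurable lebesgue" for t
    using integrable_mult_wave[OF assms, of "- t"] by auto
  show "isCont (\<lambda>t. f x * wave (- (t * x))) \<gamma>" for x
  proof -
    have "continuous_on UNIV (\<lambda>t. f x * wave (- (t * x)))" by (intro continuous_intros)
    from this show ?thesis by (simp add: continuous_on_eq_continuous_at)
  qed
  show "norm (f x * wave (- (t * x))) \<le> norm (f x)" for t x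
    by (simp add: norm_mult)
qed

lemma sigma_finite_lebesgue: "sigma_finite_measure (lebesgue :: real measure)"
proof (unfold sigma_finite_measure_def)
  have "\<Union> (range (\<lambda>n::nat. {- real n..real n})) = UNIV"
  proof (rule set_eqI)
    fix x :: real
    obtain n where "\<bar>x\<bar> \<le> real n" using real_arch_simple by blast
    then have "x \<in> {- real n..real n}" by auto
    then show "x \<in> \<Union> (range (\<lambda>n::nat. {- real n..real n})) \<longleftrightarrow> x \<in> UNIV" by blast
  qed
  then show "\<exists>A::real set set. countable A \<and> A \<subseteq> sets lebesgue \<and> \<Union>A = space lebesgue \<and> (\<forall>a\<in>A. emeasure lebesgue a \<noteq> \<infinity>)"
    by (intro exI[of _ "range (\<lambda>n::nat. {- real n..real n})"]) auto
qed

text \<open>The multiplication formula: both sides are the double integral of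
  \<open>\<psi> \<gamma> * f x * wave (- \<gamma> * x)\<close>, and Fubini applies because \<open>f\<close> and \<open>\<psi>\<close> are integrable.\<close>
lemma fourier_L1_duality:
  assumes f: "integrable lebesgue f" and \<psi>: "integrable lborel \<psi>"
  shows "(LINT \<gamma>|lebesgue. \<psi> \<gamma> * fourier_L1 f \<gamma>) = (LINT x|lebesgue. f x * fourier_L1 \<psi> x)"
proof -
  interpret P: pair_sigma_finite "lborel :: real measure" "lebesgue :: real measure"
    by (intro pair_sigma_finite.intro sigma_finite_lborel sigma_finite_lebesgue)
  note [measurable] = borel_measurable_integrable[OF f] borel_measurable_integrable[OF \<psi>]
  have id_meas: "(\<lambda>x. x) \<in> borel_measurable (lebesgue :: real measure)"
    by (rule borel_imp_lebesgue_measurable) measurable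
  have snd_meas [measurable]: "snd \<in> (lborel \<Otimes>\<^sub>M lebesgue) \<rightarrow>\<^sub>M (borel :: real measure)"
    using measurable_comp[OF measurable_snd id_meas] by (simp add: comp_def)
  have w[measurable]: "(\<lambda>p. wave (- (fst p * snd p))) \<in> borel_measurable (lborel \<Otimes>\<^sub>M lebesgue)"
    by measurable
  define F where "F = (\<lambda>(\<gamma>, x). \<psi> \<gamma> * (f x * wave (- (\<gamma> * x))))"
  have int: "integrable (lborel \<Otimes>\<^sub>M lebesgue) F"
  proof (rule P.Fubini_integrable)
    show "F \<in> borel_measurable (lborel \<Otimes>\<^sub>M lebesgue)"
      using w unfolding F_def split_beta' by measurable
    have "integrable lborel (\<lambda>\<gamma>. norm (\<psi> \<gamma>) * (LINT x|lebesgue. norm (f x)))"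
      using \<psi> by auto
    then show "integrable lborel (\<lambda>\<gamma>. LINT x|lebesgue. norm (F (\<gamma>, x)))"
      by (simp add: F_def norm_mult)
    show "AE \<gamma> in lborel. integrable lebesgue (\<lambda>x. F (\<gamma>, x))"
    proof (rule AE_I2)
      fix \<gamma>
      show "integrable lebesgue (\<lambda>x. F (\<gamma>, x))"
        using integrable_mult_right[OF integrable_mult_wave[OF f, of "- \<gamma>"], of "\<psi> \<gamma>"]
        by (simp add: F_def)
    qed
  qed
  have cf: "continuous_on UNIV (fourier_L1 h)" if "integrable lebesgue h" for h
    using isCont_fourier_L1[OF that] by (simp add: continuous_at_imp_continuous_on)
  have [measurable]: "fourier_L1 f \<in> borel_measurable borel"
    by (intro borel_measurable_continuous_onI cf f)
  have "(LINT \<gamma>|lebesgue. \<psi> \<gamma> * fourier_L1 f \<gamma>) = (LINT \<gamma>|lborel. \<psi> \<gamma> * fourier_L1 f \<gamma>)"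
    by (rule integral_completion) measurable
  also have "\<dots> = (LINT \<gamma>|lborel. LINT x|lebesgue. \<psi> \<gamma> * (f x * wave (- (\<gamma> * x))))"
    by (simp add: fourier_L1_wave)
  also have "\<dots> = (LINT x|lebesgue. LINT \<gamma>|lborel. \<psi> \<gamma> * (f x * wave (- (\<gamma> * x))))"
    using P.Fubini_integral[of "\<lambda>\<gamma> x. \<psi> \<gamma> * (f x * wave (- (\<gamma> * x)))"] int by (simp add: F_def)
  also have "\<dots> = (LINT x|lebesgue. f x * fourier_L1 \<psi> x)"
  proof (rule Bochner_Integration.integral_cong[OF refl])
    fix x
    have "(LINT \<gamma>|lborel. \<psi> \<gamma> * (f x * wave (- (\<gamma> * x)))) = f x * (LINT \<gamma>|lborel. \<psi> \<gamma> * wave (- (x * \<gamma>)))"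
      by (subst integral_mult_right_zero[symmetric]) (simp add: mult_ac)
    also have "(LINT \<gamma>|lborel. \<psi> \<gamma> * wave (- (x * \<gamma>))) = fourier_L1 \<psi> x"
      unfolding fourier_L1_wave by (rule integral_completion[symmetric]) measurable
    finally show "(LINT \<gamma>|lborel. \<psi> \<gamma> * (f x * wave (- (\<gamma> * x)))) = f x * fourier_L1 \<psi> x" .
  qed
  finally show ?thesis .
qed

section \<open>The Fourier transform on square-integrable functions\<close>

lemma integrable_inverse_1_plus_sq: "integrable lborel (\<lambda>x::real. inverse (1 + x\<^sup>2))"
  using integrable_inverse_1_plus_square
  by (simp add: set_integrable_def einterval_def)

text \<open>The transform of an interval is a sinc function: it is at most the length of the interval,
  and integrating the exponential gives the decay \<open>1 / \<bar>x\<bar>\<close>.\<close>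
lemma fourier_L1_interval_decay:
  assumes "c \<le> d"
  shows "(1 + x\<^sup>2) * (norm (fourier_L1 (indicator {c..d}) x))\<^sup>2 \<le> (d - c)\<^sup>2 + 1"
proof -
  define I where "I = fourier_L1 (indicator {c..d}) x"
  have I: "I = (LINT t|lborel. indicator {c..d} t *\<^sub>R wave (- (x * t)))"
    unfolding I_def fourier_L1_wave
    by (subst integral_completion) (auto simp: indicator_def intro!: Bochner_Integration.integral_cong)
  have "norm I \<le> (LINT t|lborel. indicator {c..d} t)"
    unfolding I by (rule order.trans[OF integral_norm_bound]) (simp add: norm_mult)
  then have 1: "norm I \<le> d - c" using assms by simp
  have 2: "\<bar>x\<bar> * norm I \<le> 1"
  proof (cases "x = 0")
    case False
    define k where "k = - (2 * complex_of_real pi * \<i> * complex_of_real x)"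
    have k: "k \<noteq> 0" using False by (simp add: k_def)
    have wk: "wave (- (x * t)) = exp (k * of_real t)" for t
      unfolding exp_eq_wave[symmetric] k_def by (simp add: mult_ac)
    have "I = exp (k * of_real d) / k - exp (k * of_real c) / k"
      unfolding I wk
    proof (rule integral_FTC_Icc[OF assms])
      show "((\<lambda>t. exp (k * complex_of_real t) / k) has_vector_derivative exp (k * complex_of_real t)) (at t within {c..d})" for t
        using k by (auto intro!: derivative_eq_intros has_vector_derivative_real_field
             simp: field_simps)
      show "continuous_on {c..d} (\<lambda>t. exp (k * complex_of_real t))"
        by (intro continuous_intros)
    qed
    then have "k * I = wave (- (x * d)) - wave (- (x * c))"
      unfolding wk using k by (simp add: field_simps)
    then have "norm (k * I) \<le> norm (wave (- (x * d))) + norm (wave (- (x * c)))"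
      by (metis norm_triangle_ineq4)
    then have "2 * pi * (\<bar>x\<bar> * norm I) \<le> 2"
      by (simp add: norm_mult k_def mult_ac)
    moreover have "2 * 1 * (\<bar>x\<bar> * norm I) \<le> 2 * pi * (\<bar>x\<bar> * norm I)"
      using pi_ge_two by (intro mult_right_mono mult_left_mono) auto
    ultimately show ?thesis by simp
  qed simp
  have "(norm I)\<^sup>2 \<le> (d - c)\<^sup>2" using 1 by (intro power_mono) auto
  moreover have "(\<bar>x\<bar> * norm I)\<^sup>2 \<le> 1\<^sup>2" using 2 by (intro power_mono) auto
  ultimately show ?thesis unfolding I_def[symmetric] by (simp add: algebra_simps power_mult_distrib)
qed

lemma L2_measurable: "f \<in> L2 \<Longrightarrow> f \<in> borel_measurable lebesgue"
  by (simp add: L2_def)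

lemma decay_imp_L2:
  assumes "f \<in> borel_measurable borel" "\<And>x. (1 + x\<^sup>2) * (norm (f x))\<^sup>2 \<le> C"
  shows "f \<in> L2"
proof -
  have "L2_sqnorm f \<le> (\<integral>\<^sup>+ x. ennreal (C * inverse (1 + x\<^sup>2)) \<partial>lborel)"
    unfolding L2_sqnorm_def nn_integral_completion
  proof (rule nn_integral_mono)
    fix x :: real
    have "1 + x\<^sup>2 > 0" by (simp add: add_pos_nonneg)
    then have "(norm (f x))\<^sup>2 \<le> C * inverse (1 + x\<^sup>2)"
      using assms(2)[of x] by (simp add: field_simps)
    then show "ennreal ((norm (f x))\<^sup>2) \<le> ennreal (C * inverse (1 + x\<^sup>2))"
      by (rule ennreal_leI)
  qed
  also have "\<dots> < \<infinity>"
  proof (rule le_less_trans)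
    show "(\<integral>\<^sup>+ x. ennreal (C * inverse (1 + x\<^sup>2)) \<partial>lborel)
        \<le> (\<integral>\<^sup>+ x. ennreal (norm (C * inverse (1 + x\<^sup>2))) \<partial>lborel)"
      by (intro nn_integral_mono ennreal_leI) simp
    show "(\<integral>\<^sup>+ x. ennreal (norm (C * inverse (1 + x\<^sup>2))) \<partial>lborel) < \<infinity>"
      using integrable_mult_right[OF integrable_inverse_1_plus_sq, of C]
      unfolding integrable_iff_bounded by blast
  qed
  finally show ?thesis
    using borel_imp_lebesgue_measurable[OF assms(1)] by (simp add: L2_def)
qed

lemma integrable_indicator_Icc: "integrable lborel (indicator {c..d :: real} :: real \<Rightarrow> complex)"
proof -
  have "integrable lborel (\<lambda>x. indicator {c..d} x *\<^sub>R (1::complex))"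
    by (intro integrable_scaleR_left impI integrable_real_indicator) (auto simp: emeasure_lborel_Icc_eq)
  moreover have "(\<lambda>x. indicator {c..d} x *\<^sub>R 1) = (indicator {c..d} :: real \<Rightarrow> complex)"
    by (auto simp: indicator_def)
  ultimately show ?thesis by simp
qed

lemma fourier_L1_interval_L2: "c \<le> d \<Longrightarrow> fourier_L1 (indicator {c..d}) \<in> L2"
proof (rule decay_imp_L2[OF _ fourier_L1_interval_decay])
  have "integrable lebesgue (indicator {c..d} :: real \<Rightarrow> complex)"
    using integrable_indicator_Icc[of c d]
    by (subst integrable_completion) (auto intro: borel_measurable_integrable)
  then show "fourier_L1 (indicator {c..d}) \<in> borel_measurable borel"
    by (intro borel_measurable_continuous_onI) (simp add: isCont_fourier_L1 continuous_at_imp_continuous_on)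
qed

lemma Cauchy_Schwarz_L2:
  assumes "f \<in> borel_measurable lebesgue" "h \<in> borel_measurable lebesgue"
  shows "(\<integral>\<^sup>+ x. ennreal (norm (f x * h x)) \<partial>lebesgue)\<^sup>2 \<le> L2_sqnorm f * L2_sqnorm h"
proof -
  note [measurable] = assms
  show ?thesis
    using Cauchy_Schwarz_nn_integral[of "\<lambda>x. ennreal (norm (f x))" lebesgue "\<lambda>x. ennreal (norm (h x))"]
    unfolding L2_sqnorm_def by (simp add: norm_mult ennreal_mult ennreal_power)
qed

lemma L2_mult_integrable:
  assumes "f \<in> L2" "h \<in> L2"
  shows "integrable lebesgue (\<lambda>x. f x * h x)"
proof -
  note [measurable] = assms[THEN L2_measurable]
  have "(\<integral>\<^sup>+ x. ennreal (norm (f x * h x)) \<partial>lebesgue)\<^sup>2 < \<infinity>"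
    using Cauchy_Schwarz_L2[of f h] assms
    by (auto simp: L2_def ennreal_mult_less_top intro: order_le_less_trans)
  then show ?thesis
    by (intro integrableI_bounded) (auto simp: power_less_top_ennreal)
qed

text \<open>Weak convergence from norm convergence, by Cauchy-Schwarz.\<close>
lemma L2_pairing_tendsto:
  assumes K: "K \<in> L2" and f: "f \<in> L2" and \<phi>: "\<And>n. \<phi> n \<in> L2"
    and lim: "(\<lambda>n. L2_sqnorm (\<lambda>x. \<phi> n x - f x)) \<longlonglongrightarrow> 0"
  shows "(\<lambda>n. LINT x|lebesgue. K x * \<phi> n x) \<longlonglongrightarrow> (LINT x|lebesgue. K x * f x)"
proof -
  note [measurable] = K[THEN L2_measurable] f[THEN L2_measurable] \<phi>[THEN L2_measurable]
  define e where "e n = norm ((LINT x|lebesgue. K x * \<phi> n x) - (LINT x|lebesgue. K x * f x))" for n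
  have le: "ennreal ((e n)\<^sup>2) \<le> L2_sqnorm K * L2_sqnorm (\<lambda>x. \<phi> n x - f x)" for n
  proof -
    have "e n = norm (LINT x|lebesgue. K x * (\<phi> n x - f x))"
      unfolding e_def
      by (subst Bochner_Integration.integral_diff[symmetric])
         (auto intro!: L2_mult_integrable K f \<phi> simp: algebra_simps)
    moreover have "ennreal (norm (LINT x|lebesgue. K x * (\<phi> n x - f x)))
        \<le> (\<integral>\<^sup>+ x. ennreal (norm (K x * (\<phi> n x - f x))) \<partial>lebesgue)"
      by (rule integral_norm_bound_ennreal)
         (simp add: algebra_simps Bochner_Integration.integrable_diff L2_mult_integrable K f \<phi>)
    ultimately have "ennreal (e n) ^ 2 \<le> (\<integral>\<^sup>+ x. ennreal (norm (K x * (\<phi> n x - f x))) \<partial>lebesgue) ^ 2"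
      by (intro power_mono) auto
    also have "\<dots> \<le> L2_sqnorm K * L2_sqnorm (\<lambda>x. \<phi> n x - f x)"
      by (rule Cauchy_Schwarz_L2) measurable
    finally show ?thesis by (simp add: ennreal_power e_def)
  qed
  have "(\<lambda>n. L2_sqnorm K * L2_sqnorm (\<lambda>x. \<phi> n x - f x)) \<longlonglongrightarrow> L2_sqnorm K * 0"
    using K by (intro tendsto_mult_ennreal tendsto_const lim) (auto simp: L2_def)
  then have "(\<lambda>n. ennreal ((e n)\<^sup>2)) \<longlonglongrightarrow> 0"
    using tendsto_sandwich[of "\<lambda>_. 0" "\<lambda>n. ennreal ((e n)\<^sup>2)" sequentially
          "\<lambda>n. L2_sqnorm K * L2_sqnorm (\<lambda>x. \<phi> n x - f x)" 0] le by simp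
  then have "(\<lambda>n. (e n)\<^sup>2) \<longlonglongrightarrow> 0"
    by (simp flip: ennreal_0 add: tendsto_ennreal_iff)
  then have "(\<lambda>n. sqrt ((e n)\<^sup>2)) \<longlonglongrightarrow> sqrt 0"
    by (rule tendsto_real_sqrt)
  then show ?thesis
    unfolding e_def by (simp add: tendsto_norm_zero_iff LIM_zero_iff)
qed

text \<open>The Borel sets over which the integral vanishes are closed under complements (the total
  integral vanishes too, as a limit over growing intervals) and countable disjoint unions, so all
  Borel sets are among them; Lebesgue sets differ from these by null sets.\<close>
lemma AE_eq_0_if_interval_integrals_0:
  fixes H :: "real \<Rightarrow> complex"
  assumes int: "integrable lebesgue H"
    and zero: "\<And>c d. c \<le> d \<Longrightarrow> (LINT x|lebesgue. indicator {c..d} x *\<^sub>R H x) = 0"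
  shows "AE x in lebesgue. H x = 0"
proof -
  have set_int: "set_integrable lebesgue A H" if "A \<in> sets borel" for A
    unfolding set_integrable_def using that int
    by (intro integrable_mult_indicator) auto
  have total: "(LINT x|lebesgue. H x) = 0"
  proof -
    have "(\<lambda>n. LINT x|lebesgue. indicator {- real n..real n} x *\<^sub>R H x) \<longlonglongrightarrow> (LINT x|lebesgue. H x)"
    proof (rule integral_dominated_convergence[where w = "\<lambda>x. norm (H x)"])
      show "AE x in lebesgue. (\<lambda>n. indicator {- real n..real n} x *\<^sub>R H x) \<longlonglongrightarrow> H x"
      proof (rule AE_I2)
        fix x :: real
        obtain N where "\<bar>x\<bar> \<le> real N" using real_arch_simple by blast
        then have "\<And>n. n \<ge> N \<Longrightarrow> indicator {- real n..real n} x *\<^sub>R H x = H x"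
          by (auto simp: indicator_def)
        then show "(\<lambda>n. indicator {- real n..real n} x *\<^sub>R H x) \<longlonglongrightarrow> H x"
          by (intro tendsto_eventually) (auto simp: eventually_sequentially)
      qed
      show "(\<lambda>x. indicator {- real n..real n} x *\<^sub>R H x) \<in> borel_measurable lebesgue" for n
        using set_int[of "{- real n..real n}"] by (simp add: set_integrable_def borel_measurable_integrable)
    qed (use int in \<open>auto simp: indicator_def\<close>)
    moreover have "(\<lambda>n. LINT x|lebesgue. indicator {- real n..real n} x *\<^sub>R H x) = (\<lambda>n. 0)"
      using zero by auto
    ultimately show ?thesis by (simp add: LIMSEQ_const_iff)
  qed
  have borel0: "set_lebesgue_integral lebesgue A H = 0" if "A \<in> sets borel" for A
    using that
  proof (induction rule: borel_set_induct)
    case (interval a b)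
    then show ?case using zero by (simp add: set_lebesgue_integral_def)
  next
    case (compl A)
    have "(LINT x|lebesgue. H x) = set_lebesgue_integral lebesgue (A \<union> - A) H"
      by (simp add: set_lebesgue_integral_def)
    also have "\<dots> = set_lebesgue_integral lebesgue A H + set_lebesgue_integral lebesgue (- A) H"
      using compl by (intro set_integral_Un set_int) auto
    finally show ?case using compl total by simp
  next
    case (union A)
    have "set_lebesgue_integral lebesgue (\<Union>i. A i) H = (\<Sum>i. set_lebesgue_integral lebesgue (A i) H)"
      using union by (intro lebesgue_integral_countable_add set_int)
        (auto simp: disjoint_family_on_def)
    then show ?case using union by simp
  qed (auto simp: set_lebesgue_integral_def)
  show ?thesis
  proof (rule sigma_finite_measure.density_zero[OF sigma_finite_lebesgue int])
    fix A :: "real set" assume A: "A \<in> sets lebesgue"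
    have mp: "main_part lborel A \<in> sets borel"
      using main_part_sets[OF A] by simp
    have "set_lebesgue_integral lebesgue A H = set_lebesgue_integral lebesgue (main_part lborel A) H"
      unfolding set_lebesgue_integral_def
    proof (rule integral_cong_AE)
      have "AE x in lebesgue. x \<notin> null_part lborel A"
        using null_part_null_sets[OF A] by (intro AE_not_in) auto
      then show "AE x in lebesgue. indicator A x *\<^sub>R H x = indicator (main_part lborel A) x *\<^sub>R H x"
      proof eventually_elim
        fix x assume "x \<notin> null_part lborel A"
        moreover have "A = main_part lborel A \<union> null_part lborel A"
          using main_part_null_part_Un[OF A] by simp
        ultimately have "x \<in> A \<longleftrightarrow> x \<in> main_part lborel A" by blast
        then show "indicator A x *\<^sub>R H x = indicator (main_part lborel A) x *\<^sub>R H x"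
          by (simp add: indicator_def)
      qed
      show "(\<lambda>x. indicator A x *\<^sub>R H x) \<in> borel_measurable lebesgue"
        using integrable_mult_indicator[OF A int] by simp
      show "(\<lambda>x. indicator (main_part lborel A) x *\<^sub>R H x) \<in> borel_measurable lebesgue"
        using set_int[OF mp] unfolding set_integrable_def by (rule borel_measurable_integrable)
    qed
    also have "\<dots> = 0" by (rule borel0[OF mp])
    finally show "set_lebesgue_integral lebesgue A H = 0" .
  qed
qed

lemma indicator_L2: "c \<le> d \<Longrightarrow> indicator {c..d} \<in> L2"
proof -
  have "(\<lambda>x. ennreal ((norm (indicator {c..d} x :: complex))\<^sup>2)) = indicator {c..d}"
    by (auto simp: indicator_def)
  then show ?thesis
    by (auto simp: L2_def L2_sqnorm_def nn_integral_completion emeasure_lborel_Icc_eq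
             intro!: borel_imp_lebesgue_measurable)
qed

lemma L2_indicator_mult: "f \<in> L2 \<Longrightarrow> (\<lambda>x. indicator {c..d} x * f x) \<in> L2"
proof -
  assume f: "f \<in> L2"
  have "L2_sqnorm (\<lambda>x. indicator {c..d} x * f x) \<le> L2_sqnorm f"
    unfolding L2_sqnorm_def by (intro nn_integral_mono) (auto simp: indicator_def)
  moreover have "(\<lambda>x. indicator {c..d} x * f x) \<in> borel_measurable lebesgue"
    by (intro borel_measurable_times borel_imp_lebesgue_measurable L2_measurable[OF f]) simp
  ultimately show ?thesis
    using f unfolding L2_def by (auto intro: order_le_less_trans)
qed

lemma L2_indicator_mult_cont:
  assumes "continuous_on {c..d} f"
  shows "(\<lambda>x. indicator {c..d} x * f x) \<in> L2"
proof -
  have meas: "(\<lambda>x. indicator {c..d} x *\<^sub>R f x) \<in> borel_measurable borel"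
    using borel_measurable_continuous_on_indicator[OF _ assms] by simp
  have "integrable lborel (\<lambda>x. indicator {c..d} x *\<^sub>R (norm (f x))\<^sup>2)"
    by (rule borel_integrable_compact) (auto intro!: continuous_intros assms)
  then have "(\<integral>\<^sup>+x. ennreal (norm (indicator {c..d} x *\<^sub>R (norm (f x))\<^sup>2)) \<partial>lborel) < \<infinity>"
    unfolding integrable_iff_bounded by blast
  also have "(\<lambda>x. ennreal (norm (indicator {c..d} x *\<^sub>R (norm (f x))\<^sup>2))) = (\<lambda>x. ennreal ((norm (indicator {c..d} x * f x))\<^sup>2))"
    by (auto simp: indicator_def)
  finally have "L2_sqnorm (\<lambda>x. indicator {c..d} x * f x) < \<infinity>"
    by (simp add: L2_sqnorm_def nn_integral_completion)
  moreover have "(\<lambda>x. indicator {c..d} x *\<^sub>R f x) = (\<lambda>x. indicator {c..d} x * f x)"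
    by (auto simp: indicator_def)
  ultimately show ?thesis
    using borel_imp_lebesgue_measurable[OF meas] by (simp add: L2_def)
qed

text \<open>The extension of the transform to \<open>L\<^sup>2\<close> agrees with the integral on integrable functions.
  Test the approximating sequence \<open>\<phi> n\<close> against an interval \<open>[c, d]\<close>: on the Fourier side the pairings
  converge to the integral of \<open>F\<close> over \<open>[c, d]\<close>, on the other side the multiplication formula moves the
  transform onto the interval, where it is a sinc function and so lies in \<open>L\<^sup>2\<close>, and the pairings
  converge to those of \<open>f\<close>. Hence \<open>F\<close> and the transform of \<open>f\<close> have the same integral over every
  interval.\<close>
lemma fourier_L2_eq_fourier_L1:
  assumes f: "integrable lebesgue f" and F: "is_fourier_L2 f F"
  shows "AE \<gamma> in lebesgue. F \<gamma> = fourier_L1 f \<gamma>"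
proof -
  from F obtain \<phi> where FL: "F \<in> L2" and fL: "f \<in> L2"
    and \<phi>: "\<And>n. integrable lebesgue (\<phi> n)" "\<And>n. \<phi> n \<in> L2"
    and lim1: "(\<lambda>n. L2_sqnorm (\<lambda>x. \<phi> n x - f x)) \<longlonglongrightarrow> 0"
    and lim2: "(\<lambda>n. L2_sqnorm (\<lambda>\<gamma>. fourier_L1 (\<phi> n) \<gamma> - F \<gamma>)) \<longlonglongrightarrow> 0"
    unfolding is_fourier_L2_def by blast
  have cont: "continuous_on S (fourier_L1 h)" if "integrable lebesgue h" for h and S :: "real set"
    using that by (simp add: isCont_fourier_L1 continuous_at_imp_continuous_on)
  note [measurable] = L2_measurable[OF FL]
  have meas[measurable]: "fourier_L1 h \<in> borel_measurable lebesgue" if "integrable lebesgue h" for h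
    using that by (intro borel_imp_lebesgue_measurable borel_measurable_continuous_onI cont)
  have pair: "(LINT \<gamma>|lebesgue. indicator {c..d} \<gamma> * F \<gamma>) = (LINT \<gamma>|lebesgue. indicator {c..d} \<gamma> * fourier_L1 f \<gamma>)"
    if cd: "c \<le> d" for c d
  proof -
    have ind: "integrable lborel (indicator {c..d} :: real \<Rightarrow> complex)"
      by (rule integrable_indicator_Icc)
    have loc: "(\<lambda>\<gamma>. indicator {c..d} \<gamma> * fourier_L1 (\<phi> n) \<gamma>) \<in> L2" for n
      by (rule L2_indicator_mult_cont) (rule cont[OF \<phi>(1)])
    have "(\<lambda>n. LINT \<gamma>|lebesgue. indicator {c..d} \<gamma> * (indicator {c..d} \<gamma> * fourier_L1 (\<phi> n) \<gamma>))
        \<longlonglongrightarrow> (LINT \<gamma>|lebesgue. indicator {c..d} \<gamma> * (indicator {c..d} \<gamma> * F \<gamma>))"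
    proof (rule L2_pairing_tendsto[OF indicator_L2[OF cd] L2_indicator_mult[OF FL] loc])
      show "(\<lambda>n. L2_sqnorm (\<lambda>\<gamma>. indicator {c..d} \<gamma> * fourier_L1 (\<phi> n) \<gamma> - indicator {c..d} \<gamma> * F \<gamma>)) \<longlonglongrightarrow> 0"
      proof (rule tendsto_sandwich[OF _ _ tendsto_const lim2])
        show "\<forall>\<^sub>F n in sequentially. L2_sqnorm (\<lambda>\<gamma>. indicator {c..d} \<gamma> * fourier_L1 (\<phi> n) \<gamma> - indicator {c..d} \<gamma> * F \<gamma>)
           \<le> L2_sqnorm (\<lambda>\<gamma>. fourier_L1 (\<phi> n) \<gamma> - F \<gamma>)"
          unfolding L2_sqnorm_def
          by (intro always_eventually allI nn_integral_mono) (auto simp: indicator_def)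
      qed auto
    qed
    moreover have "indicator {c..d} \<gamma> * (indicator {c..d} \<gamma> * z) = indicator {c..d} \<gamma> * z" for \<gamma> and z :: complex
      by (auto simp: indicator_def)
    ultimately have "(\<lambda>n. LINT \<gamma>|lebesgue. indicator {c..d} \<gamma> * fourier_L1 (\<phi> n) \<gamma>)
        \<longlonglongrightarrow> (LINT \<gamma>|lebesgue. indicator {c..d} \<gamma> * F \<gamma>)" by simp
    moreover have "(\<lambda>n. LINT x|lebesgue. fourier_L1 (indicator {c..d}) x * \<phi> n x)
        \<longlonglongrightarrow> (LINT x|lebesgue. fourier_L1 (indicator {c..d}) x * f x)"
      by (rule L2_pairing_tendsto[OF fourier_L1_interval_L2[OF cd] fL \<phi>(2) lim1])
    ultimately show ?thesis
      using fourier_L1_duality[OF \<phi>(1) ind] fourier_L1_duality[OF f ind] LIMSEQ_unique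
      by (simp add: mult.commute)
  qed
  have int: "integrable lebesgue (\<lambda>\<gamma>. indicator {c..d} \<gamma> * F \<gamma>)"
    "integrable lebesgue (\<lambda>\<gamma>. indicator {c..d} \<gamma> * fourier_L1 f \<gamma>)" if "c \<le> d" for c d
  proof -
    have *: "(\<lambda>\<gamma>. indicator {c..d} \<gamma> * (indicator {c..d} \<gamma> * h \<gamma>)) = (\<lambda>\<gamma>. indicator {c..d} \<gamma> * h \<gamma>)"
      for h :: "real \<Rightarrow> complex"
      by (auto simp: indicator_def)
    show "integrable lebesgue (\<lambda>\<gamma>. indicator {c..d} \<gamma> * F \<gamma>)"
      "integrable lebesgue (\<lambda>\<gamma>. indicator {c..d} \<gamma> * fourier_L1 f \<gamma>)"
      using L2_mult_integrable[OF indicator_L2[OF that] FL]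
        L2_mult_integrable[OF indicator_L2[OF that] L2_indicator_mult_cont[OF cont[OF f]], of c d]
      unfolding * by simp_all
  qed
  \<comment> \<open>Only the restriction to a bounded interval is known to be integrable, so the comparison is local.\<close>
  have local: "AE \<gamma> in lebesgue. indicator {- real n..real n} \<gamma> * (F \<gamma> - fourier_L1 f \<gamma>) = 0" for n
  proof (rule AE_eq_0_if_interval_integrals_0)
    let ?J = "{- real n..real n}"
    show "integrable lebesgue (\<lambda>\<gamma>. indicator ?J \<gamma> * (F \<gamma> - fourier_L1 f \<gamma>))"
      using int[of "- real n" "real n"] by (simp add: algebra_simps)
    fix c d :: real assume "c \<le> d"
    show "(LINT x|lebesgue. indicator {c..d} x *\<^sub>R (indicator ?J x * (F x - fourier_L1 f x))) = 0"
    proof (cases "max c (- real n) \<le> min d (real n)")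
      case True
      have "indicator {c..d} x *\<^sub>R (indicator ?J x * z) = indicator {max c (- real n)..min d (real n)} x * z" for x and z :: complex
        by (auto simp: indicator_def)
      then show ?thesis
        using pair[OF True] int[OF True] by (simp add: algebra_simps)
    next
      case False
      then have "(\<lambda>x. indicator {c..d} x *\<^sub>R (indicator ?J x * (F x - fourier_L1 f x))) = (\<lambda>x. 0)"
        by (auto simp: indicator_def)
      then show ?thesis by simp
    qed
  qed
  then have "AE \<gamma> in lebesgue. \<forall>n. indicator {- real n..real n} \<gamma> * (F \<gamma> - fourier_L1 f \<gamma>) = 0"
    unfolding AE_all_countable ..
  then show ?thesis
  proof eventually_elim
    fix \<gamma> assume *: "\<forall>n. indicator {- real n..real n} \<gamma> * (F \<gamma> - fourier_L1 f \<gamma>) = 0"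
    obtain N where "\<bar>\<gamma>\<bar> \<le> real N" using real_arch_simple by blast
    then have "\<gamma> \<in> {- real N..real N}" by auto
    then show "F \<gamma> = fourier_L1 f \<gamma>" using *[rule_format, of N] by simp
  qed
qed

section \<open>Summable envelopes and periodization\<close>

text \<open>Sums over the integers are written as integrals for the counting measure, so that dominated
  convergence and Fubini apply to them as they stand.\<close>
abbreviation counting :: "int measure" where
  "counting \<equiv> count_space UNIV"

lemma integrable_countingI:
  fixes A :: "int \<Rightarrow> real"
  assumes "\<And>n. 0 \<le> A n" "\<And>F. finite F \<Longrightarrow> sum A F \<le> C"
  shows "integrable counting A"
proof -
  have "A summable_on UNIV"
    using assms by (intro nonneg_bdd_above_summable_on) (auto simp: bdd_above_def)
  then have "Infinite_Sum.abs_summable_on A UNIV"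
    using assms by simp
  then show ?thesis
    unfolding abs_summable_equivalent Infinite_Set_Sum.abs_summable_on_def .
qed

lemma sum_le_integral_counting:
  fixes A :: "int \<Rightarrow> real"
  assumes "integrable counting A" "\<And>n. 0 \<le> A n" "finite F"
  shows "sum A F \<le> (LINT n|counting. A n)"
proof -
  have "(LINT n|counting. indicator F n * A n) = sum A F"
  proof -
    have "finite {a. indicator F a * A a \<noteq> 0}"
      by (rule finite_subset[OF _ assms(3)]) (auto simp: indicator_def)
    then have "(LINT n|counting. indicator F n * A n) = (\<Sum>a | indicator F a * A a \<noteq> 0. indicator F a * A a)"
      by (subst lebesgue_integral_count_space_finite_support) auto
    also have "\<dots> = (\<Sum>a\<in>F. indicator F a * A a)"
      by (rule sum.mono_neutral_left) (use assms(3) in \<open>auto simp: indicator_def\<close>)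
    finally show ?thesis by (simp add: indicator_def)
  qed
  moreover have "(LINT n|counting. indicator F n * A n) \<le> (LINT n|counting. A n)"
  proof (rule integral_mono)
    show "integrable counting (\<lambda>n. indicator F n * A n)"
      by (rule Bochner_Integration.integrable_bound[OF assms(1)]) (auto simp: indicator_def)
  qed (use assms in \<open>auto simp: indicator_def\<close>)
  ultimately show ?thesis by simp
qed

text \<open>Folding an integral over the line into one period. The windows \<open>{s..<s + q} + m * q\<close> partition
  the line, so \<open>h\<close> is the sum of its restrictions to them; the majorant \<open>B\<close> justifies exchanging sum and
  integral.\<close>
lemma periodization:
  fixes h :: "real \<Rightarrow> 'b::{banach, second_countable_topology}"
  assumes h [measurable]: "h \<in> borel_measurable borel" and q: "0 < q"
    and B: "integrable counting B"
    and hB: "\<And>m t. t \<in> {s..<s + q} \<Longrightarrow> norm (h (t + of_int m * q)) \<le> B m"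
  shows "integrable lborel h"
    and "(LINT x|lborel. h x) = (LINT t|lborel. indicator {s..<s + q} t *\<^sub>R (LINT m|counting. h (t + of_int m * q)))"
proof -
  interpret P: pair_sigma_finite counting "lborel :: real measure"
    by (intro pair_sigma_finite.intro sigma_finite_lborel sigma_finite_measure_count_space)
  let ?I = "{s..<s + q}"
  define F where "F m x = indicator ?I (x - of_int m * q) *\<^sub>R h x" for m x
  define E where "E m t = indicator ?I t *\<^sub>R h (t + of_int m * q)" for m t
  have EF: "E m t = F m (of_int m * q + 1 * t)" for m t
    by (simp add: E_def F_def add.commute)
  have E_le: "norm (E m t) \<le> indicator ?I t * B m" for m t
    using hB by (auto simp: E_def indicator_def)
  have Im [measurable]: "integrable lborel (indicator ?I :: real \<Rightarrow> real)"
    using q by (intro integrable_real_indicator) auto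
  have E_meas [measurable]: "E m \<in> borel_measurable borel" for m
    unfolding E_def by measurable
  have F_meas [measurable]: "F m \<in> borel_measurable borel" for m
    unfolding F_def by measurable
  have E_int: "integrable lborel (E m)" for m
    by (rule Bochner_Integration.integrable_bound[OF integrable_mult_left[OF Im, of "B m"]])
       (use E_le in \<open>auto intro!: order.trans[OF _ abs_ge_self]\<close>)
  have F_int: "integrable lborel (F m)" for m
    using E_int[of m] lborel_integrable_real_affine_iff[of 1 "F m" "of_int m * q"]
    by (simp add: EF[abs_def])
  have E_F: "(LINT t|lborel. E m t) = (LINT x|lborel. F m x)" for m
    unfolding EF using lborel_integral_real_affine[of 1 "F m" "of_int m * q"] by simp
  have normE_F: "(LINT t|lborel. norm (E m t)) = (LINT x|lborel. norm (F m x))" for m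
    unfolding EF using lborel_integral_real_affine[of 1 "\<lambda>x. norm (F m x)" "of_int m * q"] by simp
  have normE: "(LINT t|lborel. norm (E m t)) \<le> q * B m" for m
  proof -
    have "(LINT t|lborel. norm (E m t)) \<le> (LINT t|lborel. indicator ?I t * B m)"
      by (intro integral_mono integrable_norm E_int integrable_mult_left Im E_le)
    also have "\<dots> = q * B m" using q by simp
    finally show ?thesis .
  qed
  have int_norm: "integrable counting (\<lambda>m. LINT t|lborel. norm (E m t))"
    by (rule Bochner_Integration.integrable_bound[OF integrable_mult_right[OF B, of q]])
       (use normE in \<open>auto intro!: order.trans[OF _ abs_ge_self]\<close>)
  have F2: "integrable (counting \<Otimes>\<^sub>M lborel) (case_prod F)"
  proof (rule P.Fubini_integrable)
    show "case_prod F \<in> borel_measurable (counting \<Otimes>\<^sub>M lborel)"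
      by (rule measurable_pair_measure_countable1) auto
    show "integrable counting (\<lambda>m. LINT x|lborel. norm (case_prod F (m, x)))"
      using int_norm by (simp add: normE_F)
    show "AE m in counting. integrable lborel (\<lambda>x. case_prod F (m, x))"
      using F_int by simp
  qed
  have E2: "integrable (counting \<Otimes>\<^sub>M lborel) (case_prod E)"
  proof (rule P.Fubini_integrable)
    show "case_prod E \<in> borel_measurable (counting \<Otimes>\<^sub>M lborel)"
      by (rule measurable_pair_measure_countable1) auto
    show "integrable counting (\<lambda>m. LINT x|lborel. norm (case_prod E (m, x)))"
      using int_norm by simp
    show "AE m in counting. integrable lborel (\<lambda>x. case_prod E (m, x))"
      using E_int by simp
  qed
  have one: "(LINT m|counting. F m x) = h x" for x
  proof -
    define m0 where "m0 = \<lfloor>(x - s) / q\<rfloor>"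
    have iff: "x - of_int m * q \<in> ?I \<longleftrightarrow> m = m0" for m
    proof -
      have "m = m0 \<longleftrightarrow> of_int m \<le> (x - s) / q \<and> (x - s) / q < of_int m + 1"
        unfolding m0_def by (metis floor_unique floor_correct of_int_add of_int_1)
      also have "\<dots> \<longleftrightarrow> x - of_int m * q \<in> ?I"
        using q by (auto simp: field_simps)
      finally show ?thesis ..
    qed
    have F: "F m x = (if m = m0 then h x else 0)" for m
      unfolding F_def indicator_def iff by simp
    have "(LINT m|counting. F m x) = (\<Sum>m | m \<in> UNIV \<and> F m x \<noteq> 0. F m x)"
      by (rule lebesgue_integral_count_space_finite_support)
         (rule finite_subset[of _ "{m0}"], auto simp: F split: if_splits)
    also have "\<dots> = (\<Sum>m\<in>{m0}. F m x)"
      by (rule sum.mono_neutral_left) (auto simp: F split: if_splits)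
    finally show ?thesis by (simp add: F)
  qed
  show "integrable lborel h"
    using P.integrable_snd[OF F2] by (simp add: one)
  have "(LINT x|lborel. h x) = (LINT x|lborel. LINT m|counting. F m x)"
    by (simp add: one)
  also have "\<dots> = (LINT m|counting. LINT x|lborel. F m x)"
    using P.Fubini_integral[of F] F2 by simp
  also have "\<dots> = (LINT m|counting. LINT t|lborel. E m t)"
    by (simp add: E_F)
  also have "\<dots> = (LINT t|lborel. LINT m|counting. E m t)"
    using P.Fubini_integral[of E] E2 by simp
  finally show "(LINT x|lborel. h x) = (LINT t|lborel. indicator ?I t *\<^sub>R (LINT m|counting. h (t + of_int m * q)))"
    by (simp add: E_def)
qed

lemma AE_lebesgue_translate:
  fixes c :: real
  assumes "AE x in lebesgue. P x"
  shows "AE x in lebesgue. P (x - c)"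
proof -
  have "AE x in lborel. P x" using assms by (simp add: AE_completion_iff)
  then obtain N where N: "N \<in> null_sets lborel" "{x. \<not> P x} \<subseteq> N"
    by (auto simp: eventually_ae_filter)
  then have "{x. x - c \<in> N} \<in> null_sets lborel" "{x. \<not> P (x - c)} \<subseteq> {x. x - c \<in> N}"
    using null_sets_translation by auto
  then have "AE x in lborel. P (x - c)"
    unfolding eventually_ae_filter by auto
  then show ?thesis by (rule AE_completion)
qed

lemma wiener_envelope_AE:
  assumes "g \<in> wiener_space"
  obtains A where "integrable counting A" "\<And>k. 0 \<le> A k" "AE x in lebesgue. norm (g x) \<le> A \<lfloor>x\<rfloor>"
proof
  define M where "M k = esssup (lebesgue_on {0..1}) (\<lambda>x. ennreal (norm (g (x + of_int k))))" for k :: int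
  define A where "A k = enn2real (M k)" for k
  have fin: "(\<Sum>\<^sub>\<infinity>k. M k) < \<infinity>"
    using assms unfolding wiener_space_def M_def by simp
  have finM: "sum M F \<le> (\<Sum>\<^sub>\<infinity>k. M k)" if "finite F" for F
    using that by (subst nonneg_infsum_complete) (auto intro: SUP_upper)
  have Mk: "M k < \<infinity>" for k
    using finM[of "{k}"] fin by (simp add: le_less_trans)
  have MA: "M k = ennreal (A k)" for k
    using Mk[of k] by (simp add: A_def)
  show nn: "0 \<le> A k" for k by (simp add: A_def)
  show "integrable counting A"
  proof (rule integrable_countingI[OF nn])
    fix F :: "int set" assume "finite F"
    from finM[OF this] have "ennreal (sum A F) \<le> (\<Sum>\<^sub>\<infinity>k. M k)"
      by (simp add: MA sum_ennreal nn)
    also have "\<dots> = ennreal (enn2real (\<Sum>\<^sub>\<infinity>k. M k))" using fin by simp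
    finally show "sum A F \<le> enn2real (\<Sum>\<^sub>\<infinity>k. M k)"
      by (subst (asm) ennreal_le_iff) auto
  qed
  have "AE x in lebesgue. \<lfloor>x\<rfloor> = k \<longrightarrow> norm (g x) \<le> A k" for k
  proof -
    have "AE x in lebesgue_on {0..1}. ennreal (norm (g (x + of_int k))) \<le> M k"
      unfolding M_def by (rule esssup_AE)
    then have "AE x in lebesgue. x \<in> {0..1} \<longrightarrow> norm (g (x + of_int k)) \<le> A k"
      by (subst (asm) AE_restrict_space_iff) (auto simp: MA nn)
    from AE_lebesgue_translate[OF this, of "of_int k"]
    show ?thesis
    proof eventually_elim
      fix x :: real
      assume *: "x - of_int k \<in> {0..1} \<longrightarrow> norm (g (x - of_int k + of_int k)) \<le> A k"
      show "\<lfloor>x\<rfloor> = k \<longrightarrow> norm (g x) \<le> A k"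
      proof
        assume "\<lfloor>x\<rfloor> = k"
        then have "x - of_int k \<in> {0..1}" by (simp add: floor_eq_iff)
        then show "norm (g x) \<le> A k" using * by simp
      qed
    qed
  qed
  then have "AE x in lebesgue. \<forall>k. \<lfloor>x\<rfloor> = k \<longrightarrow> norm (g x) \<le> A k"
    unfolding AE_all_countable ..
  then show "AE x in lebesgue. norm (g x) \<le> A \<lfloor>x\<rfloor>" by simp
qed

lemma floor_envelope_integrable:
  assumes A: "integrable counting A" and nn: "\<And>k. (0::real) \<le> A k"
  shows "integrable lborel (\<lambda>x::real. A \<lfloor>x\<rfloor>)"
proof (rule periodization(1)[where q = 1 and s = 0 and B = A])
  show "norm (A \<lfloor>t + of_int m * 1\<rfloor>) \<le> A m" if "t \<in> {0..<0 + 1}" for m and t :: real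
  proof -
    have "\<lfloor>t\<rfloor> = 0" using that by (simp add: floor_eq_iff)
    then show ?thesis using nn by simp
  qed
qed (use A in auto)

text \<open>The bound jumps only at integers, where the floor is continuous from the right; so a violation
  at \<open>x\<close> would persist on a short interval to the right of \<open>x\<close>, which is not a null set.\<close>
lemma continuous_AE_floor_bound:
  fixes G :: "real \<Rightarrow> complex"
  assumes cont: "continuous_on UNIV G" and ae: "AE x in lebesgue. norm (G x) \<le> A \<lfloor>x\<rfloor>"
  shows "norm (G x) \<le> A \<lfloor>x\<rfloor>"
proof (rule ccontr)
  assume "\<not> ?thesis"
  then have gt: "A \<lfloor>x\<rfloor> < norm (G x)" by simp
  have "isCont (\<lambda>y. norm (G y)) x"
    using cont by (simp add: continuous_on_eq_continuous_at continuous_norm)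
  then have "\<forall>\<^sub>F y in at x. A \<lfloor>x\<rfloor> < norm (G y)"
    using gt unfolding isCont_def by (rule order_tendstoD)
  then obtain d where d: "d > 0" "\<And>y. y \<noteq> x \<Longrightarrow> dist y x < d \<Longrightarrow> A \<lfloor>x\<rfloor> < norm (G y)"
    unfolding eventually_at by blast
  define e where "e = min d (of_int \<lfloor>x\<rfloor> + 1 - x)"
  have e: "e > 0" using d(1) floor_less_iff[of x "\<lfloor>x\<rfloor> + 1"] by (simp add: e_def)
  from ae have "AE y in lborel. norm (G y) \<le> A \<lfloor>y\<rfloor>" by (simp add: AE_completion_iff)
  then obtain N where N: "N \<in> null_sets lborel" "{y. \<not> norm (G y) \<le> A \<lfloor>y\<rfloor>} \<subseteq> N"
    by (auto simp: eventually_ae_filter)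
  have "{x<..<x + e} \<subseteq> N"
  proof
    fix y assume y: "y \<in> {x<..<x + e}"
    then have "A \<lfloor>x\<rfloor> < norm (G y)" by (intro d(2)) (auto simp: e_def dist_real_def)
    moreover have "\<lfloor>y\<rfloor> = \<lfloor>x\<rfloor>"
      using y by (subst floor_eq_iff) (auto simp: e_def, linarith+)
    ultimately show "y \<in> N" using N(2) by auto
  qed
  then have "{x<..<x + e} \<in> null_sets lborel"
    using N(1) by (intro null_sets_subset[OF N(1)]) auto
  then have "emeasure lborel {x<..<x + e} = 0" by (rule null_setsD1)
  then show False using e by (simp add: emeasure_lborel_Ioo)
qed

text \<open>A majorant adapted to the cells \<open>[k, k + 1]\<close> yields one for the grid \<open>c * n\<close>: add up the finitely
  many cells \<open>S n\<close> near \<open>c * n\<close>. Each cell is used for at most \<open>C\<close> values of \<open>n\<close> (the set \<open>T k\<close>), so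
  summability is preserved.\<close>
lemma grid_envelope:
  fixes c :: real
  assumes A: "integrable counting A" and nn: "\<And>k. (0::real) \<le> A k" and c: "c > 0"
  obtains B where "integrable counting B" "\<And>n. 0 \<le> B n"
    "\<And>n y. \<bar>y\<bar> \<le> c \<Longrightarrow> A \<lfloor>y + of_int n * c\<rfloor> \<le> B n"
proof
  define S where "S n = {k::int. \<bar>of_int n * c - of_int k\<bar> \<le> c + 1}" for n :: int
  define T where "T k = {n::int. \<bar>of_int n * c - of_int k\<bar> \<le> c + 1}" for k :: int
  define B where "B n = sum A (S n)" for n
  define C where "C = nat \<lceil>2 * (c + 1) / c + 1\<rceil>"
  have finS: "finite (S n)" for n
  proof (rule finite_subset)
    show "S n \<subseteq> {\<lceil>of_int n * c - c - 1\<rceil>..\<lfloor>of_int n * c + c + 1\<rfloor>}"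
    proof
      fix k assume "k \<in> S n"
      then have "\<bar>of_int n * c - of_int k\<bar> \<le> c + 1" by (simp add: S_def)
      then have "of_int n * c - c - 1 \<le> of_int k" "of_int k \<le> of_int n * c + c + 1"
        by (simp_all add: abs_le_iff)
      then show "k \<in> {\<lceil>of_int n * c - c - 1\<rceil>..\<lfloor>of_int n * c + c + 1\<rfloor>}"
        by (simp only: atLeastAtMost_iff ceiling_le_iff le_floor_iff)
    qed
  qed simp
  have Tsub: "T k \<subseteq> {\<lceil>(of_int k - c - 1) / c\<rceil>..\<lfloor>(of_int k + c + 1) / c\<rfloor>}" for k
    using c by (auto simp: T_def abs_le_iff le_floor_iff ceiling_le_iff field_simps)
  have finT: "finite (T k)" for k
    by (rule finite_subset[OF Tsub]) simp
  have cardT: "card (T k) \<le> C" for k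
  proof -
    have "card (T k) \<le> card {\<lceil>(of_int k - c - 1) / c\<rceil>..\<lfloor>(of_int k + c + 1) / c\<rfloor>}"
      by (rule card_mono[OF _ Tsub]) simp
    also have "\<dots> = nat (\<lfloor>(of_int k + c + 1) / c\<rfloor> + 1 - \<lceil>(of_int k - c - 1) / c\<rceil>)"
      by simp
    also have "\<dots> \<le> C"
    proof -
      have floors: "of_int (\<lfloor>u\<rfloor> + 1 - \<lceil>v\<rceil>) \<le> u + 1 - v" for u v :: real
        by linarith
      have "of_int (\<lfloor>(of_int k + c + 1) / c\<rfloor> + 1 - \<lceil>(of_int k - c - 1) / c\<rceil>)
          \<le> (of_int k + c + 1) / c + 1 - (of_int k - c - 1) / c"
        using floors .
      also have "\<dots> = 2 * (c + 1) / c + 1" using c by (simp add: field_simps)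
      finally show ?thesis unfolding C_def by (intro nat_mono) linarith
    qed
    finally show ?thesis .
  qed
  show Bnn: "0 \<le> B n" for n unfolding B_def by (intro sum_nonneg nn)
  show "integrable counting B"
  proof (rule integrable_countingI[OF Bnn])
    fix F :: "int set" assume F: "finite F"
    define K where "K = (\<Union>n\<in>F. S n)"
    have finK: "finite K" using F finS by (simp add: K_def)
    have "sum B F = (\<Sum>n\<in>F. \<Sum>k\<in>K. if k \<in> S n then A k else 0)"
    proof (rule sum.cong[OF refl])
      fix n assume "n \<in> F"
      then have "K \<inter> S n = S n" by (auto simp: K_def)
      then show "B n = (\<Sum>k\<in>K. if k \<in> S n then A k else 0)"
        using finK by (simp add: B_def sum.If_cases)
    qed
    also have "\<dots> = (\<Sum>k\<in>K. \<Sum>n\<in>F. if n \<in> T k then A k else 0)"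
      by (subst sum.swap) (simp add: S_def T_def)
    also have "\<dots> \<le> (\<Sum>k\<in>K. of_nat C * A k)"
    proof (rule sum_mono)
      fix k
      have "(\<Sum>n\<in>F. if n \<in> T k then A k else 0) = of_nat (card (F \<inter> T k)) * A k"
        using F by (simp add: sum.If_cases)
      also have "\<dots> \<le> of_nat C * A k"
        using nn order.trans[OF card_mono[OF finT, of "F \<inter> T k" k] cardT]
        by (intro mult_right_mono) auto
      finally show "(\<Sum>n\<in>F. if n \<in> T k then A k else 0) \<le> of_nat C * A k" .
    qed
    also have "\<dots> = of_nat C * sum A K" by (simp add: sum_distrib_left)
    also have "\<dots> \<le> of_nat C * (LINT n|counting. A n)"
      by (intro mult_left_mono sum_le_integral_counting A nn finK) auto
    finally show "sum B F \<le> of_nat C * (LINT n|counting. A n)" .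
  qed
  fix n :: int and y :: real assume y: "\<bar>y\<bar> \<le> c"
  have "\<lfloor>y + of_int n * c\<rfloor> \<in> S n"
    unfolding S_def using y by (simp add: abs_le_iff) linarith
  then show "A \<lfloor>y + of_int n * c\<rfloor> \<le> B n"
    unfolding B_def by (intro member_le_sum finS nn)
qed

text \<open>An eigenfunction in the Wiener space is integrable, so up to a power of \<open>\<i>\<close> it is almost
  everywhere equal to its own transform, which is continuous. From here on, point values make sense and
  the eigenvalue equation holds at every point.\<close>
lemma eigenfunction_representative:
  assumes g: "g \<in> fourier_eigenspace j" and W: "g \<in> wiener_space"
  obtains G A where "continuous_on UNIV G" "AE x in lebesgue. g x = G x"
    "\<And>x. fourier_L1 G x = (- \<i>) ^ j * G x"
    "integrable counting A" "\<And>k. 0 \<le> A k" "\<And>x. norm (G x) \<le> A \<lfloor>x\<rfloor>"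
proof -
  from wiener_envelope_AE[OF W] obtain A where A: "integrable counting A" "\<And>k. 0 \<le> A k"
    and ae: "AE x in lebesgue. norm (g x) \<le> A \<lfloor>x\<rfloor>" by blast
  have gm [measurable]: "g \<in> borel_measurable lebesgue"
    using W by (simp add: wiener_space_def)
  have iA: "integrable lebesgue (\<lambda>x::real. A \<lfloor>x\<rfloor>)"
    using floor_envelope_integrable[OF A] borel_measurable_integrable[OF floor_envelope_integrable[OF A]]
    by (intro integrable_completion[THEN iffD2])
  have gi: "integrable lebesgue g"
    by (rule Bochner_Integration.integrable_bound[OF iA gm]) (use ae A(2) in auto)
  define G where "G x = \<i> ^ j * fourier_L1 g x" for x
  have cG: "continuous_on UNIV G"
    unfolding G_def using gi by (intro continuous_intros) (simp add: isCont_fourier_L1 continuous_at_imp_continuous_on)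
  have unit: "\<i> ^ j * (- \<i>) ^ j = 1"
    by (simp flip: power_mult_distrib)
  have "is_fourier_L2 g (\<lambda>\<gamma>. (- \<i>) ^ j * g \<gamma>)"
    using g by (simp add: fourier_eigenspace_def)
  from fourier_L2_eq_fourier_L1[OF gi this]
  have gG: "AE x in lebesgue. g x = G x"
  proof eventually_elim
    fix x assume "(- \<i>) ^ j * g x = fourier_L1 g x"
    then have "G x = (\<i> ^ j * (- \<i>) ^ j) * g x" by (simp add: G_def)
    then show "g x = G x" by (simp add: unit)
  qed
  have [measurable]: "G \<in> borel_measurable borel"
    using cG by (rule borel_measurable_continuous_onI)
  have FG: "fourier_L1 G x = (- \<i>) ^ j * G x" for x
  proof -
    have w: "(\<lambda>y. wave (- (x * y))) \<in> borel_measurable lebesgue"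
      by (rule borel_imp_lebesgue_measurable) measurable
    have "fourier_L1 G x = fourier_L1 g x"
      unfolding fourier_L1_wave
    proof (rule integral_cong_AE)
      show "(\<lambda>y. G y * wave (- (x * y))) \<in> borel_measurable lebesgue"
        by (rule borel_imp_lebesgue_measurable) measurable
      show "(\<lambda>y. g y * wave (- (x * y))) \<in> borel_measurable lebesgue"
        by (intro borel_measurable_times gm w)
      show "AE y in lebesgue. G y * wave (- (x * y)) = g y * wave (- (x * y))"
        using gG by eventually_elim simp
    qed
    also have "\<dots> = ((- \<i>) ^ j * \<i> ^ j) * fourier_L1 g x"
      using unit by (simp add: mult.commute)
    finally show ?thesis by (simp add: G_def mult_ac)
  qed
  have "AE x in lebesgue. norm (G x) \<le> A \<lfloor>x\<rfloor>"
    using ae gG by eventually_elim simp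
  from continuous_AE_floor_bound[OF cG this] have "norm (G x) \<le> A \<lfloor>x\<rfloor>" for x .
  then show ?thesis using that[OF cG gG FG A] by blast
qed

section \<open>Averaging a summable sequence over long windows\<close>

definition window :: "nat \<Rightarrow> int \<Rightarrow> real" where
  "window K = indicator {0..<int K}"

text \<open>Bounds the total effect of the two ends of a window of length \<open>K\<close>: shifting the window by \<open>n\<close>
  changes it in at most \<open>2 * \<bar>n\<bar>\<close> and at most \<open>2 * K\<close> places.\<close>
definition window_error :: "(int \<Rightarrow> real) \<Rightarrow> nat \<Rightarrow> real" where
  "window_error B K = (LINT n|counting. B n * min (2 * \<bar>of_int n\<bar>) (2 * real K))"

lemma integrable_counting_mult_bounded:
  assumes B: "integrable counting B" and nn: "\<And>n. (0::real) \<le> B n" and c: "\<And>n. \<bar>c n\<bar> \<le> (C::real)"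
  shows "integrable counting (\<lambda>n. B n * c n)"
proof (rule Bochner_Integration.integrable_bound[OF integrable_mult_right[OF B, of C]])
  have C: "0 \<le> C" using c[of 0] by linarith
  show "AE n in counting. norm (B n * c n) \<le> norm (C * B n)"
    using nn c C by (intro AE_I2) (simp add: abs_mult mult.commute[of C] mult_left_mono)
qed auto

lemma norm_integral_le:
  fixes f :: "'a \<Rightarrow> 'b::{banach, second_countable_topology}"
  assumes "integrable M f" "integrable M w" "\<And>x. x \<in> space M \<Longrightarrow> norm (f x) \<le> w x"
  shows "norm (LINT x|M. f x) \<le> (LINT x|M. w x)"
  by (rule order.trans[OF integral_norm_bound]) (intro integral_mono integrable_norm assms)

text \<open>Each summand divided by \<open>K\<close> tends to \<open>0\<close> and is at most \<open>2 * B n\<close>.\<close>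
lemma window_error_small:
  assumes B: "integrable counting B" and nn: "\<And>n. 0 \<le> B n"
  shows "(\<lambda>K. window_error B K / real K) \<longlonglongrightarrow> 0"
proof -
  have "(\<lambda>K. LINT n|counting. B n * min (2 * \<bar>of_int n\<bar>) (2 * real K) / real K) \<longlonglongrightarrow> (LINT n|counting. 0)"
  proof (rule integral_dominated_convergence[where w = "\<lambda>n. 2 * B n"])
    show "AE n in counting. (\<lambda>K. B n * min (2 * \<bar>of_int n\<bar>) (2 * real K) / real K) \<longlonglongrightarrow> 0"
    proof (rule AE_I2)
      fix n :: int
      show "(\<lambda>K. B n * min (2 * \<bar>of_int n\<bar>) (2 * real K) / real K) \<longlonglongrightarrow> 0"
      proof (rule Lim_null_comparison)
        show "\<forall>\<^sub>F K in sequentially. norm (B n * min (2 * \<bar>of_int n\<bar>) (2 * real K) / real K)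
            \<le> B n * (2 * \<bar>of_int n\<bar>) / real K"
          using nn by (intro always_eventually allI) (auto simp: abs_mult intro!: divide_right_mono mult_left_mono)
        show "(\<lambda>K. B n * (2 * \<bar>of_int n\<bar>) / real K) \<longlonglongrightarrow> 0"
          by (rule lim_const_over_n)
      qed
    qed
    show "AE n in counting. norm (B n * min (2 * \<bar>of_int n\<bar>) (2 * real K) / real K) \<le> 2 * B n" for K
    proof (rule AE_I2)
      fix n :: int
      show "norm (B n * min (2 * \<bar>of_int n\<bar>) (2 * real K) / real K) \<le> 2 * B n"
      proof (cases "K = 0")
        case False
        have "B n * min (2 * \<bar>of_int n\<bar>) (2 * real K) \<le> B n * (2 * real K)"
          using nn by (intro mult_left_mono) auto
        then show ?thesis using False nn[of n] by (simp add: abs_mult field_simps)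
      qed (use nn in simp)
    qed
  qed (use B in auto)
  then show ?thesis by (simp add: window_error_def)
qed

lemma sum_indicator_le_card:
  assumes "finite F" "finite X"
  shows "(\<Sum>l\<in>F. indicator X l :: real) \<le> real (card X)"
proof -
  have "(\<Sum>l\<in>F. indicator X l :: real) = real (card (F \<inter> X))"
    using assms by (simp add: sum.If_cases indicator_def)
  also have "\<dots> \<le> real (card X)" using assms by (simp add: card_mono)
  finally show ?thesis .
qed

lemma window_shift_variation:
  assumes F: "finite F"
  shows "(\<Sum>l\<in>F. \<bar>window K (n + l) - window K l\<bar>) \<le> min (2 * \<bar>of_int n\<bar>) (2 * real K)"
proof -
  \<comment> \<open>The places entered and left by the window under the shift.\<close>
  define X where "X = {- n..<int K - n} - {0..<int K}"
  define Y where "Y = {0..<int K} - {- n..<int K - n}"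
  have fin: "finite X" "finite Y" by (auto simp: X_def Y_def)
  have "(\<Sum>l\<in>F. \<bar>window K (n + l) - window K l\<bar>) \<le> (\<Sum>l\<in>F. indicator X l + indicator Y l)"
  proof (rule sum_mono)
    fix l
    have "n + l \<in> {0..<int K} \<longleftrightarrow> l \<in> {- n..<int K - n}" by auto
    then show "\<bar>window K (n + l) - window K l\<bar> \<le> indicator X l + indicator Y l"
      by (cases "l \<in> {- n..<int K - n}"; cases "l \<in> {0..<int K}")
         (simp_all only: window_def X_def Y_def indicator_simps Diff_iff, simp_all)
  qed
  also have "\<dots> \<le> real (card X) + real (card Y)"
    unfolding sum.distrib by (intro add_mono sum_indicator_le_card F fin)
  finally have 1: "(\<Sum>l\<in>F. \<bar>window K (n + l) - window K l\<bar>) \<le> real (card X) + real (card Y)" .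
  have "card X \<le> card {- n..<int K - n}" "card Y \<le> card {0..<int K}"
    unfolding X_def Y_def by (rule card_mono; auto)+
  then have 2: "card X \<le> K" "card Y \<le> K" by auto
  have 3: "card X \<le> nat \<bar>n\<bar> \<and> card Y \<le> nat \<bar>n\<bar>"
  proof (cases "n \<ge> 0")
    case True
    have "card X \<le> card {- n..<0}" "card Y \<le> card {int K - n..<int K}"
      unfolding X_def Y_def using True by (intro card_mono; auto)+
    then show ?thesis using True by simp
  next
    case False
    have "card X \<le> card {int K..<int K - n}" "card Y \<le> card {0..<- n}"
      unfolding X_def Y_def using False by (intro card_mono; auto)+
    then show ?thesis using False by simp
  qed
  then have "real (card X) \<le> \<bar>of_int n\<bar>" "real (card Y) \<le> \<bar>of_int n\<bar>"
    by linarith+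
  then show ?thesis using 1 2 by simp
qed

text \<open>Convolving an absolutely summable sequence \<open>s\<close> with a window of length \<open>K\<close> produces roughly the
  full sum of \<open>s\<close> inside the window and roughly \<open>0\<close> outside; the error \<open>V l\<close> at \<open>l\<close> is summable, with sum
  \<open>o(K)\<close>. This one estimate is used twice: in the mean it is the Cesaro summation behind the Poisson
  formula, in the square mean it bounds the frame coefficients of the test functions.\<close>
context
  fixes s :: "int \<Rightarrow> complex" and B :: "int \<Rightarrow> real" and K :: nat
  assumes B: "integrable counting B" and sB: "\<And>n. norm (s n) \<le> B n"
begin

private lemma B_nonneg: "0 \<le> B n"
  using sB[of n] norm_ge_zero order.trans by blast

private lemma integrable_seq: "integrable counting s"
  by (rule Bochner_Integration.integrable_bound[OF B]) (use sB B_nonneg in auto)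

private definition V :: "int \<Rightarrow> real" where
  "V l = (LINT n|counting. B n * \<bar>window K (n + l) - window K l\<bar>)"

private lemma integrable_V: "integrable counting (\<lambda>n. B n * \<bar>window K (n + l) - window K l\<bar>)"
  by (rule integrable_counting_mult_bounded[OF B B_nonneg, where C = 1])
     (auto simp: window_def indicator_def)

private lemma V_nonneg: "0 \<le> V l"
  unfolding V_def by (intro Bochner_Integration.integral_nonneg mult_nonneg_nonneg B_nonneg) auto

private lemma V_le: "V l \<le> (LINT n|counting. B n)"
  unfolding V_def
proof (rule integral_mono[OF integrable_V B])
  fix n
  have "B n * \<bar>window K (n + l) - window K l\<bar> \<le> B n * 1"
    by (intro mult_left_mono B_nonneg) (auto simp: window_def indicator_def)
  then show "B n * \<bar>window K (n + l) - window K l\<bar> \<le> B n" by simp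
qed

private lemma sum_V_le:
  assumes F: "finite F"
  shows "sum V F \<le> window_error B K"
proof -
  have "sum V F = (LINT n|counting. (\<Sum>l\<in>F. B n * \<bar>window K (n + l) - window K l\<bar>))"
    unfolding V_def by (rule Bochner_Integration.integral_sum[symmetric]) (rule integrable_V)
  also have "\<dots> \<le> window_error B K"
    unfolding window_error_def
  proof (rule integral_mono)
    show "integrable counting (\<lambda>n. \<Sum>l\<in>F. B n * \<bar>window K (n + l) - window K l\<bar>)"
      by (intro Bochner_Integration.integrable_sum integrable_V)
    show "integrable counting (\<lambda>n. B n * min (2 * \<bar>of_int n\<bar>) (2 * real K))"
      by (rule integrable_counting_mult_bounded[OF B B_nonneg, where C = "2 * real K"]) auto
    show "(\<Sum>l\<in>F. B n * \<bar>window K (n + l) - window K l\<bar>) \<le> B n * min (2 * \<bar>of_int n\<bar>) (2 * real K)" for n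
      unfolding sum_distrib_left[symmetric]
      by (intro mult_left_mono B_nonneg window_shift_variation F)
  qed
  finally show ?thesis .
qed

private lemma window_sum_approx:
  "norm ((\<Sum>j\<in>{0..<int K}. s (j - l)) - window K l *\<^sub>R (LINT n|counting. s n)) \<le> V l"
proof -
  have int: "integrable counting (\<lambda>n. window K (n + l) *\<^sub>R s n)"
    by (rule Bochner_Integration.integrable_bound[OF integrable_seq])
       (auto simp: window_def indicator_def)
  have "(\<Sum>j\<in>{0..<int K}. s (j - l)) = (\<Sum>n\<in>{- l..<int K - l}. s n)"
    by (rule sum.reindex_bij_witness[of _ "\<lambda>n. n + l" "\<lambda>j. j - l"]) auto
  also have "\<dots> = (\<Sum>n\<in>{- l..<int K - l}. window K (n + l) *\<^sub>R s n)"
    by (intro sum.cong) (auto simp: window_def indicator_def)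
  also have "\<dots> = (\<Sum>n | n \<in> UNIV \<and> window K (n + l) *\<^sub>R s n \<noteq> 0. window K (n + l) *\<^sub>R s n)"
    by (rule sum.mono_neutral_right) (auto simp: window_def indicator_def split: if_splits)
  also have "\<dots> = (LINT n|counting. window K (n + l) *\<^sub>R s n)"
    by (rule lebesgue_integral_count_space_finite_support[symmetric])
       (rule finite_subset[of _ "{- l..<int K - l}"], auto simp: window_def indicator_def split: if_splits)
  finally have "(\<Sum>j\<in>{0..<int K}. s (j - l)) - window K l *\<^sub>R (LINT n|counting. s n)
      = (LINT n|counting. window K (n + l) *\<^sub>R s n) - (LINT n|counting. window K l *\<^sub>R s n)"
    by simp
  also have "\<dots> = (LINT n|counting. window K (n + l) *\<^sub>R s n - window K l *\<^sub>R s n)"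
    by (rule Bochner_Integration.integral_diff[symmetric]) (auto intro: int integrable_seq)
  also have "norm \<dots> \<le> V l"
    unfolding V_def
  proof (rule norm_integral_le[OF _ integrable_V])
    show "integrable counting (\<lambda>n. window K (n + l) *\<^sub>R s n - window K l *\<^sub>R s n)"
      by (intro Bochner_Integration.integrable_diff int integrable_scaleR_right integrable_seq)
    show "norm (window K (n + l) *\<^sub>R s n - window K l *\<^sub>R s n) \<le> B n * \<bar>window K (n + l) - window K l\<bar>" for n
      unfolding scaleR_diff_left[symmetric] using sB[of n]
      by (simp add: mult.commute mult_right_mono)
  qed
  finally show ?thesis .
qed

lemma window_sums_mean:
  "norm ((\<Sum>l\<in>{0..<int K}. \<Sum>j\<in>{0..<int K}. s (j - l)) - of_nat K * (LINT n|counting. s n))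
     \<le> window_error B K"
proof -
  have "(\<Sum>l\<in>{0..<int K}. \<Sum>j\<in>{0..<int K}. s (j - l)) - of_nat K * (LINT n|counting. s n)
      = (\<Sum>l\<in>{0..<int K}. (\<Sum>j\<in>{0..<int K}. s (j - l)) - window K l *\<^sub>R (LINT n|counting. s n))"
    by (simp add: sum_subtractf window_def)
  also have "norm \<dots> \<le> sum V {0..<int K}"
    by (intro sum_norm_le window_sum_approx)
  also have "\<dots> \<le> window_error B K" by (rule sum_V_le) simp
  finally show ?thesis .
qed

text \<open>\<open>(norm T)\<^sup>2\<close> is at most twice the squared error plus twice the squared full sum on the window,
  and one of the two factors in the squared error is bounded by the sum of \<open>B\<close>.\<close>
lemma window_sums_square:
  assumes F: "finite F"
  shows "(\<Sum>l\<in>F. (norm (\<Sum>j\<in>{0..<int K}. s (j - l)))\<^sup>2)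
    \<le> 2 * (LINT n|counting. B n) * window_error B K + 2 * real K * (norm (LINT n|counting. s n))\<^sup>2"
proof -
  define M where "M = (LINT n|counting. B n)"
  define \<sigma> where "\<sigma> = norm (LINT n|counting. s n)"
  have "(\<Sum>l\<in>F. (norm (\<Sum>j\<in>{0..<int K}. s (j - l)))\<^sup>2) \<le> (\<Sum>l\<in>F. 2 * M * V l + 2 * \<sigma>\<^sup>2 * window K l)"
  proof (rule sum_mono)
    fix l
    let ?T = "\<Sum>j\<in>{0..<int K}. s (j - l)"
    have w: "window K l = 0 \<or> window K l = 1" by (simp add: window_def indicator_def)
    have "norm ?T \<le> norm (?T - window K l *\<^sub>R (LINT n|counting. s n)) + norm (window K l *\<^sub>R (LINT n|counting. s n))"
      using norm_triangle_ineq[of "?T - window K l *\<^sub>R (LINT n|counting. s n)" "window K l *\<^sub>R (LINT n|counting. s n)"] by simp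
    also have "\<dots> \<le> V l + window K l * \<sigma>"
      using window_sum_approx[of l] w by (auto simp: \<sigma>_def)
    finally have "(norm ?T)\<^sup>2 \<le> (V l + window K l * \<sigma>)\<^sup>2" by (intro power_mono) auto
    also have "\<dots> \<le> 2 * (V l)\<^sup>2 + 2 * (window K l * \<sigma>)\<^sup>2"
      using zero_le_power2[of "V l - window K l * \<sigma>"] by (simp add: power2_sum power2_diff)
    also have "(V l)\<^sup>2 \<le> M * V l"
      unfolding power2_eq_square M_def by (intro mult_right_mono V_le V_nonneg)
    also have "(window K l * \<sigma>)\<^sup>2 = \<sigma>\<^sup>2 * window K l" using w by (auto simp: power_mult_distrib)
    finally show "(norm ?T)\<^sup>2 \<le> 2 * M * V l + 2 * \<sigma>\<^sup>2 * window K l" by simp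
  qed
  also have "\<dots> = 2 * M * sum V F + 2 * \<sigma>\<^sup>2 * sum (window K) F"
    by (simp add: sum.distrib sum_distrib_left)
  also have "\<dots> \<le> 2 * M * window_error B K + 2 * \<sigma>\<^sup>2 * real K"
  proof (intro add_mono mult_left_mono sum_V_le F)
    show "sum (window K) F \<le> real K"
      using sum_indicator_le_card[OF F, of "{0..<int K}"] by (simp add: window_def)
    show "0 \<le> 2 * M" unfolding M_def by (simp add: Bochner_Integration.integral_nonneg B_nonneg)
  qed simp
  finally show ?thesis by (simp add: M_def \<sigma>_def mult_ac)
qed

end

section \<open>The Fejer kernel\<close>

definition fejer :: "nat \<Rightarrow> real \<Rightarrow> real" where
  "fejer K t = (norm (\<Sum>j\<in>{0..<int K}. wave (of_int j * t)))\<^sup>2 / real K"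

lemma fejer_nonneg: "0 \<le> fejer K t"
  by (simp add: fejer_def)

lemma fejer_continuous [continuous_intros]: "continuous_on S (fejer K)"
  unfolding fejer_def divide_inverse by (intro continuous_intros)

text \<open>The conjugate exponents are chosen so that integrating against this kernel gives averages of
  Fourier coefficients; both signs agree because the kernel is real.\<close>
lemma fejer_expand:
  "complex_of_real (fejer K t) = (\<Sum>l\<in>{0..<int K}. \<Sum>j\<in>{0..<int K}. wave (- (of_int (j - l) * t))) / of_nat K"
proof -
  let ?S = "\<Sum>j\<in>{0..<int K}. wave (of_int j * t)"
  have "complex_of_real ((norm ?S)\<^sup>2) = ?S * cnj ?S"
    by (rule complex_norm_square)
  also have "\<dots> = (\<Sum>l\<in>{0..<int K}. \<Sum>j\<in>{0..<int K}. wave (of_int l * t) * wave (- (of_int j * t)))"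
    by (simp add: sum_product wave_minus)
  also have "\<dots> = (\<Sum>l\<in>{0..<int K}. \<Sum>j\<in>{0..<int K}. wave (- (of_int (j - l) * t)))"
    by (intro sum.cong refl) (simp flip: wave_add add: algebra_simps)
  finally show ?thesis by (simp add: fejer_def)
qed

text \<open>Away from the integers the kernel is \<open>O(1 / K)\<close>, because the geometric sum telescopes when
  multiplied by \<open>wave t - 1\<close>.\<close>
lemma fejer_decay: "fejer K t * (norm (wave t - 1))\<^sup>2 \<le> 4 / real K"
proof -
  let ?S = "\<Sum>j\<in>{0..<int K}. wave (of_int j * t)"
  have "(wave t - 1) * (\<Sum>j<K. wave (of_nat j * t)) = wave (of_nat K * t) - 1"
  proof (induction K)
    case (Suc K)
    then show ?case
      by (simp add: distrib_left distrib_right wave_add algebra_simps)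
  qed simp
  moreover have "(\<Sum>j<K. wave (of_nat j * t)) = ?S"
    by (rule sum.reindex_bij_witness[of _ nat int]) auto
  ultimately have "norm ((wave t - 1) * ?S) \<le> norm (wave (of_nat K * t)) + norm (1 :: complex)"
    by (metis norm_triangle_ineq4)
  then have "norm (wave t - 1) * norm ?S \<le> 2" by (simp add: norm_mult)
  then have "(norm (wave t - 1) * norm ?S)\<^sup>2 \<le> 2\<^sup>2" by (intro power_mono) auto
  then show ?thesis
    by (simp add: fejer_def power_mult_distrib divide_right_mono mult.commute)
qed

lemma wave_eq_1_iff: "wave t = 1 \<longleftrightarrow> t \<in> \<int>"
proof
  assume "wave t = 1"
  then have "cos (2 * pi * t) = 1" by (simp add: wave_def complex_eq_iff)
  then obtain n :: int where "2 * pi * t = of_int n * 2 * pi"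
    using cos_one_2pi_int by auto
  then show "t \<in> \<int>" by simp
qed (auto elim!: Ints_cases)

text \<open>Centred at \<open>0\<close>, so that the kernel is peaked in the interior; half-open, so that the translates
  by integers are disjoint. The upper end is left in this form to match the windows \<open>{s..<s + q}\<close> of the
  folding lemma.\<close>
abbreviation unit_cell :: "real set" where
  "unit_cell \<equiv> {- 1 / 2..<- 1 / 2 + 1}"

lemma integrable_unit_cell:
  fixes h :: "real \<Rightarrow> 'b::{banach, second_countable_topology}"
  assumes "continuous_on UNIV h"
  shows "integrable lborel (\<lambda>t. indicator unit_cell t *\<^sub>R h t)"
proof -
  have [measurable]: "h \<in> borel_measurable borel"
    using assms by (rule borel_measurable_continuous_onI)
  have "integrable lborel (\<lambda>t. indicator {- 1 / 2..1 / 2} t *\<^sub>R h t)"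
    by (rule borel_integrable_compact) (auto intro: continuous_on_subset[OF assms])
  then show ?thesis
    by (rule Bochner_Integration.integrable_bound) (auto simp: indicator_def)
qed

lemma integral_period_wave:
  assumes "p > 0"
  shows "(LINT t|lborel. indicator {c..c + p} t *\<^sub>R wave (of_int m * t / p)) = (if m = 0 then of_real p else 0)"
proof (cases "m = 0")
  case True
  have "(LINT t|lborel. indicator {c..c + p} t *\<^sub>R (1 :: complex)) = of_real p"
    using assms by (subst integral_scaleR_left) (auto intro!: integrable_real_indicator simp: scaleR_conv_of_real)
  then show ?thesis using True by simp
next
  case False
  define k where "k = 2 * complex_of_real pi * \<i> * of_real (of_int m / p)"
  have k: "k \<noteq> 0" using False assms by (simp add: k_def)
  have wk: "wave (of_int m * t / p) = exp (k * of_real t)" for t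
    unfolding exp_eq_wave[symmetric] k_def by (simp add: mult_ac)
  have "(LINT t|lborel. indicator {c..c + p} t *\<^sub>R wave (of_int m * t / p))
      = exp (k * of_real (c + p)) / k - exp (k * of_real c) / k"
    unfolding wk
  proof (rule integral_FTC_Icc)
    show "((\<lambda>t. exp (k * complex_of_real t) / k) has_vector_derivative exp (k * complex_of_real t)) (at t within {c..c + p})" for t
      using k by (auto intro!: derivative_eq_intros has_vector_derivative_real_field
           simp: field_simps)
    show "continuous_on {c..c + p} (\<lambda>t. exp (k * complex_of_real t))"
      by (intro continuous_intros)
  qed (use assms in simp)
  also have "exp (k * of_real (c + p)) = exp (k * of_real c)"
  proof -
    have "wave (of_int m * (c + p) / p) = wave (of_int m * c / p + of_int m)"
      using assms by (intro arg_cong[where f = wave]) (simp add: field_simps)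
    also have "\<dots> = wave (of_int m * c / p)"
      by (simp only: wave_add wave_int mult_1_right)
    finally show ?thesis unfolding wk .
  qed
  finally show ?thesis using False by simp
qed

lemma integral_unit_cell_wave:
  "(LINT t|lborel. indicator unit_cell t *\<^sub>R wave (- (of_int m * t))) = (if m = 0 then 1 else 0)"
proof -
  have [measurable]: "(\<lambda>t. wave (- (of_int m * t))) \<in> borel_measurable borel"
    by (intro borel_measurable_continuous_onI continuous_intros)
  have "(LINT t|lborel. indicator unit_cell t *\<^sub>R wave (- (of_int m * t)))
      = (LINT t|lborel. indicator {- 1 / 2..- 1 / 2 + 1} t *\<^sub>R wave (- (of_int m * t)))"
  proof (rule integral_cong_AE)
    show "AE t in lborel. indicator unit_cell t *\<^sub>R wave (- (of_int m * t)) = indicator {- 1 / 2..- 1 / 2 + 1} t *\<^sub>R wave (- (of_int m * t))"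
      using AE_lborel_singleton[of "1 / 2"] by eventually_elim (auto simp: indicator_def)
  qed auto
  then show ?thesis
    using integral_period_wave[of 1 "- 1 / 2" "- m"] by simp
qed

lemma integral_fejer:
  assumes "K > 0"
  shows "(LINT t|lborel. indicator unit_cell t *\<^sub>R fejer K t) = 1"
proof -
  have int: "integrable lborel (\<lambda>t. indicator unit_cell t *\<^sub>R wave (- (of_int m * t)))" for m
    by (intro integrable_unit_cell continuous_intros)
  have "complex_of_real (LINT t|lborel. indicator unit_cell t *\<^sub>R fejer K t)
      = (LINT t|lborel. complex_of_real (indicator unit_cell t *\<^sub>R fejer K t))"
    by (rule integral_complex_of_real[symmetric])
  also have "\<dots> = (LINT t|lborel. (\<Sum>l\<in>{0..<int K}. \<Sum>j\<in>{0..<int K}. indicator unit_cell t *\<^sub>R wave (- (of_int (j - l) * t))) / of_nat K)"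
  proof (rule Bochner_Integration.integral_cong[OF refl])
    show "complex_of_real (indicator unit_cell t *\<^sub>R fejer K t)
        = (\<Sum>l\<in>{0..<int K}. \<Sum>j\<in>{0..<int K}. indicator unit_cell t *\<^sub>R wave (- (of_int (j - l) * t))) / of_nat K" for t
      by (cases "t \<in> unit_cell") (simp_all only: indicator_simps scaleR_one scaleR_zero_left fejer_expand of_real_0 sum.neutral_const divide_eq_0_iff, simp)
  qed
  also have "\<dots> = (\<Sum>l\<in>{0..<int K}. \<Sum>j\<in>{0..<int K}. LINT t|lborel. indicator unit_cell t *\<^sub>R wave (- (of_int (j - l) * t))) / of_nat K"
    unfolding integral_divide_zero
    by (subst Bochner_Integration.integral_sum; (intro Bochner_Integration.integrable_sum int)?)
       (subst Bochner_Integration.integral_sum; (intro Bochner_Integration.integrable_sum int refl)?)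
  also have "\<dots> = (\<Sum>l\<in>{0..<int K}. \<Sum>j\<in>{0..<int K}. if j = l then 1 else 0) / of_nat K"
    unfolding integral_unit_cell_wave by simp
  also have "\<dots> = 1" using assms by simp
  finally show ?thesis by (simp only: of_real_eq_1_iff)
qed

text \<open>The kernel is nonnegative with integral \<open>1\<close> and tends to \<open>0\<close> uniformly on the part of the cell away from
  the origin.\<close>
lemma fejer_approximate_identity:
  fixes H :: "real \<Rightarrow> complex"
  assumes H: "continuous_on UNIV H"
  shows "(\<lambda>K. LINT t|lborel. indicator unit_cell t *\<^sub>R (of_real (fejer K t) * H t)) \<longlonglongrightarrow> H 0"
proof (rule LIMSEQ_I)
  fix e :: real assume e: "e > 0"
  define D where "D t = norm (H t - H 0)" for t
  have cD: "continuous_on UNIV D" unfolding D_def by (intro continuous_intros H)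
  have "bounded (D ` {- 1 / 2..1 / 2})"
    by (intro compact_imp_bounded compact_continuous_image continuous_on_subset[OF cD]) auto
  then obtain M where M: "M > 0" "\<And>t. t \<in> {- 1 / 2..1 / 2} \<Longrightarrow> D t \<le> M"
    unfolding bounded_pos by (auto simp: abs_le_iff)
  have "isCont D 0" using cD by (simp add: continuous_on_eq_continuous_at)
  then obtain d where d: "d > 0" "\<And>t. \<bar>t\<bar> < d \<Longrightarrow> D t < e / 2"
    using e unfolding continuous_at_eps_delta dist_real_def
    by (metis D_def abs_of_nonneg diff_self diff_zero half_gt_zero norm_ge_zero norm_zero)
  \<comment> \<open>On the compact set \<open>X\<close> the function \<open>wave t - 1\<close> has no zero, hence is bounded below.\<close>
  define X where "X = {- 1 / 2..1 / 2} - {- d<..<d}"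
  obtain c where c: "c > 0" "\<And>t. t \<in> X \<Longrightarrow> c \<le> (norm (wave t - 1))\<^sup>2"
  proof (cases "X = {}")
    case True then show ?thesis using that[of 1] by simp
  next
    case False
    have "compact X" unfolding X_def by (intro compact_diff) auto
    moreover have "continuous_on X (\<lambda>t. (norm (wave t - 1))\<^sup>2)" by (intro continuous_intros)
    ultimately obtain t0 where t0: "t0 \<in> X" "\<And>t. t \<in> X \<Longrightarrow> (norm (wave t0 - 1))\<^sup>2 \<le> (norm (wave t - 1))\<^sup>2"
      using continuous_attains_inf[of X "\<lambda>t. (norm (wave t - 1))\<^sup>2"] False by blast
    have "wave t0 \<noteq> 1"
    proof
      assume "wave t0 = 1"
      then obtain n :: int where n: "t0 = of_int n" by (auto simp: wave_eq_1_iff elim: Ints_cases)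
      have "\<bar>t0\<bar> \<le> 1 / 2" "t0 \<noteq> 0" using t0(1) d(1) by (auto simp: X_def)
      then show False using n by auto
    qed
    then show ?thesis using that[of "(norm (wave t0 - 1))\<^sup>2"] t0 by auto
  qed
  obtain K0 :: nat where K0: "K0 > 0" "8 * M / (c * e) < real K0"
    using reals_Archimedean2[of "max 0 (8 * M / (c * e))"] by (metis max_less_iff_conj of_nat_0_less_iff)
  show "\<exists>K0. \<forall>K\<ge>K0. norm ((LINT t|lborel. indicator unit_cell t *\<^sub>R (of_real (fejer K t) * H t)) - H 0) < e"
  proof (intro exI allI impI)
    fix K assume "K \<ge> K0"
    then have K: "K > 0" "8 * M / (c * e) < real K" using K0 by auto
    have cf: "continuous_on UNIV (\<lambda>t. complex_of_real (fejer K t) * h t)" if "continuous_on UNIV h" for h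
      by (intro continuous_intros fejer_continuous that)
    have "(LINT t|lborel. indicator unit_cell t *\<^sub>R (of_real (fejer K t) * H 0))
        = (LINT t|lborel. complex_of_real (indicator unit_cell t *\<^sub>R fejer K t)) * H 0"
      by (simp add: scaleR_conv_of_real mult_ac)
    also have "\<dots> = H 0" unfolding integral_complex_of_real integral_fejer[OF K(1)] by simp
    finally have "norm ((LINT t|lborel. indicator unit_cell t *\<^sub>R (of_real (fejer K t) * H t)) - H 0)
        = norm ((LINT t|lborel. indicator unit_cell t *\<^sub>R (of_real (fejer K t) * H t))
              - (LINT t|lborel. indicator unit_cell t *\<^sub>R (of_real (fejer K t) * H 0)))"
      by simp
    also have "\<dots> = norm (LINT t|lborel. indicator unit_cell t *\<^sub>R (of_real (fejer K t) * (H t - H 0)))"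
    proof -
      have i: "integrable lborel (\<lambda>t. indicator unit_cell t *\<^sub>R (of_real (fejer K t) * H t))"
        "integrable lborel (\<lambda>t. indicator unit_cell t *\<^sub>R (of_real (fejer K t) * H 0))"
        by (intro integrable_unit_cell cf H continuous_intros)+
      show ?thesis
        unfolding Bochner_Integration.integral_diff[OF i, symmetric]
        by (simp add: right_diff_distrib scaleR_diff_right)
    qed
    also have "\<dots> \<le> (LINT t|lborel. indicator unit_cell t *\<^sub>R (fejer K t * (e / 2) + 4 * M / (c * real K)))"
    proof (rule norm_integral_le)
      show "integrable lborel (\<lambda>t. indicator unit_cell t *\<^sub>R (complex_of_real (fejer K t) * (H t - H 0)))"
        by (intro integrable_unit_cell cf continuous_intros H)
      show "integrable lborel (\<lambda>t. indicator unit_cell t *\<^sub>R (fejer K t * (e / 2) + 4 * M / (c * real K)))"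
        by (intro integrable_unit_cell continuous_intros fejer_continuous)
      fix t :: real
      show "norm (indicator unit_cell t *\<^sub>R (complex_of_real (fejer K t) * (H t - H 0)))
          \<le> indicator unit_cell t *\<^sub>R (fejer K t * (e / 2) + 4 * M / (c * real K))"
      proof (cases "t \<in> unit_cell")
        case True
        have "fejer K t * D t \<le> fejer K t * (e / 2) + 4 * M / (c * real K)"
        proof (cases "\<bar>t\<bar> < d")
          case True
          have "fejer K t * D t \<le> fejer K t * (e / 2)"
            using d(2)[OF True] by (intro mult_left_mono fejer_nonneg) simp
          moreover have "0 \<le> 4 * M / (c * real K)" using M c by simp
          ultimately show ?thesis by linarith
        next
          case False
          then have tX: "t \<in> X" using True by (auto simp: X_def)
          have "fejer K t * c \<le> fejer K t * (norm (wave t - 1))\<^sup>2"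
            by (intro mult_left_mono fejer_nonneg c(2) tX)
          also have "\<dots> \<le> 4 / real K" by (rule fejer_decay)
          finally have "fejer K t \<le> 4 / (c * real K)" using c(1) K(1) by (simp add: field_simps)
          then have "fejer K t * D t \<le> 4 / (c * real K) * M"
            using M(1) M(2)[of t] True fejer_nonneg[of K t] c(1)
            by (intro mult_mono) (auto simp: D_def)
          moreover have "0 \<le> fejer K t * (e / 2)" using fejer_nonneg e by simp
          ultimately show ?thesis by simp
        qed
        then show ?thesis using True by (simp add: norm_mult D_def fejer_nonneg)
      qed simp
    qed
    also have "\<dots> = (LINT t|lborel. indicator unit_cell t *\<^sub>R fejer K t) * (e / 2)
        + (LINT t|lborel. indicator unit_cell t *\<^sub>R (4 * M / (c * real K)))"
    proof -
      have "(LINT t|lborel. indicator unit_cell t *\<^sub>R (fejer K t * (e / 2) + 4 * M / (c * real K)))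
          = (LINT t|lborel. indicator unit_cell t *\<^sub>R (fejer K t * (e / 2)))
           + (LINT t|lborel. indicator unit_cell t *\<^sub>R (4 * M / (c * real K)))"
        unfolding scaleR_add_right
        by (rule Bochner_Integration.integral_add) (intro integrable_unit_cell continuous_intros fejer_continuous)+
      then show ?thesis by (simp add: mult.assoc[symmetric])
    qed
    also have "\<dots> = e / 2 + 4 * M / (c * real K)"
      unfolding integral_fejer[OF K(1)] by simp
    also have "\<dots> < e"
      using K c(1) e by (simp add: field_simps)
    finally show "norm ((LINT t|lborel. indicator unit_cell t *\<^sub>R (of_real (fejer K t) * H t)) - H 0) < e" .
  qed
qed

section \<open>Poisson summation\<close>

lemma fejer_le: "fejer K t \<le> real K"
proof -
  have "norm (\<Sum>j\<in>{0..<int K}. wave (of_int j * t)) \<le> (\<Sum>j\<in>{0..<int K}. 1)"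
    by (rule sum_norm_le) simp
  then have "(norm (\<Sum>j\<in>{0..<int K}. wave (of_int j * t)))\<^sup>2 \<le> (real K)\<^sup>2"
    by (intro power_mono) auto
  then show ?thesis by (cases "K = 0") (simp_all add: fejer_def field_simps power2_eq_square)
qed

lemma fejer_periodic: "fejer K (t + of_int m) = fejer K t"
proof -
  have "wave (of_int j * (t + of_int m)) = wave (of_int j * t)" for j
  proof -
    have "wave (of_int j * (t + of_int m)) = wave (of_int j * t + of_int (j * m))"
      by (simp add: distrib_left)
    then show ?thesis by (simp only: wave_add wave_int mult_1_right)
  qed
  then show ?thesis by (simp add: fejer_def)
qed

text \<open>Test \<open>G t * wave (- (x * t))\<close> against the kernel \<open>fejer K (p * t)\<close>. Expanding the kernel turns the
  integral into a Cesaro mean of the left-hand series, which converges to its sum. Folding the integral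
  into one period turns it into the kernel applied to the periodization \<open>H\<close>, which converges to \<open>H 0\<close>, the
  right-hand series.\<close>
theorem poisson_summation:
  fixes G :: "real \<Rightarrow> complex"
  assumes G: "continuous_on UNIV G" and p: "p > 0" and q: "q = 1 / p"
    and B1: "integrable counting B1" "\<And>m y. \<bar>y\<bar> \<le> q \<Longrightarrow> norm (G (y + of_int m * q)) \<le> B1 m"
    and B2: "integrable counting B2" "\<And>n. norm (fourier_L1 G (x + of_int n * p)) \<le> B2 n"
  shows "of_real p * (LINT n|counting. fourier_L1 G (x + of_int n * p))
    = (LINT m|counting. G (of_int m * q) * wave (- (x * (of_int m * q))))"
proof -
  have q0: "q > 0" and pq: "p * q = 1" using p q by auto
  define E where "E m t = G (q * (t + of_int m)) * wave (- (x * (q * (t + of_int m))))" for m :: int and t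
  define H where "H t = (LINT m|counting. E m t)" for t
  have Econt: "continuous_on UNIV (E m)" for m
    unfolding E_def by (intro continuous_intros continuous_on_compose2[OF G]) auto
  have Ebound: "norm (E m t) \<le> B1 m" if "\<bar>t\<bar> \<le> 1" for m t
  proof -
    have "norm (G (q * t + of_int m * q)) \<le> B1 m"
      using that q0 by (intro B1(2)) (simp add: abs_mult)
    then show ?thesis by (simp add: E_def norm_mult algebra_simps)
  qed
  have Hcont: "isCont H t0" if "\<bar>t0\<bar> \<le> 1 / 2" for t0
    unfolding H_def
  proof (rule isCont_integral_dominated[OF _ B1(1), where d = "1 / 2"])
    show "norm (E m t) \<le> B1 m" if "\<bar>t - t0\<bar> < 1 / 2" for t m
      using that \<open>\<bar>t0\<bar> \<le> 1 / 2\<close> by (intro Ebound) linarith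
    show "isCont (\<lambda>t. E m t) t0" for m
      using Econt[of m] by (simp add: continuous_on_eq_continuous_at)
  qed auto
  \<comment> \<open>The bound on \<open>E\<close> makes \<open>H\<close> continuous near the cell only; clamping the argument extends it to the line.\<close>
  define H' where "H' t = H (max (- 1 / 2) (min (1 / 2) t))" for t
  have H'cont: "continuous_on UNIV H'"
    unfolding H'_def
  proof (rule continuous_on_compose2[where t = "{- 1 / 2..1 / 2}" and g = H])
    show "continuous_on {- 1 / 2..1 / 2} H"
      by (intro continuous_at_imp_continuous_on ballI Hcont) auto
  qed (auto intro!: continuous_intros)
  \<comment> \<open>The integrand in the scaled variable \<open>y = p * t\<close>, in which the kernel has period \<open>1\<close>.\<close>
  define h where "h K y = of_real (fejer K y) * E 0 y" for K y
  have hE: "h K (t + of_int m * 1) = of_real (fejer K t) * E m t" for K m t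
    using fejer_periodic[of K t m] by (simp add: h_def E_def)
  have fold: "(LINT y|lborel. h K y) = (LINT t|lborel. indicator unit_cell t *\<^sub>R (of_real (fejer K t) * H' t))" for K
  proof -
    have "continuous_on UNIV (h K)"
      unfolding h_def by (intro continuous_intros fejer_continuous Econt)
    then have "h K \<in> borel_measurable borel" by (rule borel_measurable_continuous_onI)
    then have "(LINT y|lborel. h K y)
      = (LINT t|lborel. indicator unit_cell t *\<^sub>R (LINT m|counting. h K (t + of_int m * 1)))"
    proof (rule periodization(2))
      show "integrable counting (\<lambda>m. real K * B1 m)" using B1(1) by simp
      show "norm (h K (t + of_int m * 1)) \<le> real K * B1 m" if "t \<in> unit_cell" for m t
      proof -
        have "\<bar>t\<bar> \<le> 1" using that by (auto simp: abs_le_iff)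
        then show ?thesis
          unfolding hE norm_mult using fejer_nonneg[of K t]
          by (intro mult_mono Ebound) (auto intro: fejer_le)
      qed
    qed simp
    also have "\<dots> = (LINT t|lborel. indicator unit_cell t *\<^sub>R (of_real (fejer K t) * H' t))"
    proof (rule Bochner_Integration.integral_cong[OF refl])
      show "indicator unit_cell t *\<^sub>R (LINT m|counting. h K (t + of_int m * 1))
          = indicator unit_cell t *\<^sub>R (of_real (fejer K t) * H' t)" for t
        by (cases "t \<in> unit_cell") (simp_all add: hE[simplified] H'_def H_def min_def max_def)
    qed
    finally show ?thesis .
  qed
  have Gm [measurable]: "G \<in> borel_measurable borel"
    using G by (rule borel_measurable_continuous_onI)
  have FT: "(LINT y|lborel. E 0 y * wave (- (of_int m * y))) = of_real p * fourier_L1 G (x + of_int m * p)" for m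
  proof -
    have "(LINT y|lborel. E 0 y * wave (- (of_int m * y)))
        = p *\<^sub>R (LINT t|lborel. E 0 (p * t) * wave (- (of_int m * (p * t))))"
      using lborel_integral_real_affine[of p "\<lambda>y. E 0 y * wave (- (of_int m * y))" 0] p by simp
    also have "(LINT t|lborel. E 0 (p * t) * wave (- (of_int m * (p * t))))
        = (LINT t|lborel. G t * wave (- ((x + of_int m * p) * t)))"
    proof (rule Bochner_Integration.integral_cong[OF refl])
      fix t
      have "q * (p * t) = t" using pq by (metis mult.assoc mult.commute mult_1)
      then have "E 0 (p * t) = G t * wave (- (x * t))"
        by (simp only: E_def of_int_0 add_0_right)
      moreover have "wave (- (x * t)) * wave (- (of_int m * (p * t))) = wave (- ((x + of_int m * p) * t))"
        by (simp flip: wave_add add: algebra_simps)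
      ultimately show "E 0 (p * t) * wave (- (of_int m * (p * t))) = G t * wave (- ((x + of_int m * p) * t))"
        by (simp add: mult.assoc)
    qed
    also have "\<dots> = fourier_L1 G (x + of_int m * p)"
      unfolding fourier_L1_wave by (rule integral_completion[symmetric]) measurable
    finally show ?thesis by (simp add: scaleR_conv_of_real)
  qed
  have E0int: "integrable lborel (\<lambda>y. E 0 y * wave (- (of_int m * y)))" for m
  proof (rule periodization(1)[where q = 1 and s = "- 1 / 2" and B = B1])
    show "(\<lambda>y. E 0 y * wave (- (of_int m * y))) \<in> borel_measurable borel"
      by (intro borel_measurable_continuous_onI continuous_intros Econt)
    show "norm (E 0 (t + of_int n * 1) * wave (- (of_int m * (t + of_int n * 1)))) \<le> B1 n"
      if "t \<in> unit_cell" for n t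
    proof -
      have "E 0 (t + of_int n * 1) = E n t" by (simp add: E_def)
      moreover have "\<bar>t\<bar> \<le> 1" using that by (auto simp: abs_le_iff)
      ultimately show ?thesis using Ebound by (simp add: norm_mult)
    qed
  qed (use B1 in auto)
  define s where "s n = fourier_L1 G (x + of_int n * p)" for n :: int
  define \<sigma> where "\<sigma> = (LINT n|counting. s n)"
  have mean: "(LINT y|lborel. h K y) = of_real p * ((\<Sum>l\<in>{0..<int K}. \<Sum>j\<in>{0..<int K}. s (j - l)) / of_nat K)" for K
  proof -
    have "(LINT y|lborel. h K y)
        = (LINT y|lborel. (\<Sum>l\<in>{0..<int K}. \<Sum>j\<in>{0..<int K}. E 0 y * wave (- (of_int (j - l) * y))) / of_nat K)"
      unfolding h_def fejer_expand by (simp add: sum_distrib_left mult.commute)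
    also have "\<dots> = (\<Sum>l\<in>{0..<int K}. \<Sum>j\<in>{0..<int K}. LINT y|lborel. E 0 y * wave (- (of_int (j - l) * y))) / of_nat K"
      unfolding integral_divide_zero
      by (subst Bochner_Integration.integral_sum; (intro Bochner_Integration.integrable_sum E0int)?)
         (subst Bochner_Integration.integral_sum; (intro Bochner_Integration.integrable_sum E0int refl)?)
    finally show ?thesis
      unfolding FT s_def by (simp add: sum_distrib_left)
  qed
  have "(\<lambda>K. (\<Sum>l\<in>{0..<int K}. \<Sum>j\<in>{0..<int K}. s (j - l)) / of_nat K - \<sigma>) \<longlonglongrightarrow> 0"
  proof (rule Lim_null_comparison[OF _ window_error_small[OF B2(1)]])
    have sB: "norm (s n) \<le> B2 n" for n unfolding s_def by (rule B2(2))
    show "0 \<le> B2 n" for n using order.trans[OF norm_ge_zero sB] .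
    show "\<forall>\<^sub>F K in sequentially. norm ((\<Sum>l\<in>{0..<int K}. \<Sum>j\<in>{0..<int K}. s (j - l)) / of_nat K - \<sigma>)
        \<le> window_error B2 K / real K"
      using eventually_gt_at_top[of 0]
    proof eventually_elim
      fix K :: nat assume K: "0 < K"
      have "(\<Sum>l\<in>{0..<int K}. \<Sum>j\<in>{0..<int K}. s (j - l)) / of_nat K - \<sigma>
          = ((\<Sum>l\<in>{0..<int K}. \<Sum>j\<in>{0..<int K}. s (j - l)) - of_nat K * \<sigma>) / of_nat K"
        using K by (simp add: diff_divide_distrib)
      then show "norm ((\<Sum>l\<in>{0..<int K}. \<Sum>j\<in>{0..<int K}. s (j - l)) / of_nat K - \<sigma>)
          \<le> window_error B2 K / real K"
        using window_sums_mean[OF B2(1) sB, of K]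
        by (simp add: norm_divide \<sigma>_def divide_right_mono)
    qed
  qed
  then have "(\<lambda>K. LINT y|lborel. h K y) \<longlonglongrightarrow> of_real p * \<sigma>"
    unfolding mean by (intro tendsto_intros) (simp add: LIM_zero_iff)
  moreover have "(\<lambda>K. LINT y|lborel. h K y) \<longlonglongrightarrow> H' 0"
    unfolding fold by (rule fejer_approximate_identity[OF H'cont])
  ultimately have "of_real p * \<sigma> = H' 0" by (rule LIMSEQ_unique)
  then show ?thesis by (simp add: \<sigma>_def s_def H'_def H_def E_def mult.commute[of q])
qed

section \<open>Lattice sums of eigenfunctions\<close>

text \<open>The discrete Fourier transform of order \<open>3\<close> has eigenvalues \<open>1\<close>, \<open>- 1\<close> and \<open>- \<i>\<close> after
  normalization by \<open>sqrt 3\<close>; so \<open>\<i>\<close> is not among them. Adding the last two equations gives a system for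
  \<open>S 0\<close> and \<open>S 1 + S 2\<close>, subtracting them one equation for \<open>S 1 - S 2\<close>.\<close>
lemma dft_no_eigenvalue_3:
  fixes S :: "int \<Rightarrow> complex"
  assumes eq: "\<And>r. r \<in> {0..<3} \<Longrightarrow> \<i> * of_real (sqrt 3) * S r = (\<Sum>r'\<in>{0..<3}. S r' * wave (- (of_int (r * r') / 3)))"
    and r: "r \<in> {0..<3}"
  shows "S r = 0"
proof -
  define t where "t = complex_of_real (sqrt 3)"
  define w where "w = wave (- (1 / 3))"
  have t2: "t * t = 3" unfolding t_def of_real_mult[symmetric] by simp
  have I: "{0..<3::int} = {0, 1, 2}" by auto
  have w2: "wave (- (2 / 3)) = w * w"
    unfolding w_def wave_add[symmetric] by simp
  have w4: "wave (- (4 / 3)) = w"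
  proof -
    have "wave (- (4 / 3)) = wave (- (1 / 3) + of_int (- 1))" by (rule arg_cong[where f = wave]) simp
    then show ?thesis unfolding wave_add wave_int w_def by simp
  qed
  have c: "2 * w = - 1 - t * \<i>"
  proof -
    have "2 * pi / 3 = pi - pi / 3" by simp
    then have "cos (2 * pi / 3) = - 1 / 2" "sin (2 * pi / 3) = sqrt 3 / 2"
      by (simp_all only: cos_pi_minus sin_pi_minus cos_60 sin_60)
    then show ?thesis
      unfolding w_def wave_def t_def by (simp add: complex_eq_iff)
  qed
  have "4 * (w * w) = (2 * w) * (2 * w)" by simp
  also have "\<dots> = 1 + 2 * (t * \<i>) + (t * t) * (\<i> * \<i>)" unfolding c by (simp add: algebra_simps)
  also have "\<dots> = 2 * (- 1 + t * \<i>)" by (simp add: t2)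
  finally have "2 * (2 * (w * w)) = 2 * (- 1 + t * \<i>)" by simp
  then have c2: "2 * (w * w) = - 1 + t * \<i>" by (simp only: mult_cancel_left, simp)
  have e0: "\<i> * t * S 0 = S 0 + S 1 + S 2"
    using eq[of 0] by (simp add: I t_def)
  have e1: "\<i> * t * S 1 = S 0 + S 1 * w + S 2 * (w * w)"
    using eq[of 1] w2 by (simp add: I t_def w_def)
  have e2: "\<i> * t * S 2 = S 0 + S 1 * (w * w) + S 2 * w"
    using eq[of 2] w2 w4 by (simp add: I t_def w_def)
  have ww: "w + w * w = - 1"
  proof -
    have "2 * (w + w * w) = 2 * (- 1)" using c c2 by (simp add: distrib_left)
    then show ?thesis by (simp only: mult_cancel_left, simp)
  qed
  have wd: "w - w * w = - (t * \<i>)"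
  proof -
    have "2 * (w - w * w) = 2 * (- (t * \<i>))" using c c2 by (simp add: right_diff_distrib)
    then show ?thesis by (simp only: mult_cancel_left, simp)
  qed
  define P where "P = S 1 + S 2"
  define D where "D = S 1 - S 2"
  have P0: "\<i> * t * S 0 = S 0 + P" using e0 by (simp add: P_def)
  have "\<i> * t * P = 2 * S 0 + P * (w + w * w)"
    using e1 e2 by (simp add: P_def algebra_simps)
  then have P1: "\<i> * t * P = 2 * S 0 - P" by (simp add: ww)
  have "P = \<i> * t * S 0 - S 0" using P0 by simp
  then have "\<i> * t * P = \<i> * t * (\<i> * t * S 0 - S 0)" by (rule arg_cong)
  also have "\<dots> = (\<i> * \<i>) * (t * t) * S 0 - \<i> * t * S 0"
    by (simp only: right_diff_distrib mult_ac)
  also have "\<dots> = - 3 * S 0 - (S 0 + P)" unfolding P0 t2 by simp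
  finally have "2 * S 0 - P = - 3 * S 0 - (S 0 + P)" unfolding P1 .
  then have "6 * S 0 = 0" by (simp add: algebra_simps)
  then have S0: "S 0 = 0" by simp
  then have P: "P = 0" using P0 by simp
  have "\<i> * t * D = D * (w - w * w)"
    using e1 e2 by (simp add: D_def algebra_simps)
  then have "2 * (\<i> * t) * D = 0" unfolding wd by (simp add: algebra_simps)
  moreover have "t \<noteq> 0" using t2 by auto
  ultimately have D: "D = 0" by simp
  have "2 * S 1 = P + D" "2 * S 2 = P - D" by (simp_all add: P_def D_def)
  then show ?thesis using S0 P D r by (auto simp: I)
qed

text \<open>The normalized transform of order \<open>4\<close> has eigenvalues \<open>1\<close> (twice), \<open>- 1\<close> and \<open>- \<i>\<close>, so again \<open>\<i>\<close>
  is missing. The equations are solved by passing to sums and differences of opposite entries.\<close>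
lemma dft_no_eigenvalue_4:
  fixes S :: "int \<Rightarrow> complex"
  assumes eq: "\<And>r. r \<in> {0..<4} \<Longrightarrow> \<i> * 2 * S r = (\<Sum>r'\<in>{0..<4}. S r' * wave (- (of_int (r * r') / 4)))"
    and r: "r \<in> {0..<4}"
  shows "S r = 0"
proof -
  have I: "{0..<4::int} = {0, 1, 2, 3}" by auto
  have sh: "wave (u - 1) = wave u" for u
    using wave_add[of u "of_int (- 1)"] wave_int[of "- 1"] by simp
  have w1: "wave (- (1 / 4)) = - \<i>"
    by (simp add: wave_def complex_eq_iff)
  have w2: "wave (- (1 / 2)) = - 1"
    using wave_add[of "- (1 / 4)" "- (1 / 4)"] w1 by simp
  have w3: "wave (- (3 / 4)) = \<i>"
    using wave_add[of "- (1 / 4)" "- (1 / 2)"] w1 w2 by simp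
  have w4: "wave (- 1) = 1" using sh[of 0] by simp
  have w6: "wave (- (3 / 2)) = - 1" using sh[of "- (1 / 2)"] w2 by simp
  have w9: "wave (- (9 / 4)) = - \<i>" using sh[of "- (5 / 4)"] sh[of "- (1 / 4)"] w1 by simp
  have e0: "\<i> * 2 * S 0 = S 0 + S 1 + S 2 + S 3"
    using eq[of 0] by (simp add: I)
  have e1: "\<i> * 2 * S 1 = S 0 - S 1 * \<i> - S 2 + S 3 * \<i>"
    using eq[of 1] w1 w2 w3 by (simp add: I)
  have e2: "\<i> * 2 * S 2 = S 0 - S 1 + S 2 - S 3"
    using eq[of 2] w2 w4 w6 by (simp add: I)
  have e3: "\<i> * 2 * S 3 = S 0 + S 1 * \<i> - S 2 - S 3 * \<i>"
    using eq[of 3] w3 w6 w9 by (simp add: I)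
  have "2 * ((\<i> - 1) * (S 0 + S 2)) = 0"
    using arg_cong2[OF e0 e2, of "(+)"] by (simp add: algebra_simps)
  moreover have "\<i> - 1 \<noteq> 0" by (simp add: complex_eq_iff)
  ultimately have A: "S 2 = - S 0" by (simp add: eq_neg_iff_add_eq_0 add.commute)
  have B: "\<i> * (2 * S 0) = S 1 + S 3"
    using e0 by (simp add: A mult.assoc)
  have C: "\<i> * (S 1 + S 3) = 2 * S 0"
  proof -
    have "2 * (\<i> * (S 1 + S 3)) = 2 * (2 * S 0)"
      using arg_cong2[OF e1 e3, of "(+)"] by (simp add: A algebra_simps)
    then show ?thesis by simp
  qed
  have "\<i> * (\<i> * (2 * S 0)) = 2 * S 0" unfolding B C ..
  then have S0: "S 0 = 0" by (simp add: mult.assoc[symmetric])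
  then have S3: "S 3 = - S 1" using B by (simp add: eq_neg_iff_add_eq_0 add.commute)
  have "4 * \<i> * S 1 = 0" using e1 by (simp add: S0 A S3)
  then have "S 1 = 0" by simp
  then show ?thesis using S0 A S3 r by (auto simp: I)
qed

lemma integral_counting_residues:
  fixes f :: "int \<Rightarrow> 'b::{banach, second_countable_topology}"
  assumes f: "integrable counting f" and N: "N > 0"
  shows "(LINT m|counting. f m) = (\<Sum>r\<in>{0..<N}. LINT n|counting. f (r + n * N))"
proof -
  define g where "g = (\<lambda>(r, n). r + n * N)"
  have bij: "bij_betw g ({0..<N} \<times> UNIV) UNIV"
    by (rule bij_betwI[of _ _ _ "\<lambda>m. (m mod N, m div N)"]) (use N in \<open>auto simp: g_def\<close>)
  have "Infinite_Set_Sum.abs_summable_on f UNIV"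
    using f by (simp add: Infinite_Set_Sum.abs_summable_on_def)
  then have s: "Infinite_Set_Sum.abs_summable_on (\<lambda>x. f (g x)) ({0..<N} \<times> UNIV)"
    by (subst Infinite_Set_Sum.abs_summable_on_reindex_bij_betw[OF bij])
  have "(LINT m|counting. f m) = infsetsum f UNIV" by (simp add: infsetsum_def)
  also have "\<dots> = infsetsum (\<lambda>x. f (g x)) ({0..<N} \<times> UNIV)"
    by (rule infsetsum_reindex_bij_betw[OF bij, symmetric])
  also have "\<dots> = infsetsum (\<lambda>r. infsetsum (\<lambda>n. f (g (r, n))) UNIV) {0..<N}"
    by (rule infsetsum_Times) (use s in auto)
  also have "\<dots> = (\<Sum>r\<in>{0..<N}. LINT n|counting. f (r + n * N))"
    by (simp add: g_def infsetsum_def lebesgue_integral_count_space_finite)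
  finally show ?thesis .
qed

text \<open>With \<open>p = sqrt N\<close> the lattice \<open>p \<int>\<close> has index \<open>N\<close> in its dual lattice \<open>(1 / p) \<int>\<close>. The
  Poisson formula expresses the sum of \<open>G\<close> over one coset of \<open>p \<int>\<close> by a sum over the dual lattice; split
  into cosets, this says that the vector of the \<open>N\<close> coset sums is an eigenvector of the discrete Fourier
  transform of order \<open>N\<close> with normalized eigenvalue \<open>\<i>\<close>, unless it is zero.\<close>
lemma lattice_sums_vanish:
  fixes G :: "real \<Rightarrow> complex" and N :: int
  assumes N: "N \<in> {3, 4}" and p: "p = sqrt (of_int N)"
    and G: "continuous_on UNIV G" and eig: "\<And>x. fourier_L1 G x = \<i> * G x"
    and A: "integrable counting A" "\<And>k. 0 \<le> A k" and GA: "\<And>x. norm (G x) \<le> A \<lfloor>x\<rfloor>"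
    and r: "r \<in> {0..<N}"
  shows "(LINT n|counting. G (of_int r / p + of_int n * p)) = 0"
proof -
  have N0: "N > 0" using N by auto
  have p0: "p > 0" using N0 by (simp add: p)
  have pp: "p * p = of_int N" using N0 by (simp add: p)
  define q where "q = 1 / p"
  have q0: "q > 0" using p0 by (simp add: q_def)
  obtain B1 where B1: "integrable counting B1" "\<And>n. 0 \<le> B1 n"
    "\<And>n y. \<bar>y\<bar> \<le> q \<Longrightarrow> A \<lfloor>y + of_int n * q\<rfloor> \<le> B1 n"
    using grid_envelope[OF A q0] by blast
  obtain B2 where B2: "integrable counting B2" "\<And>n. 0 \<le> B2 n"
    "\<And>n y. \<bar>y\<bar> \<le> p \<Longrightarrow> A \<lfloor>y + of_int n * p\<rfloor> \<le> B2 n"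
    using grid_envelope[OF A p0] by blast
  define S where "S r = (LINT n|counting. G (of_int r / p + of_int n * p))" for r :: int
  have dft: "\<i> * of_real p * S r = (\<Sum>r'\<in>{0..<N}. S r' * wave (- (of_int (r * r') / of_int N)))"
    if r: "r \<in> {0..<N}" for r
  proof -
    have rp: "\<bar>of_int r / p\<bar> \<le> p"
    proof -
      have "of_int r \<le> p * p" using r pp by simp
      then show ?thesis using r p0 by (simp add: field_simps)
    qed
    let ?f = "\<lambda>m. G (of_int m * q) * wave (- (of_int r / p * (of_int m * q)))"
    have f_int: "integrable counting ?f"
    proof (rule Bochner_Integration.integrable_bound[OF B1(1)])
      show "AE m in counting. norm (?f m) \<le> norm (B1 m)"
        using order.trans[OF GA B1(3)[of 0]] B1(2) q0 by (simp add: norm_mult)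
    qed auto
    have "of_real p * (LINT n|counting. fourier_L1 G (of_int r / p + of_int n * p)) = (LINT m|counting. ?f m)"
    proof (rule poisson_summation[OF G p0 q_def B1(1) _ B2(1)])
      show "norm (G (y + of_int m * q)) \<le> B1 m" if "\<bar>y\<bar> \<le> q" for m y
        using order.trans[OF GA B1(3)[OF that]] .
      show "norm (fourier_L1 G (of_int r / p + of_int n * p)) \<le> B2 n" for n
        using order.trans[OF GA B2(3)[OF rp]] by (simp add: eig norm_mult)
    qed
    also have "(LINT m|counting. ?f m) = (\<Sum>r'\<in>{0..<N}. LINT n|counting. ?f (r' + n * N))"
      by (rule integral_counting_residues[OF f_int N0])
    also have "\<dots> = (\<Sum>r'\<in>{0..<N}. S r' * wave (- (of_int (r * r') / of_int N)))"
    proof (rule sum.cong[OF refl])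
      fix r' :: int
      have "?f (r' + n * N) = G (of_int r' / p + of_int n * p) * wave (- (of_int (r * r') / of_int N))" for n
      proof -
        have 1: "of_int (r' + n * N) * q = of_int r' / p + of_int n * p"
          using p0 by (simp add: q_def field_simps flip: pp)
        have 2: "- (of_int r / p * (of_int r' / p + of_int n * p)) = - (of_int (r * r') / of_int N) + of_int (- (r * n))"
          using p0 by (simp add: field_simps flip: pp)
        show ?thesis unfolding 1 unfolding 2 wave_add wave_int by simp
      qed
      then show "(LINT n|counting. ?f (r' + n * N)) = S r' * wave (- (of_int (r * r') / of_int N))"
        by (simp add: S_def)
    qed
    finally show ?thesis by (simp add: eig S_def mult_ac)
  qed
  have "S r = 0"
    using N
  proof
    assume "N = 3"
    then show ?thesis using dft_no_eigenvalue_3[of S r] dft r by (simp add: p)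
  next
    assume "N \<in> {4}"
    then show ?thesis using dft_no_eigenvalue_4[of S r] dft r by (simp add: p)
  qed
  then show ?thesis by (simp add: S_def)
qed

section \<open>Combs as test functions for the lower frame bound\<close>

text \<open>The numbers squared here are, up to the smearing of width \<open>e\<close>, the frame coefficients of a finite
  piece of a Dirac comb. Sorting the translations \<open>k * a\<close> into classes modulo \<open>p\<close> turns each class into a
  windowed sum, whose full sum \<open>\<sigma> r x\<close> vanishes at \<open>x = 0\<close> by hypothesis. So the bound is \<open>o(K)\<close> for a
  long window plus a term proportional to \<open>K\<close> that is small for \<open>x\<close> near \<open>0\<close>.\<close>
lemma lattice_comb_small:
  fixes G :: "real \<Rightarrow> complex" and N :: int
  assumes N: "N > 0" and a: "a > 0" and p: "p = of_int N * a" and \<delta>: "\<delta> > 0"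
    and G: "continuous_on UNIV G"
    and B: "integrable counting B" "\<And>n y. \<bar>y\<bar> \<le> p \<Longrightarrow> norm (G (y + of_int n * p)) \<le> B n"
    and zero: "\<And>r. r \<in> {0..<N} \<Longrightarrow> (LINT n|counting. G (of_int r * a + of_int n * p)) = 0"
  obtains K e where "K > 0" "e > 0"
    "\<And>x F. x \<in> {0..e} \<Longrightarrow> finite F \<Longrightarrow>
      (\<Sum>k\<in>F. (norm (\<Sum>j\<in>{0..<int K}. G (x + of_int j * p - of_int k * a)))\<^sup>2) \<le> \<delta> * real K"
proof -
  have Bnn: "0 \<le> B n" for n
    using order.trans[OF norm_ge_zero B(2)[of 0]] p a N by simp
  define M where "M = (LINT n|counting. B n)"
  have M: "0 \<le> M" unfolding M_def by (simp add: Bochner_Integration.integral_nonneg Bnn)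
  define \<sigma> where "\<sigma> r x = (LINT n|counting. G (x + of_int r * a + of_int n * p))" for r :: int and x
  define \<Phi> where "\<Phi> x = (\<Sum>r\<in>{0..<N}. (norm (\<sigma> r x))\<^sup>2)" for x
  have range: "\<bar>x + of_int r * a\<bar> \<le> p" if "r \<in> {0..<N}" "\<bar>x\<bar> \<le> a" for r x
  proof -
    have "of_int r + 1 \<le> (of_int N :: real)" using that(1) by simp
    then have "(of_int r + 1) * a \<le> p" unfolding p using a by (intro mult_right_mono) auto
    then have "of_int r * a + a \<le> p" by (simp add: distrib_right)
    moreover have "0 \<le> of_int r * a" using that a by simp
    ultimately show ?thesis using that(2) by linarith
  qed
  have cont: "isCont (\<sigma> r) 0" if r: "r \<in> {0..<N}" for r
    unfolding \<sigma>_def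
  proof (rule isCont_integral_dominated[OF _ B(1) a])
    show "norm (G (t + of_int r * a + of_int n * p)) \<le> B n" if "\<bar>t - 0\<bar> < a" for t n
      using range[OF r, of t] that by (intro B(2)) simp
    have "continuous_on UNIV (\<lambda>t. G (t + of_int r * a + of_int n * p))" for n
      by (intro continuous_on_compose2[OF G] continuous_intros) auto
    then show "isCont (\<lambda>t. G (t + of_int r * a + of_int n * p)) 0" for n
      by (simp add: continuous_on_eq_continuous_at)
  qed auto
  have "isCont \<Phi> 0" unfolding \<Phi>_def by (intro continuous_intros cont)
  moreover have "\<Phi> 0 = 0" using zero by (simp add: \<Phi>_def \<sigma>_def)
  ultimately obtain d where d: "d > 0" "\<And>x. \<bar>x\<bar> < d \<Longrightarrow> \<bar>\<Phi> x\<bar> < \<delta> / 4"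
    using \<delta> unfolding continuous_at_eps_delta dist_real_def
    by (metis diff_zero zero_less_divide_iff zero_less_numeral)
  define e where "e = min (d / 2) a"
  have e: "e > 0" "e < d" "e \<le> a" using d a by (auto simp: e_def)
  have "(\<lambda>K. (2 * of_int N * M) * (window_error B K / real K)) \<longlonglongrightarrow> (2 * of_int N * M) * 0"
    by (intro tendsto_mult_left window_error_small B Bnn)
  then have "\<forall>\<^sub>F K in sequentially. (2 * of_int N * M) * (window_error B K / real K) < \<delta> / 2"
    using \<delta> by (intro order_tendstoD) auto
  with eventually_gt_at_top[of 0] have "\<forall>\<^sub>F K in sequentially. 0 < K \<and> (2 * of_int N * M) * (window_error B K / real K) < \<delta> / 2"
    by eventually_elim auto
  then obtain K :: nat where K: "K > 0" "(2 * of_int N * M) * (window_error B K / real K) < \<delta> / 2"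
    using eventually_happens'[OF sequentially_bot] by blast
  have "(\<Sum>k\<in>F. (norm (\<Sum>j\<in>{0..<int K}. G (x + of_int j * p - of_int k * a)))\<^sup>2) \<le> \<delta> * real K"
    if x: "x \<in> {0..e}" and F: "finite F" for x F
  proof -
    define s where "s r n = G (x + of_int r * a + of_int n * p)" for r n :: int
    \<comment> \<open>Division with the remainder subtracted, \<open>k = L k * N - R k\<close>, so that \<open>- k * a\<close> contributes \<open>+ R k * a\<close>
      and the classes are those of the hypothesis on the lattice sums.\<close>
    define R where "R k = (- k) mod N" for k
    define L where "L k = - ((- k) div N)" for k
    have k: "k = L k * N - R k" for k
    proof -
      have "- k = (- k) div N * N + (- k) mod N" by (rule div_mult_mod_eq[symmetric])
      then show ?thesis unfolding R_def L_def by linarith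
    qed
    have shifted: "(\<Sum>j\<in>{0..<int K}. G (x + of_int j * p - of_int k * a)) = (\<Sum>j\<in>{0..<int K}. s (R k) (j - L k))" for k
    proof (rule sum.cong[OF refl])
      fix j
      have "of_int k = of_int (L k) * of_int N - (of_int (R k) :: real)"
        by (subst k) simp
      then have "of_int k * a = of_int (L k) * p - of_int (R k) * a"
        by (simp add: p left_diff_distrib)
      then have "x + of_int j * p - of_int k * a = x + of_int (R k) * a + of_int (j - L k) * p"
        by (simp add: left_diff_distrib)
      then show "G (x + of_int j * p - of_int k * a) = s (R k) (j - L k)" unfolding s_def by (rule arg_cong)
    qed
    have inj: "inj_on (\<lambda>k. (R k, L k)) F"
      by (rule inj_onI) (metis k prod.inject)
    have sB: "norm (s r n) \<le> B n" if "r \<in> {0..<N}" for r n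
      unfolding s_def using range[OF that, of x] x e by (intro B(2)) auto
    have "(\<Sum>k\<in>F. (norm (\<Sum>j\<in>{0..<int K}. G (x + of_int j * p - of_int k * a)))\<^sup>2)
        = (\<Sum>(r, l)\<in>(\<lambda>k. (R k, L k)) ` F. (norm (\<Sum>j\<in>{0..<int K}. s r (j - l)))\<^sup>2)"
      unfolding shifted by (subst sum.reindex[OF inj]) simp
    also have "\<dots> \<le> (\<Sum>(r, l)\<in>{0..<N} \<times> L ` F. (norm (\<Sum>j\<in>{0..<int K}. s r (j - l)))\<^sup>2)"
      using F N by (intro sum_mono2) (auto simp: R_def)
    also have "\<dots> = (\<Sum>r\<in>{0..<N}. \<Sum>l\<in>L ` F. (norm (\<Sum>j\<in>{0..<int K}. s r (j - l)))\<^sup>2)"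
      by (rule sum.cartesian_product[symmetric])
    also have "\<dots> \<le> (\<Sum>r\<in>{0..<N}. 2 * M * window_error B K + 2 * real K * (norm (\<sigma> r x))\<^sup>2)"
    proof (rule sum_mono)
      fix r assume "r \<in> {0..<N}"
      from window_sums_square[OF B(1) sB[OF this], of "L ` F" K] F
      show "(\<Sum>l\<in>L ` F. (norm (\<Sum>j\<in>{0..<int K}. s r (j - l)))\<^sup>2)
          \<le> 2 * M * window_error B K + 2 * real K * (norm (\<sigma> r x))\<^sup>2"
        by (simp add: M_def \<sigma>_def s_def)
    qed
    also have "\<dots> = real K * ((2 * of_int N * M) * (window_error B K / real K)) + 2 * real K * \<Phi> x"
      using K(1) N by (simp add: sum.distrib sum_distrib_left \<Phi>_def)
    also have "\<dots> \<le> real K * (\<delta> / 2) + 2 * real K * (\<delta> / 4)"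
    proof (intro add_mono mult_left_mono)
      show "\<Phi> x \<le> \<delta> / 4" using d(2)[of x] x e by auto
    qed (use K in auto)
    finally show ?thesis by (simp add: algebra_simps)
  qed
  then show ?thesis using that K(1) e(1) by blast
qed

lemma integrable_Icc_continuous:
  fixes h :: "real \<Rightarrow> 'b::{banach, second_countable_topology}"
  assumes "continuous_on UNIV h"
  shows "integrable lborel (\<lambda>x. indicator {c..d} x *\<^sub>R h x)"
  by (rule borel_integrable_compact) (auto intro: continuous_on_subset[OF assms])

text \<open>Let \<open>s\<close> be the \<open>p\<close>-periodic trigonometric polynomial with coefficients \<open>c\<close> and \<open>S\<close> the left-hand side. Then
  \<open>S\<close> is the inner product of \<open>h\<close> (cut off to \<open>[0, e]\<close>) and \<open>s\<close>, while orthogonality gives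
  \<open>p * S\<close> for the squared norm of \<open>s\<close> over a period; the arithmetic-geometric mean inequality concludes.\<close>
lemma bessel_inequality:
  fixes h :: "real \<Rightarrow> complex"
  assumes h: "continuous_on UNIV h" and e: "0 < e" "e \<le> p" and F: "finite F"
  defines "c \<equiv> \<lambda>m::int. LINT x|lborel. indicator {0..e} x *\<^sub>R (h x * wave (- (of_int m * x / p)))"
  shows "(\<Sum>m\<in>F. (norm (c m))\<^sup>2) \<le> p * (LINT x|lborel. indicator {0..e} x *\<^sub>R (norm (h x))\<^sup>2)"
proof -
  have p: "p > 0" using e by simp
  define s where "s x = (\<Sum>m\<in>F. c m * wave (of_int m * x / p))" for x
  define S where "S = (\<Sum>m\<in>F. (norm (c m))\<^sup>2)"
  have wc: "continuous_on UNIV (\<lambda>x. wave (of_int m * x / p))" for m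
    unfolding divide_inverse by (intro continuous_intros)
  have wc': "continuous_on UNIV (\<lambda>x. wave (- (of_int m * x / p)))" for m
    unfolding divide_inverse by (intro continuous_intros)
  have sc: "continuous_on UNIV s" unfolding s_def by (intro continuous_intros wc)
  have cnj_s: "cnj (s x) = (\<Sum>m\<in>F. cnj (c m) * wave (- (of_int m * x / p)))" for x
    by (simp add: s_def wave_minus)
  have 1: "(LINT x|lborel. indicator {0..e} x *\<^sub>R (h x * cnj (s x))) = of_real S"
  proof -
    have "(LINT x|lborel. indicator {0..e} x *\<^sub>R (h x * cnj (s x)))
        = (LINT x|lborel. (\<Sum>m\<in>F. cnj (c m) * (indicator {0..e} x *\<^sub>R (h x * wave (- (of_int m * x / p))))))"
      unfolding cnj_s by (simp add: sum_distrib_left scaleR_sum_right mult_ac)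
    also have "\<dots> = (\<Sum>m\<in>F. cnj (c m) * c m)"
    proof -
      have i: "integrable lborel (\<lambda>x. cnj (c m) * (indicator {0..e} x *\<^sub>R (h x * wave (- (of_int m * x / p)))))" for m
        by (intro integrable_mult_right integrable_Icc_continuous continuous_on_mult h wc')
      have c: "(LINT x|lborel. indicator {0..e} x *\<^sub>R (h x * wave (- (of_int m * x / p)))) = c m" for m
        by (simp add: c_def)
      show ?thesis
        by (simp only: Bochner_Integration.integral_sum i integral_mult_right_zero c)
    qed
    also have "\<dots> = of_real S"
      unfolding S_def of_real_sum complex_norm_square by (simp add: mult.commute)
    finally show ?thesis .
  qed
  have 2: "(LINT x|lborel. indicator {0..p} x *\<^sub>R (norm (s x))\<^sup>2) = p * S"
  proof -
    have "complex_of_real (LINT x|lborel. indicator {0..p} x *\<^sub>R (norm (s x))\<^sup>2)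
        = (LINT x|lborel. complex_of_real (indicator {0..p} x *\<^sub>R (norm (s x))\<^sup>2))"
      by (rule integral_complex_of_real[symmetric])
    also have "\<dots> = (LINT x|lborel. (\<Sum>m\<in>F. \<Sum>n\<in>F. (c m * cnj (c n)) * (indicator {0..0 + p} x *\<^sub>R wave (of_int (m - n) * x / p))))"
    proof (rule Bochner_Integration.integral_cong[OF refl])
      fix x
      have "complex_of_real ((norm (s x))\<^sup>2) = (\<Sum>m\<in>F. \<Sum>n\<in>F. (c m * cnj (c n)) * wave (of_int (m - n) * x / p))"
      proof -
        have w: "wave (of_int m * x / p) * wave (- (of_int n * x / p)) = wave (of_int (m - n) * x / p)" for m n
          by (simp flip: wave_add add: left_diff_distrib diff_divide_distrib)
        have "complex_of_real ((norm (s x))\<^sup>2) = s x * cnj (s x)" by (rule complex_norm_square)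
        also have "\<dots> = (\<Sum>m\<in>F. \<Sum>n\<in>F. (c m * cnj (c n)) * (wave (of_int m * x / p) * wave (- (of_int n * x / p))))"
          unfolding cnj_s unfolding s_def by (simp add: sum_product mult_ac)
        finally show ?thesis unfolding w .
      qed
      then show "complex_of_real (indicator {0..p} x *\<^sub>R (norm (s x))\<^sup>2)
          = (\<Sum>m\<in>F. \<Sum>n\<in>F. (c m * cnj (c n)) * (indicator {0..0 + p} x *\<^sub>R wave (of_int (m - n) * x / p)))"
        by (cases "x \<in> {0..p}") simp_all
    qed
    also have "\<dots> = (\<Sum>m\<in>F. \<Sum>n\<in>F. (c m * cnj (c n)) * (LINT x|lborel. indicator {0..0 + p} x *\<^sub>R wave (of_int (m - n) * x / p)))"
    proof -
      have i: "integrable lborel (\<lambda>x. (c m * cnj (c n)) * (indicator {0..0 + p} x *\<^sub>R wave (of_int (m - n) * x / p)))" for m n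
        by (intro integrable_mult_right integrable_Icc_continuous wc)
      show ?thesis
        by (simp only: Bochner_Integration.integral_sum Bochner_Integration.integrable_sum i integral_mult_right_zero)
    qed
    also have "\<dots> = (\<Sum>m\<in>F. \<Sum>n\<in>F. if n = m then (c m * cnj (c n)) * of_real p else 0)"
      unfolding integral_period_wave[OF p] by (intro sum.cong refl) auto
    also have "\<dots> = (\<Sum>m\<in>F. (c m * cnj (c m)) * of_real p)" using F by simp
    also have "\<dots> = of_real (p * S)"
      unfolding S_def of_real_mult of_real_sum complex_norm_square
      by (simp add: sum_distrib_left mult_ac)
    finally show ?thesis by (simp only: of_real_eq_iff)
  qed
  have ci: "integrable lborel (\<lambda>x. indicator {0..d} x *\<^sub>R (norm (f x))\<^sup>2)" if "continuous_on UNIV f" for f :: "real \<Rightarrow> complex" and d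
    by (intro integrable_Icc_continuous continuous_intros that)
  have hs: "integrable lborel (\<lambda>x. indicator {0..e} x *\<^sub>R (h x * cnj (s x)))"
    by (intro integrable_Icc_continuous continuous_intros h sc)
  have "S = Re (LINT x|lborel. indicator {0..e} x *\<^sub>R (h x * cnj (s x)))" unfolding 1 by simp
  also have "\<dots> = (LINT x|lborel. Re (indicator {0..e} x *\<^sub>R (h x * cnj (s x))))"
    by (rule integral_Re[symmetric, OF hs])
  also have "\<dots> \<le> (LINT x|lborel. (p / 2) * (indicator {0..e} x *\<^sub>R (norm (h x))\<^sup>2) + (1 / (2 * p)) * (indicator {0..p} x *\<^sub>R (norm (s x))\<^sup>2))"
  proof (rule integral_mono)
    show "integrable lborel (\<lambda>x. Re (indicator {0..e} x *\<^sub>R (h x * cnj (s x))))"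
      by (rule integrable_Re[OF hs])
    show "integrable lborel (\<lambda>x. (p / 2) * (indicator {0..e} x *\<^sub>R (norm (h x))\<^sup>2) + (1 / (2 * p)) * (indicator {0..p} x *\<^sub>R (norm (s x))\<^sup>2))"
      by (intro Bochner_Integration.integrable_add integrable_mult_right ci h sc)
    fix x
    show "Re (indicator {0..e} x *\<^sub>R (h x * cnj (s x)))
      \<le> (p / 2) * (indicator {0..e} x *\<^sub>R (norm (h x))\<^sup>2) + (1 / (2 * p)) * (indicator {0..p} x *\<^sub>R (norm (s x))\<^sup>2)"
    proof (cases "x \<in> {0..e}")
      case True
      have "Re (h x * cnj (s x)) \<le> norm (h x) * norm (s x)"
        using complex_Re_le_cmod[of "h x * cnj (s x)"] by (simp add: norm_mult)
      also have "\<dots> \<le> (p / 2) * (norm (h x))\<^sup>2 + (1 / (2 * p)) * (norm (s x))\<^sup>2"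
        using zero_le_power2[of "p * norm (h x) - norm (s x)"] p
        by (simp add: power2_diff field_simps power2_eq_square)
      finally show ?thesis using True e by (simp add: indicator_def)
    next
      case False
      then have "Re (indicator {0..e} x *\<^sub>R (h x * cnj (s x))) = 0" by simp
      moreover have "0 \<le> (1 / (2 * p)) * (indicator {0..p} x *\<^sub>R (norm (s x))\<^sup>2)"
        using p by (simp add: indicator_def)
      ultimately show ?thesis using False by simp
    qed
  qed
  also have "\<dots> = (p / 2) * (LINT x|lborel. indicator {0..e} x *\<^sub>R (norm (h x))\<^sup>2) + (1 / (2 * p)) * (p * S)"
    unfolding 2[symmetric]
    by (subst Bochner_Integration.integral_add) (intro integrable_mult_right ci h sc | simp only: integral_mult_right_zero)+
  finally show ?thesis using p by (simp add: S_def field_simps)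
qed

text \<open>The test functions: \<open>K\<close> teeth of width \<open>e\<close> at the points of \<open>p \<int>\<close>, a truncated and smeared
  Dirac comb.\<close>
definition comb :: "real \<Rightarrow> real \<Rightarrow> nat \<Rightarrow> real \<Rightarrow> complex" where
  "comb p e K x = (\<Sum>j\<in>{0..<int K}. indicator {of_int j * p..of_int j * p + e} x)"

lemma comb_L2:
  assumes "p > 0" "e > 0"
  shows "comb p e K \<in> L2"
proof -
  have meas: "comb p e K \<in> borel_measurable borel"
    unfolding comb_def by measurable
  let ?I = "{0..real K * p + e}"
  have bound: "ennreal ((norm (comb p e K x))\<^sup>2) \<le> ennreal ((real K)\<^sup>2) * indicator ?I x" for x
  proof (cases "x \<in> ?I")
    case True
    have "norm (comb p e K x) \<le> (\<Sum>j\<in>{0..<int K}. 1)"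
      unfolding comb_def by (rule sum_norm_le) (simp add: indicator_def)
    then have "(norm (comb p e K x))\<^sup>2 \<le> (real K)\<^sup>2" by (intro power_mono) auto
    then show ?thesis using True by (simp add: ennreal_leI)
  next
    case False
    have sub: "{of_int j * p..of_int j * p + e} \<subseteq> ?I" if "j \<in> {0..<int K}" for j
    proof -
      have "of_int j * p \<le> real K * p" "0 \<le> of_int j * p"
        using that assms by (auto intro!: mult_right_mono)
      then show ?thesis by auto
    qed
    have "comb p e K x = 0"
      unfolding comb_def using False
    proof (intro sum.neutral ballI)
      fix j assume "j \<in> {0..<int K}" "x \<notin> ?I"
      then have "x \<notin> {of_int j * p..of_int j * p + e}"
        using sub by blast
      then show "indicator {of_int j * p..of_int j * p + e} x = (0 :: complex)"
        by (rule indicator_simps(2))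
    qed
    then show ?thesis by simp
  qed
  have "L2_sqnorm (comb p e K) \<le> (\<integral>\<^sup>+ x. ennreal ((real K)\<^sup>2) * indicator ?I x \<partial>lborel)"
    unfolding L2_sqnorm_def nn_integral_completion by (intro nn_integral_mono bound)
  also have "\<dots> < \<infinity>"
    by (subst nn_integral_cmult) (auto simp: emeasure_lborel_Icc_eq ennreal_mult_less_top)
  finally show ?thesis
    using borel_imp_lebesgue_measurable[OF meas] by (simp add: L2_def)
qed

text \<open>The value of the comb at a point is a natural number, hence at most its square, and its
  integral is \<open>e * K\<close>. This holds even where teeth overlap.\<close>
lemma comb_sqnorm_ge:
  assumes "e > 0"
  shows "ennreal (e * real K) \<le> L2_sqnorm (comb p e K)"
proof -
  let ?J = "\<lambda>j::int. {of_int j * p..of_int j * p + e}"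
  have "ennreal (e * real K) = (\<integral>\<^sup>+ x. (\<Sum>j\<in>{0..<int K}. indicator (?J j) x) \<partial>lborel)"
  proof -
    have "(\<integral>\<^sup>+ x. (\<Sum>j\<in>{0..<int K}. indicator (?J j) x) \<partial>lborel) = (\<Sum>j\<in>{0..<int K}. ennreal e)"
      using assms by (subst nn_integral_sum) auto
    also have "\<dots> = ennreal (e * real K)"
      using assms by (simp add: ennreal_mult mult.commute ennreal_of_nat_eq_real_of_nat)
    finally show ?thesis by simp
  qed
  also have "\<dots> \<le> (\<integral>\<^sup>+ x. ennreal ((norm (comb p e K x))\<^sup>2) \<partial>lborel)"
  proof (rule nn_integral_mono)
    fix x
    define i where "i j = (indicator (?J j) x :: real)" for j :: int
    define S where "S = (\<Sum>j\<in>{0..<int K}. i j)"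
    have i: "i j = 0 \<or> i j = 1" for j by (simp add: i_def indicator_def)
    have i0: "0 \<le> i j" for j using i[of j] by auto
    have c: "comb p e K x = of_real S"
      unfolding comb_def S_def i_def by (simp add: of_real_indicator)
    have "S \<le> (\<Sum>j\<in>{0..<int K}. i j * S)"
      unfolding S_def
    proof (rule sum_mono)
      fix j assume "j \<in> {0..<int K}"
      then have "i j \<le> (\<Sum>j\<in>{0..<int K}. i j)" by (intro member_le_sum i0) auto
      then show "i j \<le> i j * (\<Sum>j\<in>{0..<int K}. i j)" using i[of j] by auto
    qed
    also have "\<dots> = S\<^sup>2" by (simp add: S_def sum_distrib_right power2_eq_square)
    finally have "S \<le> (norm (comb p e K x))\<^sup>2" unfolding c by simp
    moreover have "(\<Sum>j\<in>{0..<int K}. indicator (?J j) x) = ennreal S"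
      unfolding S_def i_def by (simp add: sum_ennreal[symmetric] ennreal_indicator)
    ultimately show "(\<Sum>j\<in>{0..<int K}. indicator (?J j) x) \<le> ennreal ((norm (comb p e K x))\<^sup>2)"
      by (simp add: ennreal_leI)
  qed
  finally show ?thesis by (simp add: L2_sqnorm_def nn_integral_completion)
qed

text \<open>The modulations of step \<open>1 / p\<close> are \<open>p\<close>-periodic, so all teeth can be moved to \<open>[0, e]\<close> without
  changing the exponential: for fixed \<open>k\<close> the coefficients are the Fourier coefficients of one function
  on \<open>[0, e]\<close>.\<close>
lemma comb_inner_gabor:
  fixes G :: "real \<Rightarrow> complex" and a p e :: real and K :: nat
  assumes p: "p > 0" and e: "e > 0" and G: "continuous_on UNIV G"
    and g: "g \<in> borel_measurable lebesgue" and gG: "AE x in lebesgue. g x = G x"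
  defines "h \<equiv> \<lambda>k x. \<Sum>j\<in>{0..<int K}. cnj (G (x + of_int j * p - of_int k * a))"
  shows "L2_inner (comb p e K) (gabor_system g a (1 / p) (k, m))
    = (LINT x|lborel. indicator {0..e} x *\<^sub>R (h k x * wave (- (of_int m * x / p))))"
proof -
  let ?w = "\<lambda>x. wave (- (of_int m * x / p))"
  have wm [measurable]: "?w \<in> borel_measurable borel"
    unfolding divide_inverse by (intro borel_measurable_continuous_onI continuous_intros)
  have [measurable]: "G \<in> borel_measurable borel"
    using G by (rule borel_measurable_continuous_onI)
  have [measurable]: "comb p e K \<in> borel_measurable borel"
    unfolding comb_def by measurable
  have gab: "gabor_system g a (1 / p) (k, m) x = wave (of_int m * x / p) * g (x - of_int k * a)" for g x
    unfolding gabor_system_def exp_eq_wave by (simp add: mult.commute)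
  let ?F = "\<lambda>x. comb p e K x * cnj (wave (of_int m * x / p) * G (x - of_int k * a))"
  have cnjG [measurable]: "(\<lambda>x. cnj (G (x - of_int k * a))) \<in> borel_measurable borel"
    by (intro borel_measurable_continuous_onI continuous_intros continuous_on_compose2[OF G]) auto
  have cnj_meas: "cnj \<in> borel_measurable borel"
    by (intro borel_measurable_continuous_onI continuous_intros)
  have Fm: "?F \<in> borel_measurable borel"
    unfolding complex_cnj_mult wave_minus[symmetric] using cnjG wm by measurable
  have shift: "(\<lambda>x. g (x - of_int k * a)) \<in> borel_measurable lebesgue"
  proof -
    have "(\<lambda>x. x - of_int k * a) \<in> lebesgue \<rightarrow>\<^sub>M lebesgue"
      using lebesgue_affine_measurable[of "\<lambda>_. 1" "- (of_int k * a)"] by simp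
    from measurable_comp[OF this g] show ?thesis by (simp add: comp_def)
  qed
  have "L2_inner (comb p e K) (gabor_system g a (1 / p) (k, m)) = (LINT x|lebesgue. ?F x)"
    unfolding L2_inner_def gab
  proof (rule integral_cong_AE)
    show "(\<lambda>x. comb p e K x * cnj (wave (of_int m * x / p) * g (x - of_int k * a))) \<in> borel_measurable lebesgue"
      unfolding complex_cnj_mult wave_minus[symmetric]
      by (intro borel_measurable_times measurable_compose[OF shift cnj_meas] borel_imp_lebesgue_measurable wm) measurable
    show "?F \<in> borel_measurable lebesgue"
      by (rule borel_imp_lebesgue_measurable[OF Fm])
    show "AE x in lebesgue. comb p e K x * cnj (wave (of_int m * x / p) * g (x - of_int k * a)) = ?F x"
      using AE_lebesgue_translate[OF gG, of "of_int k * a"] by eventually_elim simp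
  qed
  also have "\<dots> = (LINT x|lborel. ?F x)"
    using Fm by (intro integral_completion) simp
  also have "\<dots> = (LINT x|lborel. (\<Sum>j\<in>{0..<int K}. indicator {of_int j * p..of_int j * p + e} x *\<^sub>R (?w x * cnj (G (x - of_int k * a)))))"
    by (intro Bochner_Integration.integral_cong refl)
       (simp add: comb_def sum_distrib_right wave_minus scaleR_conv_of_real of_real_indicator)
  also have "\<dots> = (\<Sum>j\<in>{0..<int K}. LINT x|lborel. indicator {of_int j * p..of_int j * p + e} x *\<^sub>R (?w x * cnj (G (x - of_int k * a))))"
  proof (rule Bochner_Integration.integral_sum)
    show "integrable lborel (\<lambda>x. indicator {of_int j * p..of_int j * p + e} x *\<^sub>R (?w x * cnj (G (x - of_int k * a))))" for j
      unfolding divide_inverse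
      by (intro integrable_Icc_continuous continuous_intros continuous_on_compose2[OF G]) auto
  qed
  also have "\<dots> = (\<Sum>j\<in>{0..<int K}. LINT x|lborel. indicator {0..e} x *\<^sub>R (cnj (G (x + of_int j * p - of_int k * a)) * ?w x))"
  proof (rule sum.cong[OF refl])
    fix j :: int
    let ?f = "\<lambda>x. indicator {of_int j * p..of_int j * p + e} x *\<^sub>R (?w x * cnj (G (x - of_int k * a)))"
    have "(LINT x|lborel. ?f x) = (LINT x|lborel. ?f (of_int j * p + 1 * x))"
      using lborel_integral_real_affine[of 1 ?f "of_int j * p"] by simp
    also have "\<dots> = (LINT x|lborel. indicator {0..e} x *\<^sub>R (cnj (G (x + of_int j * p - of_int k * a)) * ?w x))"
    proof (rule Bochner_Integration.integral_cong[OF refl])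
      fix x
      have "wave (- (of_int m * (of_int j * p + 1 * x) / p)) = wave (- (of_int m * x / p) + of_int (- (m * j)))"
        using p by (intro arg_cong[where f = wave]) (simp add: field_simps)
      then have "?w (of_int j * p + 1 * x) = ?w x"
        by (simp only: wave_add wave_int mult_1_right)
      then show "?f (of_int j * p + 1 * x) = indicator {0..e} x *\<^sub>R (cnj (G (x + of_int j * p - of_int k * a)) * ?w x)"
        by (simp add: indicator_def add.commute mult.commute)
    qed
    finally show "(LINT x|lborel. ?f x) = (LINT x|lborel. indicator {0..e} x *\<^sub>R (cnj (G (x + of_int j * p - of_int k * a)) * ?w x))" .
  qed
  also have "\<dots> = (LINT x|lborel. (\<Sum>j\<in>{0..<int K}. indicator {0..e} x *\<^sub>R (cnj (G (x + of_int j * p - of_int k * a)) * ?w x)))"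
  proof (rule Bochner_Integration.integral_sum[symmetric])
    show "integrable lborel (\<lambda>x. indicator {0..e} x *\<^sub>R (cnj (G (x + of_int j * p - of_int k * a)) * ?w x))" for j
      unfolding divide_inverse
      by (intro integrable_Icc_continuous continuous_intros continuous_on_compose2[OF G]) auto
  qed
  finally show ?thesis
    by (simp add: h_def sum_distrib_right scaleR_sum_right)
qed

text \<open>If all lattice sums vanish, the system annihilates the Dirac comb on \<open>p \<int>\<close>, so combs with
  many narrow teeth violate any lower frame bound \<open>A\<close>. Bessel's inequality removes the sum over the modulations
  and leaves the quantity of the previous estimate, where \<open>\<delta>\<close> is chosen to reach half of \<open>A\<close> times the norm.\<close>
theorem not_frame_if_lattice_sums_vanish:
  fixes G :: "real \<Rightarrow> complex" and N :: int
  assumes N: "N > 0" and a: "a > 0" and p: "p = of_int N * a"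
    and g: "g \<in> borel_measurable lebesgue" and gG: "AE x in lebesgue. g x = G x"
    and G: "continuous_on UNIV G"
    and B: "integrable counting B" "\<And>n y. \<bar>y\<bar> \<le> p \<Longrightarrow> norm (G (y + of_int n * p)) \<le> B n"
    and zero: "\<And>r. r \<in> {0..<N} \<Longrightarrow> (LINT n|counting. G (of_int r * a + of_int n * p)) = 0"
  shows "\<not> L2_frame (gabor_system g a (1 / p))"
proof
  assume "L2_frame (gabor_system g a (1 / p))"
  then obtain A where A: "A > 0"
    and lower: "\<And>f. f \<in> L2 \<Longrightarrow> ennreal A * L2_sqnorm f \<le> (\<Sum>\<^sub>\<infinity>i. ennreal ((norm (L2_inner f (gabor_system g a (1 / p) i)))\<^sup>2))"
    unfolding L2_frame_def by blast
  have p0: "p > 0" using N a by (simp add: p)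
  define \<delta> where "\<delta> = A / (2 * p)"
  have \<delta>: "\<delta> > 0" using A p0 by (simp add: \<delta>_def)
  obtain K e0 where K: "K > 0" "e0 > 0"
    and small: "\<And>x F. x \<in> {0..e0} \<Longrightarrow> finite F \<Longrightarrow>
      (\<Sum>k\<in>F. (norm (\<Sum>j\<in>{0..<int K}. G (x + of_int j * p - of_int k * a)))\<^sup>2) \<le> \<delta> * real K"
    using lattice_comb_small[OF N a p \<delta> G B zero] by blast
  define e where "e = min e0 p"
  have e: "e > 0" "e \<le> p" "e \<le> e0" using K p0 by (auto simp: e_def)
  define h where "h k x = (\<Sum>j\<in>{0..<int K}. cnj (G (x + of_int j * p - of_int k * a)))" for k :: int and x
  have hc: "continuous_on UNIV (h k)" for k
    unfolding h_def by (intro continuous_intros continuous_on_compose2[OF G]) auto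
  define c where "c k m = L2_inner (comb p e K) (gabor_system g a (1 / p) (k, m))" for k m
  have c: "c k m = (LINT x|lborel. indicator {0..e} x *\<^sub>R (h k x * wave (- (of_int m * x / p))))" for k m
    unfolding c_def h_def by (rule comb_inner_gabor[OF p0 e(1) G g gG])
  have hi: "integrable lborel (\<lambda>x. indicator {0..e} x *\<^sub>R (norm (h k x))\<^sup>2)" for k
    by (intro integrable_Icc_continuous continuous_intros hc)
  have upper: "(\<Sum>k\<in>F1. \<Sum>m\<in>F2. (norm (c k m))\<^sup>2) \<le> A / 2 * (e * real K)"
    if F: "finite F1" "finite F2" for F1 F2
  proof -
    have "(\<Sum>k\<in>F1. \<Sum>m\<in>F2. (norm (c k m))\<^sup>2) \<le> (\<Sum>k\<in>F1. p * (LINT x|lborel. indicator {0..e} x *\<^sub>R (norm (h k x))\<^sup>2))"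
      unfolding c by (intro sum_mono bessel_inequality hc e F)
    also have "\<dots> = p * (LINT x|lborel. (\<Sum>k\<in>F1. indicator {0..e} x *\<^sub>R (norm (h k x))\<^sup>2))"
      by (simp only: Bochner_Integration.integral_sum hi sum_distrib_left)
    also have "\<dots> \<le> p * (LINT x|lborel. indicator {0..e} x *\<^sub>R (\<delta> * real K))"
    proof (intro mult_left_mono integral_mono)
      show "integrable lborel (\<lambda>x. \<Sum>k\<in>F1. indicator {0..e} x *\<^sub>R (norm (h k x))\<^sup>2)"
        by (intro Bochner_Integration.integrable_sum hi)
      show "integrable lborel (\<lambda>x. indicator {0..e} x *\<^sub>R (\<delta> * real K))"
        by (intro integrable_Icc_continuous continuous_intros)
      show "(\<Sum>k\<in>F1. indicator {0..e} x *\<^sub>R (norm (h k x))\<^sup>2) \<le> indicator {0..e} x *\<^sub>R (\<delta> * real K)" for x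
      proof (cases "x \<in> {0..e}")
        case True
        have "norm (h k x) = norm (\<Sum>j\<in>{0..<int K}. G (x + of_int j * p - of_int k * a))" for k
          unfolding h_def by (subst cnj_sum[symmetric]) (rule complex_mod_cnj)
        then show ?thesis using small[of x F1] True e F by simp
      qed simp
    qed (use p0 in simp)
    also have "\<dots> = A / 2 * (e * real K)"
      using e(1) p0 by (simp add: \<delta>_def)
    finally show ?thesis .
  qed
  have "(\<Sum>\<^sub>\<infinity>i. ennreal ((norm (L2_inner (comb p e K) (gabor_system g a (1 / p) i)))\<^sup>2)) \<le> ennreal (A / 2 * (e * real K))"
  proof (subst nonneg_infsum_complete, simp, rule SUP_least, clarify)
    fix F :: "(int \<times> int) set" assume F: "finite F"
    have "(\<Sum>i\<in>F. (norm (L2_inner (comb p e K) (gabor_system g a (1 / p) i)))\<^sup>2)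
        \<le> (\<Sum>i\<in>fst ` F \<times> snd ` F. (norm (L2_inner (comb p e K) (gabor_system g a (1 / p) i)))\<^sup>2)"
      using F by (intro sum_mono2) (auto intro: rev_image_eqI)
    also have "\<dots> = (\<Sum>k\<in>fst ` F. \<Sum>m\<in>snd ` F. (norm (c k m))\<^sup>2)"
      unfolding sum.cartesian_product c_def by (rule sum.cong) auto
    also have "\<dots> \<le> A / 2 * (e * real K)" using F by (intro upper) auto
    finally show "(\<Sum>i\<in>F. ennreal ((norm (L2_inner (comb p e K) (gabor_system g a (1 / p) i)))\<^sup>2)) \<le> ennreal (A / 2 * (e * real K))"
      by (simp add: sum_ennreal ennreal_leI)
  qed
  moreover have "ennreal (A * (e * real K)) \<le> ennreal A * L2_sqnorm (comb p e K)"
    using mult_left_mono[OF comb_sqnorm_ge[OF e(1), of K p], of "ennreal A"] A e(1)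
    by (simp add: ennreal_mult)
  ultimately have "ennreal (A * (e * real K)) \<le> ennreal (A / 2 * (e * real K))"
    using lower[OF comb_L2[OF p0 e(1), of K]] by (meson order.trans)
  moreover have "A / 2 * (e * real K) < A * (e * real K)" using A e(1) K(1) by simp
  moreover have "0 \<le> A / 2 * (e * real K)" using A e(1) by simp
  ultimately show False by (simp add: ennreal_le_iff)
qed

section \<open>Hermite functions\<close>

text \<open>A class of rapidly decreasing functions that contains the Hermite functions and is closed under
  differentiation and multiplication by polynomials.\<close>
definition poly_gauss :: "real poly \<Rightarrow> real \<Rightarrow> real" where
  "poly_gauss P x = poly P x * exp (- (pi * x\<^sup>2))"

lemma poly_growth: "\<exists>C k. 0 \<le> C \<and> (\<forall>x::real. \<bar>poly P x\<bar> \<le> C * (1 + x\<^sup>2) ^ k)"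
proof (induction P)
  case 0
  then show ?case by (intro exI[of _ 0]) auto
next
  case (pCons a P)
  then obtain C k where C: "0 \<le> C" "\<And>x. \<bar>poly P x\<bar> \<le> C * (1 + x\<^sup>2) ^ k" by blast
  have "\<bar>poly (pCons a P) x\<bar> \<le> (\<bar>a\<bar> + C) * (1 + x\<^sup>2) ^ Suc k" for x
  proof -
    have x: "\<bar>x\<bar> \<le> 1 + x\<^sup>2"
      using zero_le_power2[of "\<bar>x\<bar> - 1"] by (simp add: power2_diff)
    have one: "1 \<le> (1 + x\<^sup>2) ^ Suc k" by (intro one_le_power) simp
    have "\<bar>poly (pCons a P) x\<bar> \<le> \<bar>a\<bar> + \<bar>x\<bar> * \<bar>poly P x\<bar>"
      by (simp add: abs_mult[symmetric])
    also have "\<dots> \<le> \<bar>a\<bar> * (1 + x\<^sup>2) ^ Suc k + (1 + x\<^sup>2) * (C * (1 + x\<^sup>2) ^ k)"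
    proof (intro add_mono mult_mono C x)
      show "\<bar>a\<bar> \<le> \<bar>a\<bar> * (1 + x\<^sup>2) ^ Suc k" using mult_left_mono[OF one, of "\<bar>a\<bar>"] by simp
    qed auto
    finally show ?thesis by (simp add: algebra_simps)
  qed
  then show ?case using C(1) by (intro exI[of _ "\<bar>a\<bar> + C"] exI[of _ "Suc k"]) auto
qed

lemma poly_gauss_bounded: "\<exists>C\<ge>0. \<forall>x. \<bar>poly_gauss P x\<bar> \<le> C"
proof -
  obtain C k where C: "0 \<le> C" "\<And>x. \<bar>poly P x\<bar> \<le> C * (1 + x\<^sup>2) ^ k"
    using poly_growth by blast
  have "\<bar>poly_gauss P x\<bar> \<le> C * (real (Suc k) ^ k * exp 1)" for x
  proof -
    \<comment> \<open>\<open>y ^ k = O(exp y)\<close> comes from \<open>z \<le> exp z\<close> at \<open>z = y / Suc k\<close>; the successor avoids division by \<open>0\<close>.\<close>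
    define y where "y = 1 + x\<^sup>2"
    have y: "y \<ge> 1" by (simp add: y_def)
    have "y / real (Suc k) \<le> exp (y / real (Suc k))" by (rule order.trans[OF _ exp_ge_add_one_self]) simp
    then have "y \<le> real (Suc k) * exp (y / real (Suc k))" by (simp add: field_simps)
    then have "y ^ k \<le> (real (Suc k) * exp (y / real (Suc k))) ^ k"
      using y by (intro power_mono) auto
    also have "\<dots> = real (Suc k) ^ k * exp (real k * (y / real (Suc k)))"
      by (simp only: power_mult_distrib exp_of_nat_mult)
    also have "\<dots> \<le> real (Suc k) ^ k * exp y"
      using y by (intro mult_left_mono) (auto simp: field_simps)
    finally have yk: "y ^ k \<le> real (Suc k) ^ k * exp y" .
    have "\<bar>poly_gauss P x\<bar> \<le> (C * y ^ k) * exp (- x\<^sup>2)"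
      unfolding poly_gauss_def abs_mult y_def
    proof (intro mult_mono C)
      have "1 * x\<^sup>2 \<le> pi * x\<^sup>2" using pi_ge_two by (intro mult_right_mono) auto
      then show "\<bar>exp (- (pi * x\<^sup>2))\<bar> \<le> exp (- x\<^sup>2)" by simp
    qed (use C in auto)
    also have "\<dots> \<le> (C * (real (Suc k) ^ k * exp y)) * exp (- x\<^sup>2)"
      by (intro mult_right_mono mult_left_mono yk C) auto
    also have "\<dots> = C * (real (Suc k) ^ k * exp 1)"
      by (simp add: y_def exp_add exp_minus)
    finally show ?thesis .
  qed
  then show ?thesis using C(1) by (intro exI[of _ "C * (real (Suc k) ^ k * exp 1)"]) auto
qed

text \<open>Multiplying the polynomial by \<open>1 + x\<^sup>2\<close> upgrades boundedness to decay.\<close>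
lemma poly_gauss_decay: "\<exists>C\<ge>0. \<forall>x. (1 + x\<^sup>2) * \<bar>poly_gauss P x\<bar> \<le> C"
proof -
  obtain C where C: "0 \<le> C" "\<And>x. \<bar>poly_gauss ([:1, 0, 1:] * P) x\<bar> \<le> C"
    using poly_gauss_bounded by blast
  have "(1 + x\<^sup>2) * \<bar>poly_gauss P x\<bar> = \<bar>poly_gauss ([:1, 0, 1:] * P) x\<bar>" for x
  proof -
    have "poly_gauss ([:1, 0, 1:] * P) x = (1 + x\<^sup>2) * poly_gauss P x"
      by (simp add: poly_gauss_def power2_eq_square distrib_right)
    then show ?thesis by (simp add: abs_mult)
  qed
  then show ?thesis using C by auto
qed

lemma poly_gauss_continuous [continuous_intros]: "continuous_on S (poly_gauss P)"
  unfolding poly_gauss_def by (intro continuous_intros)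

lemma poly_gauss_add: "poly_gauss (P + Q) x = poly_gauss P x + poly_gauss Q x"
  by (simp add: poly_gauss_def distrib_right)

lemma poly_gauss_smult: "poly_gauss (smult c P) x = c * poly_gauss P x"
  by (simp add: poly_gauss_def)

lemma poly_gauss_deriv:
  "(poly_gauss P has_real_derivative poly_gauss (pderiv P + [:0, - 2 * pi:] * P) x) (at x)"
  unfolding poly_gauss_def
  by (auto intro!: derivative_eq_intros simp: algebra_simps)

lemma le_inverse_1_plus_sq:
  fixes x y C :: real
  assumes "(1 + x\<^sup>2) * y \<le> C"
  shows "y \<le> C * inverse (1 + x\<^sup>2)"
proof -
  have "1 + x\<^sup>2 > 0" by (simp add: add_pos_nonneg)
  then show ?thesis using assms by (simp add: field_simps)
qed

lemma integrable_poly_gauss_mult: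
  assumes w: "continuous_on UNIV w" "\<And>x. norm (w x :: complex) \<le> 1"
  shows "integrable lborel (\<lambda>x. complex_of_real (poly_gauss P x) * w x)"
proof -
  obtain C where C: "0 \<le> C" "\<And>x. (1 + x\<^sup>2) * \<bar>poly_gauss P x\<bar> \<le> C"
    using poly_gauss_decay by blast
  have "continuous_on UNIV (\<lambda>x. complex_of_real (poly_gauss P x) * w x)"
    by (intro continuous_intros poly_gauss_continuous w)
  then have [measurable]: "(\<lambda>x. complex_of_real (poly_gauss P x) * w x) \<in> borel_measurable borel"
    by (rule borel_measurable_continuous_onI)
  show ?thesis
  proof (rule Bochner_Integration.integrable_bound[OF integrable_mult_right[OF integrable_inverse_1_plus_sq, of C]])
    show "AE x in lborel. norm (complex_of_real (poly_gauss P x) * w x) \<le> norm (C * inverse (1 + x\<^sup>2))"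
    proof (rule AE_I2)
      fix x :: real
      have "norm (complex_of_real (poly_gauss P x) * w x) \<le> \<bar>poly_gauss P x\<bar> * 1"
        unfolding norm_mult norm_of_real by (intro mult_left_mono w) auto
      also have "\<dots> \<le> C * inverse (1 + x\<^sup>2)" using le_inverse_1_plus_sq[OF C(2)] by simp
      finally show "norm (complex_of_real (poly_gauss P x) * w x) \<le> norm (C * inverse (1 + x\<^sup>2))"
        by (rule order.trans) simp
    qed
  qed simp
qed

lemma integrable_poly_gauss_wave:
  "integrable lborel (\<lambda>x. complex_of_real (poly_gauss P x) * wave (- (\<gamma> * x)))"
  by (rule integrable_poly_gauss_mult) (auto intro!: continuous_intros)

lemma fourier_L1_poly_gauss:
  "fourier_L1 (\<lambda>x. complex_of_real (poly_gauss P x)) \<gamma>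
    = (LINT x|lborel. complex_of_real (poly_gauss P x) * wave (- (\<gamma> * x)))"
  unfolding fourier_L1_wave
  by (rule integral_completion) (use borel_measurable_integrable[OF integrable_poly_gauss_wave] in simp)

lemma fourier_L1_poly_gauss_add:
  "fourier_L1 (\<lambda>x. complex_of_real (poly_gauss (P + Q) x)) \<gamma>
    = fourier_L1 (\<lambda>x. complex_of_real (poly_gauss P x)) \<gamma> + fourier_L1 (\<lambda>x. complex_of_real (poly_gauss Q x)) \<gamma>"
  unfolding fourier_L1_poly_gauss unfolding poly_gauss_add of_real_add distrib_right
  by (rule Bochner_Integration.integral_add) (rule integrable_poly_gauss_wave)+

lemma fourier_L1_poly_gauss_smult:
  "fourier_L1 (\<lambda>x. complex_of_real (poly_gauss (smult c P) x)) \<gamma>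
    = of_real c * fourier_L1 (\<lambda>x. complex_of_real (poly_gauss P x)) \<gamma>"
  unfolding fourier_L1_poly_gauss unfolding poly_gauss_smult of_real_mult mult.assoc
  by (rule integral_mult_right_zero)

lemma poly_gauss_tendsto_0:
  "(poly_gauss P \<longlongrightarrow> 0) at_top" "(poly_gauss P \<longlongrightarrow> 0) at_bot"
proof -
  obtain C where C: "0 \<le> C" "\<And>x. (1 + x\<^sup>2) * \<bar>poly_gauss P x\<bar> \<le> C"
    using poly_gauss_decay by blast
  have le: "norm (poly_gauss P x) \<le> C * inverse (1 + x\<^sup>2)" for x
    using le_inverse_1_plus_sq[OF C(2)] by simp
  have lim: "((\<lambda>x. C * inverse (1 + x\<^sup>2)) \<longlongrightarrow> 0) at_top" "((\<lambda>x. C * inverse (1 + x\<^sup>2)) \<longlongrightarrow> 0) at_bot"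
    by real_asymp+
  show "(poly_gauss P \<longlongrightarrow> 0) at_top"
    by (rule Lim_null_comparison[OF always_eventually[OF allI[OF le]] lim(1)])
  show "(poly_gauss P \<longlongrightarrow> 0) at_bot"
    by (rule Lim_null_comparison[OF always_eventually[OF allI[OF le]] lim(2)])
qed

text \<open>Integration by parts; the boundary terms vanish because of the decay.\<close>
lemma fourier_L1_poly_gauss_deriv:
  "fourier_L1 (\<lambda>x. complex_of_real (poly_gauss (pderiv P + [:0, - 2 * pi:] * P) x)) \<gamma>
    = 2 * of_real pi * \<i> * of_real \<gamma> * fourier_L1 (\<lambda>x. complex_of_real (poly_gauss P x)) \<gamma>"
proof -
  define Q where "Q = pderiv P + [:0, - 2 * pi:] * P"
  define k where "k = - (2 * complex_of_real pi * \<i> * of_real \<gamma>)"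
  have wk: "wave (- (\<gamma> * x)) = exp (k * of_real x)" for x
    unfolding exp_eq_wave[symmetric] k_def by (simp add: mult_ac)
  define F where "F x = complex_of_real (poly_gauss P x) * wave (- (\<gamma> * x))" for x
  define f where "f x = complex_of_real (poly_gauss Q x) * wave (- (\<gamma> * x)) + k * (complex_of_real (poly_gauss P x) * wave (- (\<gamma> * x)))" for x
  have fi: "integrable lborel f"
    unfolding f_def by (intro Bochner_Integration.integrable_add integrable_mult_right integrable_poly_gauss_wave)
  have "(LBINT x=-\<infinity>..\<infinity>. f x) = 0 - 0"
  proof (rule interval_integral_FTC_integrable)
    show "(F has_vector_derivative f x) (at x)" for x
    proof -
      have 1: "((\<lambda>x. complex_of_real (poly_gauss P x)) has_vector_derivative complex_of_real (poly_gauss Q x)) (at x)"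
        unfolding Q_def
        by (intro has_vector_derivative_of_real has_real_derivative_iff_has_vector_derivative[THEN iffD1] poly_gauss_deriv)
      have 2: "((\<lambda>x. wave (- (\<gamma> * x))) has_vector_derivative k * wave (- (\<gamma> * x))) (at x)"
        unfolding wk by (auto intro!: derivative_eq_intros has_vector_derivative_real_field)
      show ?thesis
        using has_vector_derivative_mult[OF 1 2] unfolding F_def f_def by (simp add: algebra_simps)
    qed
    show "isCont f x" for x
    proof -
      have "continuous_on UNIV f"
        unfolding f_def by (intro continuous_intros poly_gauss_continuous)
      then show ?thesis by (simp add: continuous_on_eq_continuous_at)
    qed
    show "set_integrable lborel (einterval (- \<infinity>) \<infinity>) f"
      using fi by (simp add: set_integrable_def einterval_def)
    have F0: "(F \<longlongrightarrow> 0) at_top" "(F \<longlongrightarrow> 0) at_bot"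
      using poly_gauss_tendsto_0[of P]
      by (auto simp: F_def norm_mult intro!: tendsto_norm_zero_cancel[of F] intro: tendsto_rabs_zero)
    show "((F \<circ> real_of_ereal) \<longlongrightarrow> 0) (at_right (- \<infinity>))"
      using F0(2) by (simp add: ereal_tendsto_simps)
    show "((F \<circ> real_of_ereal) \<longlongrightarrow> 0) (at_left \<infinity>)"
      using F0(1) by (simp add: ereal_tendsto_simps)
  qed simp
  then have "(LINT x|lborel. f x) = 0"
    by (simp add: interval_lebesgue_integral_def set_lebesgue_integral_def einterval_def)
  also have "(LINT x|lborel. f x) = (LINT x|lborel. complex_of_real (poly_gauss Q x) * wave (- (\<gamma> * x)))
      + k * (LINT x|lborel. complex_of_real (poly_gauss P x) * wave (- (\<gamma> * x)))"
    unfolding f_def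
    by (subst Bochner_Integration.integral_add) (auto intro!: integrable_poly_gauss_wave integrable_mult_right)
  finally show ?thesis
    unfolding fourier_L1_poly_gauss Q_def[symmetric] k_def by (simp add: eq_neg_iff_add_eq_0)
qed

text \<open>The characteristic function of the standard normal distribution, rescaled by \<open>sqrt (2 * pi)\<close>.\<close>
lemma fourier_L1_gauss:
  "fourier_L1 (\<lambda>x. complex_of_real (poly_gauss 1 x)) \<gamma> = complex_of_real (poly_gauss 1 \<gamma>)"
proof -
  define c where "c = sqrt (2 * pi)"
  have c: "c > 0" "c\<^sup>2 = 2 * pi" by (simp_all add: c_def)
  have "char std_normal_distribution (- (c * \<gamma>)) = (CLINT y|lborel. std_normal_density y *\<^sub>R iexp (- (c * \<gamma>) * y))"
    unfolding char_def by (subst integral_density) (auto simp: normal_density_nonneg)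
  also have "\<dots> = \<bar>c\<bar> *\<^sub>R (CLINT x|lborel. std_normal_density (0 + c * x) *\<^sub>R iexp (- (c * \<gamma>) * (0 + c * x)))"
    by (rule lborel_integral_real_affine) (use c in simp)
  also have "\<dots> = (CLINT x|lborel. c *\<^sub>R (std_normal_density (0 + c * x) *\<^sub>R iexp (- (c * \<gamma>) * (0 + c * x))))"
    by (simp only: abs_of_pos[OF c(1)] integral_scaleR_right)
  also have "\<dots> = (CLINT x|lborel. complex_of_real (poly_gauss 1 x) * wave (- (\<gamma> * x)))"
  proof (rule Bochner_Integration.integral_cong[OF refl])
    fix x
    have "c * std_normal_density (c * x) = poly_gauss 1 x"
      using c by (simp add: std_normal_density_def poly_gauss_def power_mult_distrib c_def)
    moreover have "iexp (- (c * \<gamma>) * (c * x)) = wave (- (\<gamma> * x))"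
    proof -
      have "- (c * \<gamma>) * (c * x) = - (2 * pi * (\<gamma> * x))"
        using c(2) by (simp add: power2_eq_square mult_ac)
      then have "iexp (- (c * \<gamma>) * (c * x)) = iexp (- (2 * pi * (\<gamma> * x)))" by (rule arg_cong)
      then show ?thesis unfolding wave_def cis_conv_exp by simp
    qed
    ultimately show "c *\<^sub>R (std_normal_density (0 + c * x) *\<^sub>R iexp (- (c * \<gamma>) * (0 + c * x)))
        = complex_of_real (poly_gauss 1 x) * wave (- (\<gamma> * x))"
      by (simp add: scaleR_conv_of_real mult.assoc[symmetric] flip: of_real_mult)
  qed
  finally have "(CLINT x|lborel. complex_of_real (poly_gauss 1 x) * wave (- (\<gamma> * x))) = exp (- ((c * \<gamma>)\<^sup>2 / 2))"
    unfolding char_std_normal_distribution by (simp add: exp_of_real)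
  then show ?thesis
    unfolding fourier_L1_poly_gauss using c(2)
    by (simp add: poly_gauss_def power_mult_distrib exp_of_real)
qed

text \<open>The recursion is the one obeyed by the polynomial factor of the \<open>n\<close>th derivative of
  \<open>exp (- 2 * pi * x\<^sup>2)\<close>; these are Hermite polynomials up to scaling.\<close>
fun hermite_poly :: "nat \<Rightarrow> real poly" where
  "hermite_poly 0 = 1"
| "hermite_poly (Suc n) = pderiv (hermite_poly n) + [:0, - 4 * pi:] * hermite_poly n"

lemma pderiv_hermite_poly: "pderiv (hermite_poly (Suc n)) = smult (- 4 * pi * real (Suc n)) (hermite_poly n)"
proof (induction n)
  case 0
  show ?case by (simp add: pderiv_add pderiv_mult pderiv_pCons)
next
  case (Suc n)
  let ?c = "- 4 * pi * real (Suc n)"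
  have X: "pderiv [:0, - 4 * pi:] = [:- 4 * pi:]" by (simp add: pderiv_pCons)
  have "pderiv (hermite_poly (Suc (Suc n)))
      = pderiv (pderiv (hermite_poly (Suc n))) + ([:0, - 4 * pi:] * pderiv (hermite_poly (Suc n)) + hermite_poly (Suc n) * [:- 4 * pi:])"
    by (subst hermite_poly.simps(2)) (simp only: pderiv_add pderiv_mult X)
  also have "\<dots> = smult ?c (pderiv (hermite_poly n) + [:0, - 4 * pi:] * hermite_poly n) + smult (- 4 * pi) (hermite_poly (Suc n))"
    unfolding Suc.IH by (simp only: pderiv_smult smult_add_right mult_smult_right) simp
  also have "\<dots> = smult (?c + - 4 * pi) (hermite_poly (Suc n))"
    by (simp only: hermite_poly.simps(2)[symmetric] smult_add_left)
  also have "?c + - 4 * pi = - 4 * pi * real (Suc (Suc n))" by (simp add: algebra_simps)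
  finally show ?case .
qed

text \<open>Writing \<open>q\<close> for the \<open>k\<close>th polynomial and \<open>u\<close> for its product with the Gaussian, the next one
  is the polynomial factor of \<open>2 * u'\<close> minus \<open>q'\<close>. The derivative \<open>u'\<close>
  transforms by integration by parts and \<open>q'\<close> is a multiple of the polynomial before \<open>q\<close>; so
  integration by parts carries the whole induction.\<close>
lemma fourier_L1_hermite_poly:
  "fourier_L1 (\<lambda>x. complex_of_real (poly_gauss (hermite_poly n) x)) \<gamma>
    = (- \<i>) ^ n * complex_of_real (poly_gauss (hermite_poly n) \<gamma>)"
proof (induction n rule: less_induct)
  case (less n)
  show ?case
  proof (cases n)
    case 0
    then show ?thesis using fourier_L1_gauss by simp
  next
    case (Suc k)
    let ?FT = "\<lambda>P. fourier_L1 (\<lambda>x. complex_of_real (poly_gauss P x)) \<gamma>"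
    let ?v = "\<lambda>P. complex_of_real (poly_gauss P \<gamma>)"
    let ?q = "hermite_poly k"
    have D: "?FT (pderiv ?q) = - ((- \<i>) ^ Suc k) * ?v (pderiv ?q)"
    proof (cases k)
      case 0
      then show ?thesis by (simp add: poly_gauss_def fourier_L1_wave)
    next
      case (Suc l)
      have "?FT (hermite_poly l) = (- \<i>) ^ l * ?v (hermite_poly l)"
        using less.IH[of l] \<open>n = Suc k\<close> Suc by simp
      then show ?thesis
        unfolding Suc pderiv_hermite_poly poly_gauss_smult[of _ _ \<gamma>] fourier_L1_poly_gauss_smult by simp
    qed
    have "smult 2 (pderiv ?q + [:0, - 2 * pi:] * ?q) = hermite_poly (Suc k) + pderiv ?q"
    proof -
      have "smult 2 ([:0, - 2 * pi:] * ?q) = [:0, - 4 * pi:] * ?q" by simp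
      moreover have "smult 2 (pderiv ?q) = pderiv ?q + pderiv ?q"
        using smult_add_left[of 1 1 "pderiv ?q"] by simp
      ultimately show ?thesis by (simp only: smult_add_right hermite_poly.simps(2))
    qed
    from arg_cong[OF this, of ?FT]
    have "?FT (hermite_poly (Suc k)) = 2 * (2 * of_real pi * \<i> * of_real \<gamma> * ?FT ?q) - ?FT (pderiv ?q)"
      unfolding fourier_L1_poly_gauss_smult fourier_L1_poly_gauss_deriv fourier_L1_poly_gauss_add
      by (simp add: algebra_simps)
    also have "?FT ?q = (- \<i>) ^ k * ?v ?q" using less.IH[of k] Suc by simp
    also have "2 * (2 * of_real pi * \<i> * of_real \<gamma> * ((- \<i>) ^ k * ?v ?q)) - ?FT (pderiv ?q)
        = (- \<i>) ^ Suc k * (?v (pderiv ?q) + of_real (- 4 * pi * \<gamma>) * ?v ?q)"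
      unfolding D by (simp add: algebra_simps)
    also have "?v (pderiv ?q) + of_real (- 4 * pi * \<gamma>) * ?v ?q = ?v (hermite_poly (Suc k))"
      by (simp add: poly_gauss_def algebra_simps)
    finally show ?thesis using Suc by simp
  qed
qed

lemma deriv_gauss_hermite:
  "(deriv ^^ n) (\<lambda>y. exp (- 2 * pi * y\<^sup>2)) = (\<lambda>x. poly (hermite_poly n) x * exp (- 2 * pi * x\<^sup>2))"
proof (induction n)
  case (Suc n)
  have "(deriv ^^ Suc n) (\<lambda>y. exp (- 2 * pi * y\<^sup>2)) = deriv (\<lambda>x. poly (hermite_poly n) x * exp (- 2 * pi * x\<^sup>2))"
    by (simp only: funpow.simps comp_def Suc)
  also have "\<dots> = (\<lambda>x. poly (hermite_poly (Suc n)) x * exp (- 2 * pi * x\<^sup>2))"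
    by (intro ext DERIV_imp_deriv) (auto intro!: derivative_eq_intros simp: algebra_simps)
  finally show ?case .
qed simp

lemma hermite_fun_eq: "hermite_fun n x = poly_gauss (smult (hermite_const n powr (- 1 / 2)) (hermite_poly n)) x"
proof -
  have "exp (pi * x\<^sup>2) * exp (- 2 * pi * x\<^sup>2) = exp (- (pi * x\<^sup>2))"
    by (simp flip: exp_add)
  then show ?thesis
    unfolding hermite_fun_def deriv_gauss_hermite poly_gauss_smult
    unfolding poly_gauss_def by (simp only: mult_ac flip: \<open>exp (pi * x\<^sup>2) * exp (- 2 * pi * x\<^sup>2) = exp (- (pi * x\<^sup>2))\<close>)
qed

lemma poly_gauss_L2: "(\<lambda>x. complex_of_real (poly_gauss P x)) \<in> L2"
proof -
  obtain C where C: "0 \<le> C" "\<And>x. (1 + x\<^sup>2) * \<bar>poly_gauss P x\<bar> \<le> C"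
    using poly_gauss_decay by blast
  show ?thesis
  proof (rule decay_imp_L2)
    show "(\<lambda>x. complex_of_real (poly_gauss P x)) \<in> borel_measurable borel"
      by (intro borel_measurable_continuous_onI continuous_intros poly_gauss_continuous)
    fix x :: real
    have "1 * \<bar>poly_gauss P x\<bar> \<le> (1 + x\<^sup>2) * \<bar>poly_gauss P x\<bar>" by (intro mult_right_mono) auto
    then have "\<bar>poly_gauss P x\<bar> \<le> C" using C(2)[of x] by simp
    then have "(1 + x\<^sup>2) * \<bar>poly_gauss P x\<bar> * \<bar>poly_gauss P x\<bar> \<le> C * C"
      by (intro mult_mono C) auto
    then show "(1 + x\<^sup>2) * (norm (complex_of_real (poly_gauss P x)))\<^sup>2 \<le> C * C"
      by (simp add: power2_eq_square mult.assoc)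
  qed
qed

lemma sum_int_inverse_square_bounded:
  fixes F :: "int set"
  assumes "finite F"
  shows "(\<Sum>k\<in>F. inverse (1 + (of_int k)\<^sup>2)) \<le> 3 * (LINT x|lborel. inverse (1 + x\<^sup>2 :: real))"
proof -
  have i: "integrable lborel (\<lambda>x::real. indicator {of_int k..<of_int k + 1} x * inverse (1 + (of_int k)\<^sup>2) :: real)" for k :: int
    by (intro integrable_mult_left integrable_real_indicator) auto
  have "(\<Sum>k\<in>F. inverse (1 + (of_int k)\<^sup>2))
      = (\<Sum>k\<in>F. LINT x|(lborel :: real measure). indicator {of_int k..<of_int k + 1} x * (inverse (1 + (of_int k)\<^sup>2) :: real))"
    by simp
  also have "\<dots> = (LINT x|(lborel :: real measure). (\<Sum>k\<in>F. indicator {of_int k..<of_int k + 1} x * inverse (1 + (of_int k)\<^sup>2) :: real))"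
    by (rule Bochner_Integration.integral_sum[symmetric]) (rule i)
  also have "\<dots> \<le> (LINT x|lborel. 3 * inverse (1 + x\<^sup>2 :: real))"
  proof (rule integral_mono)
    show "integrable lborel (\<lambda>x::real. (\<Sum>k\<in>F. indicator {of_int k..<of_int k + 1} x * inverse (1 + (of_int k)\<^sup>2) :: real))"
      by (intro Bochner_Integration.integrable_sum i)
    show "integrable lborel (\<lambda>x. 3 * inverse (1 + x\<^sup>2 :: real))"
      by (intro integrable_mult_right integrable_inverse_1_plus_sq)
    fix x :: real
    define k where "k = \<lfloor>x\<rfloor>"
    have "(\<Sum>l\<in>F. indicator {of_int l..<of_int l + 1} x * inverse (1 + (of_int l)\<^sup>2) :: real)
        = (\<Sum>l\<in>F. if l = k then inverse (1 + (of_int k)\<^sup>2) else 0)"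
    proof (rule sum.cong[OF refl])
      fix l
      have "x \<in> {of_int l..<of_int l + 1} \<longleftrightarrow> l = k"
        unfolding k_def eq_commute[of l] by (auto simp: floor_eq_iff)
      then show "indicator {of_int l..<of_int l + 1} x * inverse (1 + (of_int l)\<^sup>2)
          = (if l = k then inverse (1 + (of_int k)\<^sup>2) else (0::real))"
        by (simp add: indicator_def)
    qed
    also have "\<dots> \<le> inverse (1 + (of_int k)\<^sup>2)" using assms by simp
    also have "\<dots> \<le> 3 * inverse (1 + x\<^sup>2)"
    proof -
      define d where "d = x - of_int k"
      have d: "0 \<le> d" "d \<le> 1" unfolding d_def k_def by linarith+
      then have "d\<^sup>2 \<le> 1" by (simp add: power_le_one)
      moreover have "x\<^sup>2 + (of_int k - d)\<^sup>2 = 2 * (of_int k)\<^sup>2 + 2 * d\<^sup>2"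
        by (simp add: d_def power2_eq_square algebra_simps)
      moreover have "0 \<le> (of_int k - d)\<^sup>2" by simp
      ultimately have "x\<^sup>2 \<le> 2 * (of_int k)\<^sup>2 + 2" by linarith
      then have "1 + x\<^sup>2 \<le> 3 * (1 + (of_int k)\<^sup>2)"
        using zero_le_power2[of "of_int k :: real"] by argo
      then have "inverse (3 * (1 + (of_int k)\<^sup>2)) \<le> inverse (1 + x\<^sup>2)"
        by (intro le_imp_inverse_le) (simp_all add: add_pos_nonneg)
      then show ?thesis unfolding inverse_mult_distrib by simp
    qed
    finally show "(\<Sum>l\<in>F. indicator {of_int l..<of_int l + 1} x * inverse (1 + (of_int l)\<^sup>2) :: real) \<le> 3 * inverse (1 + x\<^sup>2)" .
  qed
  finally show ?thesis by simp
qed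

lemma poly_gauss_wiener: "(\<lambda>x. complex_of_real (poly_gauss P x)) \<in> wiener_space"
proof -
  obtain C where C: "0 \<le> C" "\<And>x. (1 + x\<^sup>2) * \<bar>poly_gauss P x\<bar> \<le> C"
    using poly_gauss_decay by blast
  have meas: "(\<lambda>x. ennreal (norm (complex_of_real (poly_gauss P (x + c))))) \<in> borel_measurable lebesgue" for c
  proof -
    have "(\<lambda>x. ennreal (norm (complex_of_real (poly_gauss P (x + c))))) \<in> borel_measurable borel"
      by (intro measurable_compose[OF _ measurable_ennreal] borel_measurable_continuous_onI continuous_intros
          continuous_on_compose2[OF poly_gauss_continuous]) auto
    then show ?thesis by (rule borel_imp_lebesgue_measurable)
  qed
  have glob: "esssup lebesgue (\<lambda>x. ennreal (norm (complex_of_real (poly_gauss P x)))) < \<infinity>"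
  proof -
    have "\<bar>poly_gauss P x\<bar> \<le> C" for x
    proof -
      have "1 * \<bar>poly_gauss P x\<bar> \<le> (1 + x\<^sup>2) * \<bar>poly_gauss P x\<bar>" by (intro mult_right_mono) auto
      then show ?thesis using C(2)[of x] by simp
    qed
    then have "esssup lebesgue (\<lambda>x. ennreal (norm (complex_of_real (poly_gauss P x)))) \<le> ennreal C"
      using meas[of 0] by (intro esssup_I AE_I2) (auto intro: ennreal_leI)
    then show ?thesis by (simp add: le_less_trans)
  qed
  let ?e = "\<lambda>k::int. esssup (lebesgue_on {0..1}) (\<lambda>x. ennreal (norm (complex_of_real (poly_gauss P (x + of_int k)))))"
  have cell: "?e k \<le> ennreal (3 * C * inverse (1 + (of_int k)\<^sup>2))" for k
  proof (rule esssup_I)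
    show "(\<lambda>x. ennreal (norm (complex_of_real (poly_gauss P (x + of_int k))))) \<in> borel_measurable (lebesgue_on {0..1})"
      by (rule measurable_restrict_space1[OF meas])
    show "AE x in lebesgue_on {0..1}. ennreal (norm (complex_of_real (poly_gauss P (x + of_int k)))) \<le> ennreal (3 * C * inverse (1 + (of_int k)\<^sup>2))"
    proof (rule AE_I2)
      fix x :: real assume "x \<in> space (lebesgue_on {0..1})"
      then have x: "0 \<le> x" "x \<le> 1" by auto
      define y where "y = x + of_int k"
      have "x\<^sup>2 \<le> 1" using x by (simp add: power_le_one)
      moreover have "(of_int k)\<^sup>2 + (y + x)\<^sup>2 = 2 * y\<^sup>2 + 2 * x\<^sup>2"
        by (simp add: y_def power2_eq_square algebra_simps)
      moreover have "0 \<le> (y + x)\<^sup>2" by simp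
      ultimately have "(of_int k)\<^sup>2 \<le> 2 * y\<^sup>2 + 2" by linarith
      then have "1 + (of_int k)\<^sup>2 \<le> 3 * (1 + y\<^sup>2)" using zero_le_power2[of y] by argo
      then have "(1 + (of_int k)\<^sup>2) * \<bar>poly_gauss P y\<bar> \<le> 3 * (1 + y\<^sup>2) * \<bar>poly_gauss P y\<bar>"
        by (intro mult_right_mono) auto
      also have "\<dots> \<le> 3 * C" unfolding mult.assoc by (intro mult_left_mono C(2)) simp
      finally have "\<bar>poly_gauss P y\<bar> \<le> 3 * C * inverse (1 + (of_int k)\<^sup>2)"
        by (rule le_inverse_1_plus_sq)
      then show "ennreal (norm (complex_of_real (poly_gauss P (x + of_int k)))) \<le> ennreal (3 * C * inverse (1 + (of_int k)\<^sup>2))"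
        by (intro ennreal_leI) (simp add: y_def)
    qed
  qed
  define I where "I = 3 * (LINT x|lborel. inverse (1 + x\<^sup>2 :: real))"
  have "(\<Sum>\<^sub>\<infinity>k. ?e k) \<le> ennreal (3 * C * I)"
  proof (subst nonneg_infsum_complete, simp, rule SUP_least, clarify)
    fix F :: "int set" assume F: "finite F"
    have "sum ?e F \<le> (\<Sum>k\<in>F. ennreal (3 * C * inverse (1 + (of_int k)\<^sup>2)))"
      by (intro sum_mono cell)
    also have "\<dots> = ennreal (3 * C * (\<Sum>k\<in>F. inverse (1 + (of_int k)\<^sup>2)))"
      using C(1) by (simp add: sum_ennreal sum_distrib_left)
    also have "\<dots> \<le> ennreal (3 * C * I)"
      unfolding I_def using C(1) by (intro ennreal_leI mult_left_mono sum_int_inverse_square_bounded F) auto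
    finally show "sum ?e F \<le> ennreal (3 * C * I)" .
  qed
  then have "(\<Sum>\<^sub>\<infinity>k. ?e k) < \<infinity>" by (simp add: le_less_trans)
  moreover have "(\<lambda>x. complex_of_real (poly_gauss P x)) \<in> borel_measurable lebesgue"
    by (intro borel_imp_lebesgue_measurable borel_measurable_continuous_onI continuous_intros poly_gauss_continuous)
  ultimately show ?thesis using glob by (simp add: wiener_space_def)
qed

lemma hermite_fun_eigen: "(\<lambda>x. complex_of_real (hermite_fun n x)) \<in> fourier_eigenspace n"
proof -
  define c where "c = hermite_const n powr (- 1 / 2)"
  let ?f = "\<lambda>x. complex_of_real (hermite_fun n x)"
  have f: "?f = (\<lambda>x. complex_of_real (poly_gauss (smult c (hermite_poly n)) x))"
    by (simp add: hermite_fun_eq c_def)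
  have L2: "?f \<in> L2" unfolding f by (rule poly_gauss_L2)
  have "integrable lborel (\<lambda>x. complex_of_real (poly_gauss (smult c (hermite_poly n)) x) * 1)"
    by (rule integrable_poly_gauss_mult) auto
  then have "integrable lborel ?f" unfolding f by simp
  then have int: "integrable lebesgue ?f"
    using borel_measurable_integrable[of lborel ?f] by (intro integrable_completion[THEN iffD2])
  have FT: "fourier_L1 ?f \<gamma> = (- \<i>) ^ n * ?f \<gamma>" for \<gamma>
  proof -
    have "fourier_L1 ?f \<gamma> = of_real c * fourier_L1 (\<lambda>x. complex_of_real (poly_gauss (hermite_poly n) x)) \<gamma>"
      unfolding f by (rule fourier_L1_poly_gauss_smult)
    also have "\<dots> = (- \<i>) ^ n * ?f \<gamma>"
      unfolding fourier_L1_hermite_poly by (simp add: hermite_fun_eq c_def poly_gauss_smult)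
    finally show ?thesis .
  qed
  have "L2_sqnorm (\<lambda>\<gamma>. (- \<i>) ^ n * ?f \<gamma>) = L2_sqnorm ?f"
    unfolding L2_sqnorm_def by (simp add: norm_mult norm_power)
  then have "(\<lambda>\<gamma>. (- \<i>) ^ n * ?f \<gamma>) \<in> L2"
    using L2 by (auto simp: L2_def intro!: borel_measurable_times)
  moreover have "L2_sqnorm (\<lambda>x. 0) = 0" by (simp add: L2_sqnorm_def)
  ultimately have "is_fourier_L2 ?f (\<lambda>\<gamma>. (- \<i>) ^ n * ?f \<gamma>)"
    unfolding is_fourier_L2_def using L2 int by (intro conjI exI[of _ "\<lambda>_. ?f"]) (auto simp: FT)
  then show ?thesis using L2 by (simp add: fourier_eigenspace_def)
qed

section \<open>Failure of the frame property\<close>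

text \<open>Both parameter pairs are \<open>(1 / p, 1 / p)\<close> with \<open>p\<close> the square root of \<open>3\<close> or \<open>4\<close>, and
  \<open>p = N * (1 / p)\<close>.\<close>
lemma eigenfunction_not_frame:
  fixes N :: int
  assumes g: "g \<in> fourier_eigenspace 3" "g \<in> wiener_space" and N: "N \<in> {3, 4}"
  shows "\<not> L2_frame (gabor_system g (1 / sqrt (of_int N)) (1 / sqrt (of_int N)))"
proof -
  define p where "p = sqrt (of_int N)"
  have p: "p > 0" "p * p = of_int N" using N by (auto simp: p_def)
  obtain G A where G: "continuous_on UNIV G" and gG: "AE x in lebesgue. g x = G x"
    and eig: "\<And>x. fourier_L1 G x = (- \<i>) ^ 3 * G x"
    and A: "integrable counting A" "\<And>k. 0 \<le> A k" and GA: "\<And>x. norm (G x) \<le> A \<lfloor>x\<rfloor>"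
    using eigenfunction_representative[OF g] by blast
  have eig': "fourier_L1 G x = \<i> * G x" for x
    using eig by (simp add: power3_eq_cube)
  obtain B where B: "integrable counting B" "\<And>n. 0 \<le> B n"
    "\<And>n y. \<bar>y\<bar> \<le> p \<Longrightarrow> A \<lfloor>y + of_int n * p\<rfloor> \<le> B n"
    using grid_envelope[OF A p(1)] by blast
  have "\<not> L2_frame (gabor_system g (1 / p) (1 / p))"
  proof (rule not_frame_if_lattice_sums_vanish[where N = N and G = G and B = B])
    show "N > 0" using N by auto
    show "1 / p > 0" using p(1) by simp
    show "p = of_int N * (1 / p)" using p by (simp add: field_simps)
    show "g \<in> borel_measurable lebesgue" using g(2) by (simp add: wiener_space_def)
    show "norm (G (y + of_int n * p)) \<le> B n" if "\<bar>y\<bar> \<le> p" for n y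
      using GA B(3)[OF that] by (rule order.trans)
    show "(LINT n|counting. G (of_int r * (1 / p) + of_int n * p)) = 0" if "r \<in> {0..<N}" for r
      using lattice_sums_vanish[OF N p_def G eig' A GA that] by simp
  qed (use gG G B in auto)
  then show ?thesis by (simp add: p_def)
qed

theorem theorem8:
  fixes a b :: real
  assumes "(a, b) \<in> {(1 / sqrt 3, 1 / sqrt 3), (1 / 2, 1 / 2)}"
  shows "(\<forall>g \<in> fourier_eigenspace 3 \<inter> wiener_space. \<not> L2_frame (gabor_system g a b)) \<and>
    (\<forall>n m :: nat. n = 4 * m + 3 \<longrightarrow>
       \<not> L2_frame (gabor_system (\<lambda>x. complex_of_real (hermite_fun n x)) a b))"
proof -
  have main: "\<not> L2_frame (gabor_system g a b)" if g: "g \<in> fourier_eigenspace 3" "g \<in> wiener_space" for g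
  proof -
    from assms consider "a = 1 / sqrt 3" "b = 1 / sqrt 3" | "a = 1 / 2" "b = 1 / 2" by blast
    then show ?thesis
    proof cases
      case 1
      then show ?thesis using eigenfunction_not_frame[OF g, of 3] by simp
    next
      case 2
      have "\<not> L2_frame (gabor_system g (1 / 2) (1 / 2))"
        using eigenfunction_not_frame[OF g, of 4] by simp
      then show ?thesis unfolding 2 .
    qed
  qed
  moreover have "(\<lambda>x. complex_of_real (hermite_fun n x)) \<in> fourier_eigenspace 3 \<inter> wiener_space"
    if "n = 4 * m + 3" for n m
  proof -
    have "(- \<i>) ^ n = (- \<i>) ^ 3" by (simp add: that power_add power_mult)
    then have "(\<lambda>x. complex_of_real (hermite_fun n x)) \<in> fourier_eigenspace 3"
      using hermite_fun_eigen[of n] by (simp add: fourier_eigenspace_def)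
    then show ?thesis using poly_gauss_wiener by (simp add: hermite_fun_eq)
  qed
  ultimately show ?thesis by blast
qed

end
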